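(* Let $(X,\mathcal{B}(X),\mu)$ be a probability space, and let $(T_1^{s})_{s\in\mathbb{R}}$, $(T_2^{s})_{s\in\mathbb{R}}$ be two commuting measure-preserving flows on $X$ such that the mapping $X\times\mathbb{R}^2\to X$, $(x,t_1,t_2)\mapsto T_1^{t_1}T_2^{t_2}x$, is measurable. Suppose $f,g\in L^\infty(X)$. Then the limit $$\lim_{N\to\infty}\frac{1}{N^2}\int_{[0,N]^2}f\big(T_1^{t_1}T_2^{t_2}x\big)\,g\big(T_1^{t_1^2+t_2^2}T_2^{t_1^3+t_2^3}x\big)\,dt_1\,dt_2$$ exists for $\mu$-almost every $x\in X$.
   Context: A measure-preserving flow $(T^s)_{s\in\mathbb{R}}$ is a one-parameter group of measure-preserving transformations of $X$ ($T^{s+s'}=T^sT^{s'}$, $T^0=\mathrm{id}$). Commuting means $T_1^{s}T_2^{s'}=T_2^{s'}T_1^{s}$ for all $s,s'\in\mathbb{R}$. The limit is taken over real $N\to\infty$. *)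

theory Defs
  imports "HOL-Probability.Probability"
begin

definition measure_preserving_map :: "'a measure \<Rightarrow> ('a \<Rightarrow> 'a) \<Rightarrow> bool" where
  "measure_preserving_map M T \<longleftrightarrow> T \<in> measurable M M \<and> distr M M T = M"

definition measure_preserving_flow :: "'a measure \<Rightarrow> (real \<Rightarrow> 'a \<Rightarrow> 'a) \<Rightarrow> bool" where
  "measure_preserving_flow M T \<longleftrightarrow>
     (\<forall>s. measure_preserving_map M (T s)) \<and>
     (\<forall>x\<in>space M. T 0 x = x) \<and>
     (\<forall>s s'. \<forall>x\<in>space M. T (s + s') x = T s (T s' x))"

definition commuting_flows ::
    "'a measure \<Rightarrow> (real \<Rightarrow> 'a \<Rightarrow> 'a) \<Rightarrow> (real \<Rightarrow> 'a \<Rightarrow> 'a) \<Rightarrow> bool" where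
  "commuting_flows M T1 T2 \<longleftrightarrow>
     (\<forall>s s'. \<forall>x\<in>space M. T1 s (T2 s' x) = T2 s' (T1 s x))"

(* Members are representatives, not classes modulo null sets; the scalars are complex. *)
definition L_infinity :: "'a measure \<Rightarrow> ('a \<Rightarrow> complex) set" where
  "L_infinity M = {f \<in> borel_measurable M. \<exists>C::real. AE x in M. norm (f x) \<le> C}"

(* Changing f and g on null sets alters this only for x in a null set, uniformly in N: for
   almost every x the integrand changes only for (t1, t2) in a Lebesgue null set. Likewise,
   for almost every x the integrand is integrable on every square, so the default value 0
   of a divergent Bochner integral does not interfere with almost-everywhere statements. *)
definition double_average ::
    "(real \<Rightarrow> 'a \<Rightarrow> 'a) \<Rightarrow> (real \<Rightarrow> 'a \<Rightarrow> 'a) \<Rightarrow> ('a \<Rightarrow> complex) \<Rightarrow> ('a \<Rightarrow> complex) \<Rightarrow>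
     real \<Rightarrow> 'a \<Rightarrow> complex" where
  "double_average T1 T2 f g N x =
     (1 / N\<^sup>2) *\<^sub>R
     (LINT t:{0..N} \<times> {0..N}|lborel.
        (case t of (t1, t2) \<Rightarrow>
          f (T1 t1 (T2 t2 x)) * g (T1 (t1\<^sup>2 + t2\<^sup>2) (T2 (t1^3 + t2^3) x))))"

end

theory Submission
  imports Defs
begin

text \<open>
  Write \<open>U\<^sub>t = T\<^sub>1\<^bsup>t\<^sub>1\<^esup> T\<^sub>2\<^bsup>t\<^sub>2\<^esup>\<close> for the action of the plane and \<open>P(t) = (t\<^sub>1\<^sup>2 + t\<^sub>2\<^sup>2, t\<^sub>1\<^sup>3 + t\<^sub>2\<^sup>3)\<close>.
  The point is that \<open>P\<close> maps the plane to the plane, that it is locally invertible off a null set, and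
  that it expands: near a point of size \<open>N\<close>, a fixed displacement \<open>v\<close> of \<open>P(t)\<close> is caused by a displacement
  of \<open>t\<close> of size only \<open>O(1/N)\<close>. If \<open>f\<close> is uniformly continuous along orbits, such a displacement of
  \<open>t\<close> is invisible to \<open>f(U\<^sub>t x)\<close>, so replacing \<open>g\<close> by \<open>g \<circ> U\<^sub>v\<close> does not change the asymptotics of the
  averages (\<open>shift_average_tendsto_0\<close>). Hence \<open>g\<close> may be replaced by its mean over a large square of
  translates, and this mean is close to an invariant function \<open>g'\<close>, the limit of such means.
  For the invariant function the average is \<open>g'(x)\<close> times the average of \<open>f\<close> over a square, which
  converges by the ergodic theorem. The limit is therefore the product of the orbit means of
  \<open>f\<close> and \<open>g\<close> (\<open>bilin_limit\<close>).

  Three ingredients make this rigorous almost everywhere. The ergodic theorem for two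
  transformations, with independent lengths in the two directions, gives pointwise convergence
  over the rectangles \<open>[0,a] \<times> [0,b]\<close>; it follows from the maximal ergodic inequality applied once in
  each direction. Since \<open>P(N s)\<close> arises from \<open>P(s)\<close> by the dilation with factors \<open>N\<^sup>2\<close> and \<open>N\<^sup>3\<close>, the
  image under \<open>P\<close> of Lebesgue measure on the unit square is a measure with integrable density
  whose dilates govern all the averages at once; truncating the density bounds the averages
  along \<open>P\<close> of a nonnegative function by its means over rectangles, up to a small multiple of its
  supremum (\<open>power_sums_average_le\<close>), and this controls the error made by passing from the means of
  \<open>g\<close> to \<open>g'\<close>. Finally, the means of \<open>f\<close> over small squares are uniformly continuous along orbits and
  approximate \<open>f\<close> in the mean, and the error is controlled by the ergodic theorem once more.
\<close>

section \<open>The ergodic theorem for one transformation\<close>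

lemma (in finite_measure) integrable_bounded:
  fixes f :: "'a \<Rightarrow> real"
  assumes "f \<in> borel_measurable M" "\<And>x. x \<in> space M \<Longrightarrow> \<bar>f x\<bar> \<le> C"
  shows "integrable M f"
  using assms by (intro integrable_const_bound[where B=C]) auto

locale measure_preserving = prob_space M for M :: "'a measure" +
  fixes \<tau> :: "'a \<Rightarrow> 'a"
  assumes \<tau>_meas[measurable]: "\<tau> \<in> measurable M M"
    and \<tau>_distr: "distr M M \<tau> = M"
begin

lemma \<tau>_space: "x \<in> space M \<Longrightarrow> \<tau> x \<in> space M"
  using \<tau>_meas by (rule measurable_space)

lemma \<tau>_iter_space: "x \<in> space M \<Longrightarrow> (\<tau> ^^ k) x \<in> space M"
  by (induction k) (auto intro: \<tau>_space)

lemma \<tau>_iter_meas[measurable]: "\<tau> ^^ k \<in> measurable M M"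
  by (induction k) (auto simp: id_def)

lemma integral_comp:
  fixes f :: "'a \<Rightarrow> real"
  assumes "f \<in> borel_measurable M"
  shows "(\<integral>x. f (\<tau> x) \<partial>M) = (\<integral>x. f x \<partial>M)"
  using integral_distr[OF \<tau>_meas assms] by (simp add: \<tau>_distr)

text \<open>
  The largest of the sums \<open>h + h \<circ> \<tau> + \<dots> + h \<circ> \<tau>\<^bsup>k-1\<^esup>\<close> with \<open>k \<le> n\<close>, the empty sum included.
\<close>
fun max_sum :: "('a \<Rightarrow> real) \<Rightarrow> nat \<Rightarrow> 'a \<Rightarrow> real" where
  "max_sum h 0 x = 0"
| "max_sum h (Suc n) x = max 0 (h x + max_sum h n (\<tau> x))"

lemma max_sum_nonneg: "0 \<le> max_sum h n x"
  by (cases n) auto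

lemma max_sum_meas[measurable]:
  assumes [measurable]: "h \<in> borel_measurable M"
  shows "max_sum h n \<in> borel_measurable M"
proof (induction n)
  case (Suc n)
  note [measurable] = Suc
  have "(\<lambda>x. max 0 (h x + max_sum h n (\<tau> x))) \<in> borel_measurable M" by measurable
  then show ?case by (simp add: max_sum.simps(2)[abs_def])
qed (simp add: max_sum.simps(1)[abs_def])

lemma max_sum_Suc_mono: "max_sum h n x \<le> max_sum h (Suc n) x"
proof (induction n arbitrary: x)
  case (Suc n)
  show ?case using Suc[of "\<tau> x"] by simp
qed simp

lemma max_sum_bound:
  assumes "\<And>x. x \<in> space M \<Longrightarrow> \<bar>h x\<bar> \<le> C" "x \<in> space M"
  shows "\<bar>max_sum h n x\<bar> \<le> n * C"
  using assms(2)
proof (induction n arbitrary: x)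
  case (Suc n)
  from Suc(1)[of "\<tau> x"] \<tau>_space[OF Suc(2)] assms(1)[OF Suc(2)] show ?case
    by (auto simp: algebra_simps max_def)
qed simp

lemma sum_le_max_sum: "n \<le> m \<Longrightarrow> (\<Sum>k<n. h ((\<tau> ^^ k) x)) \<le> max_sum h m x"
proof (induction m arbitrary: x n)
  case (Suc m)
  show ?case
  proof (cases n)
    case (Suc n')
    have "(\<Sum>k<n. h ((\<tau> ^^ k) x)) = h x + (\<Sum>k<n'. h ((\<tau> ^^ k) (\<tau> x)))"
      by (simp add: Suc sum.lessThan_Suc_shift funpow_swap1 del: sum.lessThan_Suc)
    with Suc.IH[of n' "\<tau> x"] Suc.prems Suc show ?thesis by simp
  qed (simp add: max_sum_nonneg del: max_sum.simps)
qed simp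

text \<open>
  Where the maximal sum is positive it is at most \<open>h\<close> plus its own value at the image point, and
  elsewhere it does not exceed that value. As \<open>\<tau>\<close> preserves the integral, \<open>h\<close> has a nonnegative
  integral over the set of positivity, and these sets exhaust the space.
\<close>
lemma maximal_ergodic:
  fixes h :: "'a \<Rightarrow> real"
  assumes [measurable]: "h \<in> borel_measurable M"
    and bd: "\<And>x. x \<in> space M \<Longrightarrow> \<bar>h x\<bar> \<le> C"
    and pos: "\<And>x. x \<in> space M \<Longrightarrow> \<exists>n. (\<Sum>k<n. h ((\<tau> ^^ k) x)) > 0"
  shows "0 \<le> (\<integral>x. h x \<partial>M)"
proof (rule tendsto_lowerbound)
  let ?I = "\<lambda>n x. if max_sum h n x > 0 then h x else 0"
  show "(\<lambda>n. \<integral>x. ?I n x \<partial>M) \<longlonglongrightarrow> (\<integral>x. h x \<partial>M)"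
  proof (rule integral_dominated_convergence[where w="\<lambda>_. C"])
    show "AE x in M. (\<lambda>n. ?I n x) \<longlonglongrightarrow> h x"
    proof (rule AE_I2)
      fix x assume x: "x \<in> space M"
      obtain n where n: "(\<Sum>k<n. h ((\<tau> ^^ k) x)) > 0" using pos[OF x] by blast
      have "max_sum h m x > 0" if "m \<ge> n" for m
        using sum_le_max_sum[OF that, of h x] n by simp
      then have "\<forall>\<^sub>F m in sequentially. ?I m x = h x"
        unfolding eventually_sequentially by (intro exI[of _ n]) auto
      then show "(\<lambda>n. ?I n x) \<longlonglongrightarrow> h x" by (rule tendsto_eventually)
    qed
    show "AE x in M. norm (?I n x) \<le> C" for n
      using bd by (intro AE_I2) force
  qed (use bd in auto)
  have "0 \<le> (\<integral>x. ?I n x \<partial>M)" for n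
  proof -
    let ?m = "max_sum h n"
    have int: "integrable M ?m" "integrable M (\<lambda>x. ?m (\<tau> x))"
      using max_sum_bound[OF bd] \<tau>_space
      by (auto intro!: integrable_bounded[where C="n*C"])
    have "0 = (\<integral>x. ?m x \<partial>M) - (\<integral>x. ?m (\<tau> x) \<partial>M)"
      by (subst integral_comp) auto
    also have "\<dots> = (\<integral>x. ?m x - ?m (\<tau> x) \<partial>M)" using int by simp
    also have "\<dots> \<le> (\<integral>x. ?I n x \<partial>M)"
    proof (rule integral_mono)
      show "integrable M (?I n)"
        using bd by (intro integrable_bounded[where C=C]) force+
      fix x assume "x \<in> space M"
      show "?m x - ?m (\<tau> x) \<le> ?I n x"
      proof (cases "?m x > 0")
        case True
        then obtain k where n: "n = Suc k" by (cases n) auto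
        from True have "?m x = h x + max_sum h k (\<tau> x)" by (auto simp: n max_def split: if_splits)
        also have "\<dots> \<le> h x + ?m (\<tau> x)" using max_sum_Suc_mono[of h k "\<tau> x"] by (simp add: n)
        finally show ?thesis using True by simp
      next
        case False
        then show ?thesis using max_sum_nonneg[of h n x] max_sum_nonneg[of h n "\<tau> x"] by simp
      qed
    qed (use int in simp)
    finally show ?thesis .
  qed
  then show "\<forall>\<^sub>F n in sequentially. 0 \<le> (\<integral>x. ?I n x \<partial>M)" by simp
qed simp

definition birkhoff_avg :: "('a \<Rightarrow> real) \<Rightarrow> nat \<Rightarrow> 'a \<Rightarrow> real" where
  "birkhoff_avg f n x = (\<Sum>k<n. f ((\<tau> ^^ k) x)) / n"

lemma birkhoff_avg_meas[measurable]:
  assumes [measurable]: "f \<in> borel_measurable M"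
  shows "birkhoff_avg f n \<in> borel_measurable M"
  unfolding birkhoff_avg_def[abs_def] by measurable

lemma birkhoff_avg_bound:
  assumes "\<And>x. x \<in> space M \<Longrightarrow> \<bar>f x\<bar> \<le> C" "x \<in> space M"
  shows "\<bar>birkhoff_avg f n x\<bar> \<le> C"
proof -
  have C: "0 \<le> C" using assms by force
  have "\<bar>\<Sum>k<n. f ((\<tau> ^^ k) x)\<bar> \<le> (\<Sum>k<n. C)"
    using assms by (intro order_trans[OF sum_abs] sum_mono) (auto intro: \<tau>_iter_space)
  then have "\<bar>\<Sum>k<n. f ((\<tau> ^^ k) x)\<bar> \<le> C * n" by (simp add: mult.commute)
  then show ?thesis using C
    by (cases "n = 0") (simp_all add: birkhoff_avg_def pos_divide_le_eq)
qed

lemma birkhoff_avg_shift: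
  assumes "\<And>x. x \<in> space M \<Longrightarrow> \<bar>f x\<bar> \<le> C" "x \<in> space M"
  shows "(\<lambda>n. birkhoff_avg f n (\<tau> x) - birkhoff_avg f n x) \<longlonglongrightarrow> 0"
proof (rule Lim_null_comparison)
  show "(\<lambda>n. (2*C) * inverse (real n)) \<longlonglongrightarrow> 0"
    using tendsto_mult_right_zero[OF lim_inverse_n, of "2*C"] by simp
  have "\<bar>birkhoff_avg f n (\<tau> x) - birkhoff_avg f n x\<bar> \<le> (2*C) * inverse (real n)" for n
  proof -
    have "(\<Sum>k<n. f ((\<tau> ^^ k) (\<tau> x))) - (\<Sum>k<n. f ((\<tau> ^^ k) x)) = f ((\<tau> ^^ n) x) - f x"
      by (induction n) (auto simp: funpow_swap1)
    then have "birkhoff_avg f n (\<tau> x) - birkhoff_avg f n x = (f ((\<tau> ^^ n) x) - f x) * inverse (real n)"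
      by (metis birkhoff_avg_def diff_divide_distrib divide_inverse)
    moreover have "\<bar>f ((\<tau> ^^ n) x) - f x\<bar> \<le> 2 * C"
      using assms(1)[OF \<tau>_iter_space[OF assms(2)], of n] assms(1)[OF assms(2)] by simp
    ultimately show ?thesis by (simp add: abs_mult mult_right_mono)
  qed
  then show "\<forall>\<^sub>F n in sequentially. norm (birkhoff_avg f n (\<tau> x) - birkhoff_avg f n x) \<le> (2*C) * inverse (real n)"
    by simp
qed

definition upper_avg :: "('a \<Rightarrow> real) \<Rightarrow> 'a \<Rightarrow> real" where
  "upper_avg f x = real_of_ereal (limsup (\<lambda>n. ereal (birkhoff_avg f n x)))"

lemma upper_avg_meas[measurable]:
  assumes [measurable]: "f \<in> borel_measurable M"
  shows "upper_avg f \<in> borel_measurable M"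
  unfolding upper_avg_def[abs_def] by measurable

lemma ereal_upper_avg:
  assumes "\<And>x. x \<in> space M \<Longrightarrow> \<bar>f x\<bar> \<le> C" "x \<in> space M"
  shows "ereal (upper_avg f x) = limsup (\<lambda>n. ereal (birkhoff_avg f n x))"
    and "\<bar>upper_avg f x\<bar> \<le> C"
proof -
  let ?L = "limsup (\<lambda>n. ereal (birkhoff_avg f n x))"
  have b: "\<bar>birkhoff_avg f n x\<bar> \<le> C" for n using birkhoff_avg_bound[OF assms] .
  have 1: "?L \<le> ereal C"
    using b by (intro Limsup_bounded always_eventually allI) (auto simp: abs_le_iff)
  have 2: "ereal (-C) \<le> ?L"
  proof -
    have "ereal (-C) \<le> liminf (\<lambda>n. ereal (birkhoff_avg f n x))"
    proof (rule Liminf_bounded, rule always_eventually, rule allI)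
      fix n show "ereal (-C) \<le> ereal (birkhoff_avg f n x)" using b[of n] by (simp add: abs_le_iff)
    qed
    also have "\<dots> \<le> ?L" by (rule Liminf_le_Limsup) simp
    finally show ?thesis .
  qed
  have fin: "\<bar>?L\<bar> \<noteq> \<infinity>" using 1 2 by auto
  show eq: "ereal (upper_avg f x) = ?L"
    unfolding upper_avg_def using fin by (rule ereal_real')
  show "\<bar>upper_avg f x\<bar> \<le> C" using 1 2 unfolding eq[symmetric] by auto
qed

lemma upper_avg_invariant:
  assumes "\<And>x. x \<in> space M \<Longrightarrow> \<bar>f x\<bar> \<le> C" "x \<in> space M"
  shows "upper_avg f (\<tau> x) = upper_avg f x"
proof -
  have "(\<lambda>n. ereal (birkhoff_avg f n (\<tau> x) - birkhoff_avg f n x)) \<longlonglongrightarrow> ereal 0"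
    using birkhoff_avg_shift[OF assms] by simp
  then have "limsup (\<lambda>n. ereal (birkhoff_avg f n (\<tau> x) - birkhoff_avg f n x) + ereal (birkhoff_avg f n x))
     = ereal 0 + limsup (\<lambda>n. ereal (birkhoff_avg f n x))"
    by (intro ereal_limsup_lim_add) auto
  then show ?thesis by (simp add: upper_avg_def)
qed

lemma upper_avg_iter:
  assumes "\<And>x. x \<in> space M \<Longrightarrow> \<bar>f x\<bar> \<le> C" "x \<in> space M"
  shows "upper_avg f ((\<tau> ^^ k) x) = upper_avg f x"
  by (induction k) (use upper_avg_invariant[OF assms(1)] \<tau>_iter_space[OF assms(2)] in auto)

text \<open>
  The upper limit is invariant, so the ergodic sums of \<open>f\<close> minus the upper limit plus \<open>e\<close> become
  positive at every point, and the maximal ergodic inequality applies to this function.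
\<close>
lemma integral_upper_avg_le:
  assumes [measurable]: "f \<in> borel_measurable M"
    and bd: "\<And>x. x \<in> space M \<Longrightarrow> \<bar>f x\<bar> \<le> C"
  shows "(\<integral>x. upper_avg f x \<partial>M) \<le> (\<integral>x. f x \<partial>M)"
proof (rule field_le_epsilon)
  fix e :: real assume e: "0 < e"
  let ?h = "\<lambda>x. f x - upper_avg f x + e"
  have ub: "\<bar>upper_avg f x\<bar> \<le> C" if "x \<in> space M" for x
    using ereal_upper_avg(2)[OF bd that] .
  have hb: "\<bar>?h x\<bar> \<le> 2 * C + e" if "x \<in> space M" for x
    using bd[OF that] ub[OF that] e by linarith
  have int: "integrable M f" "integrable M (upper_avg f)"
    using bd ub by (auto intro!: integrable_bounded[where C=C])
  have "0 \<le> (\<integral>x. ?h x \<partial>M)"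
  proof (rule maximal_ergodic[OF _ hb])
    fix x assume x: "x \<in> space M"
    have "ereal (upper_avg f x - e) < limsup (\<lambda>n. ereal (birkhoff_avg f n x))"
      using e by (simp add: ereal_upper_avg(1)[OF bd x, symmetric])
    then have "\<exists>\<^sub>F n in sequentially. ereal (upper_avg f x - e) < ereal (birkhoff_avg f n x)"
      using Limsup_bounded[of "\<lambda>n. ereal (birkhoff_avg f n x)" "ereal (upper_avg f x - e)" sequentially]
      unfolding frequently_def not_less by (meson leD)
    then have "\<exists>\<^sub>F n in sequentially. upper_avg f x - e < birkhoff_avg f n x" by simp
    then obtain n where n: "n \<ge> 1" "upper_avg f x - e < birkhoff_avg f n x"
      unfolding frequently_sequentially by blast
    have "(\<Sum>k<n. ?h ((\<tau> ^^ k) x)) = (\<Sum>k<n. f ((\<tau> ^^ k) x)) - n * (upper_avg f x - e)"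
      by (simp add: upper_avg_iter[OF bd x] sum.distrib sum_subtractf algebra_simps)
    also have "\<dots> > 0" using n by (simp add: birkhoff_avg_def field_simps)
    finally show "\<exists>n. (\<Sum>k<n. ?h ((\<tau> ^^ k) x)) > 0" by blast
  qed measurable
  also have "(\<integral>x. ?h x \<partial>M) = (\<integral>x. f x \<partial>M) - (\<integral>x. upper_avg f x \<partial>M) + e"
    using int by (simp add: prob_space)
  finally show "(\<integral>x. upper_avg f x \<partial>M) \<le> (\<integral>x. f x \<partial>M) + e" by simp
qed

text \<open>
  Applied to \<open>f\<close> and to \<open>-f\<close>, the inequality \<open>integral_upper_avg_le\<close> shows that the upper limit does not exceed the
  lower limit in the mean; being pointwise at least as large, it agrees with it almost everywhere.
\<close>
theorem birkhoff:
  assumes f[measurable]: "f \<in> borel_measurable M"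
    and bd: "\<And>x. x \<in> space M \<Longrightarrow> \<bar>f x\<bar> \<le> C"
  shows "AE x in M. (\<lambda>n. birkhoff_avg f n x) \<longlonglongrightarrow> upper_avg f x"
    and "(\<integral>x. upper_avg f x \<partial>M) = (\<integral>x. f x \<partial>M)"
proof -
  let ?g = "\<lambda>x. - f x"
  have gb: "\<bar>?g x\<bar> \<le> C" if "x \<in> space M" for x using bd[OF that] by simp
  have g[measurable]: "?g \<in> borel_measurable M" by measurable
  have int: "integrable M f" "integrable M (upper_avg f)" "integrable M (upper_avg ?g)"
    using bd ereal_upper_avg(2)[OF bd] ereal_upper_avg(2)[OF gb] 
    by (auto intro!: integrable_bounded[where C=C])
  have lim: "liminf (\<lambda>n. ereal (birkhoff_avg f n x)) = ereal (- upper_avg ?g x)" if "x \<in> space M" for x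
  proof -
    have "ereal (- upper_avg ?g x) = - limsup (\<lambda>n. ereal (birkhoff_avg ?g n x))"
      by (simp add: ereal_upper_avg(1)[OF gb that, symmetric])
    also have "\<dots> = - limsup (\<lambda>n. - ereal (birkhoff_avg f n x))"
      by (simp add: birkhoff_avg_def sum_negf)
    also have "\<dots> = liminf (\<lambda>n. ereal (birkhoff_avg f n x))"
      by (subst ereal_Limsup_uminus) simp
    finally show ?thesis by simp
  qed
  let ?d = "\<lambda>x. upper_avg f x + upper_avg ?g x"
  have dnn: "0 \<le> ?d x" if x: "x \<in> space M" for x
  proof -
    have "liminf (\<lambda>n. ereal (birkhoff_avg f n x)) \<le> limsup (\<lambda>n. ereal (birkhoff_avg f n x))"
      by (rule Liminf_le_Limsup) simp
    then have "ereal (- upper_avg ?g x) \<le> ereal (upper_avg f x)"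
      by (simp only: lim[OF x] ereal_upper_avg(1)[OF bd x])
    then show ?thesis by simp
  qed
  have "(\<integral>x. ?d x \<partial>M) \<le> 0"
    using integral_upper_avg_le[OF f bd] integral_upper_avg_le[OF g gb] int by simp
  moreover have "0 \<le> (\<integral>x. ?d x \<partial>M)" using dnn by (intro integral_nonneg_AE AE_I2) 
  ultimately have z: "(\<integral>x. ?d x \<partial>M) = 0" by simp
  then have "AE x in M. ?d x = 0"
    using int dnn by (subst (asm) integral_nonneg_eq_0_iff_AE) auto
  then show "AE x in M. (\<lambda>n. birkhoff_avg f n x) \<longlonglongrightarrow> upper_avg f x"
  proof (rule AE_mp, intro AE_I2 impI)
    fix x assume x: "x \<in> space M" and d: "?d x = 0"
    have "(\<lambda>n. ereal (birkhoff_avg f n x)) \<longlonglongrightarrow> ereal (upper_avg f x)"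
      using d by (intro Liminf_eq_Limsup) (auto simp: lim[OF x] ereal_upper_avg(1)[OF bd x, symmetric] add_eq_0_iff)
    then show "(\<lambda>n. birkhoff_avg f n x) \<longlonglongrightarrow> upper_avg f x" by simp
  qed
  show "(\<integral>x. upper_avg f x \<partial>M) = (\<integral>x. f x \<partial>M)"
    using z integral_upper_avg_le[OF f bd] integral_upper_avg_le[OF g gb] int by simp
qed

end

section \<open>The ergodic theorem for two transformations\<close>

lemma (in prob_space) AE_subseq_zero:
  fixes h :: "nat \<Rightarrow> 'a \<Rightarrow> real"
  assumes [measurable]: "\<And>n. h n \<in> borel_measurable M"
    and bd: "\<And>n x. x \<in> space M \<Longrightarrow> \<bar>h n x\<bar> \<le> C"
    and lim: "(\<lambda>n. \<integral>x. \<bar>h n x\<bar> \<partial>M) \<longlonglongrightarrow> 0"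
  obtains r :: "nat \<Rightarrow> nat" where "strict_mono r" "AE x in M. (\<lambda>n. h (r n) x) \<longlonglongrightarrow> 0"
  using tendsto_L1_AE_subseq[of M h] lim integrable_bounded[OF assms(1) bd]
  by auto

text \<open>
  Averaging along \<open>\<tau>2\<close> converges to \<open>E\<close> by the theorem for one transformation. The error after \<open>K\<close> steps
  is dominated, uniformly in all later steps, by a bounded function \<open>h K\<close> that decreases to \<open>0\<close> almost
  everywhere. Averaging along \<open>\<tau>1\<close> turns \<open>E\<close> into the limit and \<open>h K\<close> into a function with the same
  small integral, so the two lengths may tend to infinity independently.
\<close>
lemma two_parameter_birkhoff:
  fixes f :: "'a \<Rightarrow> real"
  assumes "measure_preserving M \<tau>1" "measure_preserving M \<tau>2"
    and f[measurable]: "f \<in> borel_measurable M"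
    and bd: "\<And>x. x \<in> space M \<Longrightarrow> \<bar>f x\<bar> \<le> C"
  obtains L where "L \<in> borel_measurable M" "(\<integral>x. L x \<partial>M) = (\<integral>x. f x \<partial>M)"
    "AE x in M. ((\<lambda>(m, n). (\<Sum>j<m. \<Sum>k<n. f ((\<tau>2 ^^ k) ((\<tau>1 ^^ j) x))) / (real m * real n))
        \<longlongrightarrow> L x) (sequentially \<times>\<^sub>F sequentially)"
proof -
  interpret T1: measure_preserving M \<tau>1 by fact
  interpret T2: measure_preserving M \<tau>2 by fact
  let ?B = "T2.birkhoff_avg f" and ?E = "T2.upper_avg f"
  let ?L = "T1.upper_avg ?E"
  \<comment> \<open>The supremum over all later lengths makes the estimate below uniform in the second length.\<close>
  define h where "h K x = (SUP n\<in>{K..}. \<bar>?B n x - ?E x\<bar>)" for K :: nat and x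
  have E[measurable]: "?E \<in> borel_measurable M" by measurable
  have Eb: "\<bar>?E x\<bar> \<le> C" if "x \<in> space M" for x using bd that by (intro T2.ereal_upper_avg(2)) auto
  have Bb: "\<bar>?B n x - ?E x\<bar> \<le> 2 * C" if "x \<in> space M" for x n
    using T2.birkhoff_avg_bound[where f=f, OF bd that, of n] Eb[OF that] by linarith
  have bdd: "bdd_above ((\<lambda>n. \<bar>?B n x - ?E x\<bar>) ` {K..})" if "x \<in> space M" for x K
    using Bb[OF that] by (intro bdd_aboveI2[where M="2*C"])
  have hm[measurable]: "h K \<in> borel_measurable M" for K
    unfolding h_def[abs_def] using bdd by (intro borel_measurable_cSUP) auto
  have le_h: "\<bar>?B n x - ?E x\<bar> \<le> h K x" if "x \<in> space M" "n \<ge> K" for x n K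
    unfolding h_def using that by (intro cSUP_upper bdd) auto
  have hb: "\<bar>h K x\<bar> \<le> 2 * C" if "x \<in> space M" for x K
  proof -
    have "0 \<le> h K x" using le_h[OF that order_refl, of K] by linarith
    moreover have "h K x \<le> 2 * C"
      unfolding h_def using Bb[OF that] by (intro cSUP_least) auto
    ultimately show ?thesis by simp
  qed
  have h_nonneg: "0 \<le> h K x" if "x \<in> space M" for x K
    using le_h[OF that order_refl, of K] by linarith
  have h_lim: "AE x in M. (\<lambda>K. h K x) \<longlonglongrightarrow> 0"
  proof (rule AE_mp[OF T2.birkhoff(1)[where f=f and C=C, OF f]], fact bd, intro AE_I2 impI)
    fix x assume x: "x \<in> space M" and lim: "(\<lambda>n. ?B n x) \<longlonglongrightarrow> ?E x"
    show "(\<lambda>K. h K x) \<longlonglongrightarrow> 0"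
    proof (rule LIMSEQ_I)
      fix r :: real assume r: "0 < r"
      then obtain N where N: "\<And>n. n \<ge> N \<Longrightarrow> \<bar>?B n x - ?E x\<bar> < r/2"
        using LIMSEQ_D[OF lim, of "r/2"] by auto
      have "h K x \<le> r/2" if "K \<ge> N" for K
        unfolding h_def using that by (intro cSUP_least) (auto intro!: order.strict_implies_order[OF N] simp del: le_divide_eq_numeral1)
      then show "\<exists>N. \<forall>K\<ge>N. norm (h K x - 0) < r"
        using r h_nonneg[OF x] by (intro exI[of _ N]) (force simp: abs_le_iff)
    qed
  qed
  let ?H = "\<lambda>K. T1.upper_avg (h K)"
  have "(\<lambda>K. \<integral>x. h K x \<partial>M) \<longlonglongrightarrow> (\<integral>x. 0 \<partial>M)"
    by (rule integral_dominated_convergence[where w="\<lambda>_. 2*C"]) (use h_lim hb in auto)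
  then have intH: "(\<lambda>K. \<integral>x. ?H K x \<partial>M) \<longlonglongrightarrow> 0"
    using T1.birkhoff(2)[where f="h _" and C="2*C", OF hm] hb by simp
  have Hb: "\<bar>?H K x\<bar> \<le> 2 * C" if "x \<in> space M" for x K using hb that by (intro T1.ereal_upper_avg(2)) auto
  have conv: "AE x in M. \<forall>K. (\<lambda>m. T1.birkhoff_avg (h K) m x) \<longlonglongrightarrow> ?H K x"
    unfolding AE_all_countable using hb by (intro allI T1.birkhoff(1)[where C="2*C"]) auto
  then have Hnn: "AE x in M. \<forall>K. 0 \<le> ?H K x"
  proof (rule AE_mp, intro AE_I2 impI allI)
    fix x K assume x: "x \<in> space M" and "\<forall>K. (\<lambda>m. T1.birkhoff_avg (h K) m x) \<longlonglongrightarrow> ?H K x"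
    then show "0 \<le> ?H K x"
      using h_nonneg T1.\<tau>_iter_space[OF x]
      by (intro LIMSEQ_le_const[of "\<lambda>m. T1.birkhoff_avg (h K) m x"])
        (auto simp: T1.birkhoff_avg_def intro!: sum_nonneg divide_nonneg_nonneg)
  qed
  have "(\<lambda>K. \<integral>x. \<bar>?H K x\<bar> \<partial>M) \<longlonglongrightarrow> 0"
  proof -
    have "(\<integral>x. \<bar>?H K x\<bar> \<partial>M) = (\<integral>x. ?H K x \<partial>M)" for K
      using Hnn by (intro integral_cong_AE) auto
    then show ?thesis using intH by simp
  qed
  then obtain r where r: "strict_mono r" "AE x in M. (\<lambda>n. ?H (r n) x) \<longlonglongrightarrow> 0"
    using Hb by (elim T1.AE_subseq_zero[rotated 2]) auto
  show ?thesis
  proof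
    show "?L \<in> borel_measurable M" by measurable
    show "(\<integral>x. ?L x \<partial>M) = (\<integral>x. f x \<partial>M)"
      using T1.birkhoff(2)[where f="?E" and C=C, OF E] T2.birkhoff(2)[where f=f and C=C, OF f] Eb bd by simp
    have "AE x in M. (\<lambda>m. T1.birkhoff_avg ?E m x) \<longlonglongrightarrow> ?L x"
      using Eb by (intro T1.birkhoff(1)[where C=C]) auto
    then show "AE x in M. ((\<lambda>(m, n). (\<Sum>j<m. \<Sum>k<n. f ((\<tau>2 ^^ k) ((\<tau>1 ^^ j) x))) / (real m * real n))
        \<longlongrightarrow> ?L x) (sequentially \<times>\<^sub>F sequentially)"
      using conv r(2)
    proof (rule AE_mp[OF _ AE_mp[OF _ AE_mp[OF _ AE_I2]]], intro impI)
      fix x assume x: "x \<in> space M" and Hr: "(\<lambda>n. ?H (r n) x) \<longlonglongrightarrow> 0"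
        and cv: "\<forall>K. (\<lambda>m. T1.birkhoff_avg (h K) m x) \<longlonglongrightarrow> ?H K x"
        and E: "(\<lambda>m. T1.birkhoff_avg ?E m x) \<longlonglongrightarrow> ?L x"
      let ?A = "\<lambda>m n. (\<Sum>j<m. \<Sum>k<n. f ((\<tau>2 ^^ k) ((\<tau>1 ^^ j) x))) / (real m * real n)"
      have A_eq: "?A m n = T1.birkhoff_avg (?B n) m x" for m n
        by (simp add: T1.birkhoff_avg_def T2.birkhoff_avg_def sum_divide_distrib mult.commute)
      have A_le: "\<bar>?A m n - T1.birkhoff_avg ?E m x\<bar> \<le> T1.birkhoff_avg (h K) m x" if "n \<ge> K" for m n K
      proof -
        have "?A m n - T1.birkhoff_avg ?E m x = (\<Sum>j<m. ?B n ((\<tau>1 ^^ j) x) - ?E ((\<tau>1 ^^ j) x)) / m"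
          unfolding A_eq by (simp add: T1.birkhoff_avg_def sum_subtractf diff_divide_distrib)
        also have "\<bar>\<dots>\<bar> \<le> T1.birkhoff_avg (h K) m x"
          unfolding T1.birkhoff_avg_def abs_divide using T1.\<tau>_iter_space[OF x] that
          by (auto intro!: divide_right_mono order_trans[OF sum_abs] sum_mono le_h)
        finally show ?thesis .
      qed
      have "\<forall>\<^sub>F (m, n) in sequentially \<times>\<^sub>F sequentially. \<bar>?A m n - ?L x\<bar> < e" if "e > 0" for e
      proof -
        obtain i where i: "?H (r i) x < e / 3"
          using order_tendstoD(2)[OF Hr, of "e/3"] \<open>e > 0\<close> by (auto simp: eventually_sequentially)
        let ?K = "r i"
        have "\<forall>\<^sub>F m in sequentially. T1.birkhoff_avg (h ?K) m x < e/3"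
          using cv i by (intro order_tendstoD(2)) auto
        moreover have "\<forall>\<^sub>F m in sequentially. dist (T1.birkhoff_avg ?E m x) (?L x) < e/3"
          using E \<open>e > 0\<close> by (intro tendstoD) auto
        ultimately have ev: "\<forall>\<^sub>F m in sequentially. T1.birkhoff_avg (h ?K) m x < e/3 \<and>
            dist (T1.birkhoff_avg ?E m x) (?L x) < e/3" by (rule eventually_conj)
        show ?thesis
          unfolding eventually_prod_filter
        proof (intro exI conjI allI impI)
          show "\<forall>\<^sub>F m in sequentially. T1.birkhoff_avg (h ?K) m x < e/3 \<and>
            dist (T1.birkhoff_avg ?E m x) (?L x) < e/3" by fact
          show "\<forall>\<^sub>F n in sequentially. n \<ge> ?K" by (rule eventually_ge_at_top)
          fix m n assume "T1.birkhoff_avg (h ?K) m x < e/3 \<and>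
            dist (T1.birkhoff_avg ?E m x) (?L x) < e/3" "n \<ge> ?K"
          then show "case (m, n) of (m, n) \<Rightarrow> \<bar>?A m n - ?L x\<bar> < e"
            using A_le[of ?K n m] by (simp only: dist_real_def prod.case) argo
        qed
      qed
      then show "((\<lambda>(m, n). ?A m n) \<longlongrightarrow> ?L x) (sequentially \<times>\<^sub>F sequentially)"
        unfolding tendsto_iff dist_real_def case_prod_beta by blast
    qed
  qed
qed

section \<open>Continuity of translations in the mean\<close>

lemma lborel_distr_add:
  fixes u :: "'a::euclidean_space"
  shows "distr lborel borel (\<lambda>z. z + u) = lborel"
  using lborel_distr_plus[of u] unfolding add.commute[of _ u] .

lemma
  fixes f :: "'a::euclidean_space \<Rightarrow> real" and u :: 'a
  assumes [measurable]: "f \<in> borel_measurable borel"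
  shows lborel_integral_translate: "(\<integral>z. f (z + u) \<partial>lborel) = (\<integral>z. f z \<partial>lborel)"
    and lborel_integrable_translate: "integrable lborel (\<lambda>z. f (z + u)) \<longleftrightarrow> integrable lborel f"
proof -
  show "(\<integral>z. f (z + u) \<partial>lborel) = (\<integral>z. f z \<partial>lborel)"
    by (subst (2) lborel_distr_add[of u, symmetric], subst integral_distr) auto
  show "integrable lborel (\<lambda>z. f (z + u)) \<longleftrightarrow> integrable lborel f"
    by (subst (2) lborel_distr_add[of u, symmetric], subst integrable_distr_eq) auto
qed

text \<open>
  Translations act isometrically on integrable functions, so continuity passes to limits in the mean.
\<close>
lemma L1_translation_approx:
  fixes w :: "'a::euclidean_space \<Rightarrow> real" and u :: "nat \<Rightarrow> 'a"
  assumes w[measurable]: "integrable lborel w"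
    and approx: "\<And>e. e > 0 \<Longrightarrow> \<exists>v. integrable lborel v \<and> (\<integral>z. \<bar>w z - v z\<bar> \<partial>lborel) < e \<and>
      (\<lambda>n. \<integral>z. \<bar>v (z + u n) - v z\<bar> \<partial>lborel) \<longlonglongrightarrow> 0"
  shows "(\<lambda>n. \<integral>z. \<bar>w (z + u n) - w z\<bar> \<partial>lborel) \<longlonglongrightarrow> 0"
proof (rule tendstoI)
  fix e :: real assume e: "e > 0"
  obtain v where v[measurable]: "integrable lborel v" and d: "(\<integral>z. \<bar>w z - v z\<bar> \<partial>lborel) < e/3"
    and lim: "(\<lambda>n. \<integral>z. \<bar>v (z + u n) - v z\<bar> \<partial>lborel) \<longlonglongrightarrow> 0"
    using approx[of "e/3"] e by auto
  have [measurable]: "w \<in> borel_measurable borel" "v \<in> borel_measurable borel"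
    using w v by (auto dest: borel_measurable_integrable)
  have tr: "integrable lborel (\<lambda>z. w (z + a))" "integrable lborel (\<lambda>z. v (z + a))" for a
    using w v by (auto simp: lborel_integrable_translate)
  have le: "(\<integral>z. \<bar>w (z + a) - w z\<bar> \<partial>lborel) \<le>
      2 * (\<integral>z. \<bar>w z - v z\<bar> \<partial>lborel) + (\<integral>z. \<bar>v (z + a) - v z\<bar> \<partial>lborel)" for a
  proof -
    have "(\<integral>z. \<bar>w (z + a) - w z\<bar> \<partial>lborel) \<le>
      (\<integral>z. \<bar>w (z + a) - v (z + a)\<bar> + \<bar>w z - v z\<bar> + \<bar>v (z + a) - v z\<bar> \<partial>lborel)"
      using w v tr by (intro integral_mono) auto
    also have "\<dots> = (\<integral>z. \<bar>w (z + a) - v (z + a)\<bar> \<partial>lborel) + (\<integral>z. \<bar>w z - v z\<bar> \<partial>lborel)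
        + (\<integral>z. \<bar>v (z + a) - v z\<bar> \<partial>lborel)"
      using w v tr by simp
    also have "(\<integral>z. \<bar>w (z + a) - v (z + a)\<bar> \<partial>lborel) = (\<integral>z. \<bar>w z - v z\<bar> \<partial>lborel)"
      by (rule lborel_integral_translate[of "\<lambda>z. \<bar>w z - v z\<bar>"]) simp
    finally show ?thesis by simp
  qed
  have "\<forall>\<^sub>F n in sequentially. (\<integral>z. \<bar>v (z + u n) - v z\<bar> \<partial>lborel) < e/3"
    using lim e by (intro order_tendstoD(2)) auto
  then show "\<forall>\<^sub>F n in sequentially. dist (\<integral>z. \<bar>w (z + u n) - w z\<bar> \<partial>lborel) 0 < e"
  proof eventually_elim
    case (elim n)
    then show ?case using le[of "u n"] d by (simp add: dist_real_def)
  qed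
qed

text \<open>
  For an open set, a point of the set stays in it under small displacements, so the indicator
  function times its translate converges pointwise to the indicator function. Thus open sets can
  serve here as the dense class in place of continuous functions.
\<close>
lemma L1_translation_open:
  fixes u :: "nat \<Rightarrow> 'a::euclidean_space"
  assumes "open G" and fin: "emeasure lborel G < \<infinity>" and u: "u \<longlonglongrightarrow> 0"
  shows "(\<lambda>n. \<integral>z. \<bar>indicator G (z + u n) - indicator G z :: real\<bar> \<partial>lborel) \<longlonglongrightarrow> 0"
proof -
  let ?i = "\<lambda>z. indicator G z :: real"
  have [measurable]: "G \<in> sets borel" using \<open>open G\<close> by simp
  have int: "integrable lborel ?i" using fin by simp
  have intr: "integrable lborel (\<lambda>z. ?i (z + a))" for a
    using int by (subst lborel_integrable_translate) auto
  have intp: "integrable lborel (\<lambda>z. ?i (z + a) * ?i z)" for a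
    by (rule Bochner_Integration.integrable_bound[OF int]) (auto split: split_indicator)
  have "(\<integral>z. \<bar>?i (z + a) - ?i z\<bar> \<partial>lborel) = 2 * (\<integral>z. ?i z \<partial>lborel) - 2 * (\<integral>z. ?i (z + a) * ?i z \<partial>lborel)" for a
  proof -
    have "(\<integral>z. \<bar>?i (z + a) - ?i z\<bar> \<partial>lborel) = (\<integral>z. (?i (z + a) + ?i z) - 2 * (?i (z + a) * ?i z) \<partial>lborel)"
      by (intro Bochner_Integration.integral_cong refl) (auto split: split_indicator)
    also have "\<dots> = (\<integral>z. ?i (z + a) \<partial>lborel) + (\<integral>z. ?i z \<partial>lborel) - 2 * (\<integral>z. ?i (z + a) * ?i z \<partial>lborel)"
      using int intr intp by (subst Bochner_Integration.integral_diff) simp_all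
    also have "(\<integral>z. ?i (z + a) \<partial>lborel) = (\<integral>z. ?i z \<partial>lborel)"
      by (rule lborel_integral_translate) simp
    finally show ?thesis by simp
  qed
  moreover have "(\<lambda>n. \<integral>z. ?i (z + u n) * ?i z \<partial>lborel) \<longlonglongrightarrow> (\<integral>z. ?i z \<partial>lborel)"
  proof (rule integral_dominated_convergence[where w="?i"])
    show "AE z in lborel. (\<lambda>n. ?i (z + u n) * ?i z) \<longlonglongrightarrow> ?i z"
    proof (intro AE_I2)
      fix z :: 'a
      show "(\<lambda>n. ?i (z + u n) * ?i z) \<longlonglongrightarrow> ?i z"
      proof (cases "z \<in> G")
        case True
        have "(\<lambda>n. z + u n) \<longlonglongrightarrow> z" using tendsto_add[OF tendsto_const u, of z] by simp
        then have "\<forall>\<^sub>F n in sequentially. z + u n \<in> G" using \<open>open G\<close> True by (rule topological_tendstoD)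
        then have "\<forall>\<^sub>F n in sequentially. ?i (z + u n) * ?i z = ?i z" by eventually_elim (simp add: True)
        then show ?thesis by (rule tendsto_eventually)
      qed simp
    qed
  qed (use int in \<open>auto split: split_indicator\<close>)
  ultimately have "(\<lambda>n. \<integral>z. \<bar>?i (z + u n) - ?i z\<bar> \<partial>lborel) \<longlonglongrightarrow> 2 * (\<integral>z. ?i z \<partial>lborel) - 2 * (\<integral>z. ?i z \<partial>lborel)"
    by (simp only: tendsto_intros)
  then show ?thesis by simp
qed

lemma L1_translation_continuous:
  fixes w :: "'a::euclidean_space \<Rightarrow> real" and u :: "nat \<Rightarrow> 'a"
  assumes w: "integrable lborel w" and u: "u \<longlonglongrightarrow> 0"
  shows "(\<lambda>n. \<integral>z. \<bar>w (z + u n) - w z\<bar> \<partial>lborel) \<longlonglongrightarrow> 0"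
  using w
proof (induction rule: integrable_induct)
  case (base A c)
  then have A[measurable]: "A \<in> sets borel" by simp
  have fin: "emeasure lborel A < \<infinity>" using base by simp
  have "(\<lambda>n. \<integral>z. \<bar>indicator A (z + u n) - indicator A z :: real\<bar> \<partial>lborel) \<longlonglongrightarrow> 0"
  proof (rule L1_translation_approx)
    show "integrable lborel (\<lambda>z. indicator A z :: real)" using fin by simp
    fix e :: real assume e: "e > 0"
    obtain G where G: "open G" "A \<subseteq> G" "emeasure lborel (G - A) < ennreal e"
      using outer_regular_lborel[OF A e] by blast
    have [measurable]: "G \<in> sets borel" using G by simp
    have "emeasure lborel G = emeasure lborel A + emeasure lborel (G - A)"
      using G by (subst plus_emeasure) (auto simp: Un_absorb1)
    also have "\<dots> < \<infinity>" using fin order.strict_trans[OF G(3) ennreal_less_top] by (simp add: less_top)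
    finally have finG: "emeasure lborel G < \<infinity>" .
    have "(\<integral>z. \<bar>indicator A z - indicator G z :: real\<bar> \<partial>lborel) = (\<integral>z. indicator (G - A) z \<partial>lborel)"
      using G by (intro Bochner_Integration.integral_cong) (auto split: split_indicator)
    also have "\<dots> = measure lborel (G - A)" by simp
    also have "\<dots> < e" using G(3) e unfolding measure_def by (metis enn2real_less_iff order.strict_trans[OF G(3) ennreal_less_top])
    finally show "\<exists>v. integrable lborel v \<and> (\<integral>z. \<bar>indicator A z - v z\<bar> \<partial>lborel) < e \<and>
      (\<lambda>n. \<integral>z. \<bar>v (z + u n) - v z :: real\<bar> \<partial>lborel) \<longlonglongrightarrow> 0"
      using finG L1_translation_open[OF G(1) finG u] by (intro exI[of _ "indicator G"]) simp
  qed
  then have "(\<lambda>n. (\<integral>z. \<bar>indicator A (z + u n) - indicator A z :: real\<bar> \<partial>lborel) * \<bar>c\<bar>) \<longlonglongrightarrow> 0"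
    by (rule tendsto_mult_left_zero)
  then show ?case
    by (simp add: left_diff_distrib[symmetric] abs_mult)
next
  case (add f g)
  have [measurable]: "f \<in> borel_measurable borel" "g \<in> borel_measurable borel"
    using add by (auto dest: borel_measurable_integrable)
  have tr: "integrable lborel (\<lambda>z. f (z + a))" "integrable lborel (\<lambda>z. g (z + a))" for a
    using add by (auto simp: lborel_integrable_translate)
  have "(\<lambda>n. (\<integral>z. \<bar>f (z + u n) - f z\<bar> \<partial>lborel) + (\<integral>z. \<bar>g (z + u n) - g z\<bar> \<partial>lborel)) \<longlonglongrightarrow> 0"
    using tendsto_add[OF add.IH] by simp
  moreover have "(\<integral>z. \<bar>(f (z + a) + g (z + a)) - (f z + g z)\<bar> \<partial>lborel) \<le>
     (\<integral>z. \<bar>f (z + a) - f z\<bar> \<partial>lborel) + (\<integral>z. \<bar>g (z + a) - g z\<bar> \<partial>lborel)" for a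
    using tr add.hyps by (subst Bochner_Integration.integral_add[symmetric]) (simp, simp, rule integral_mono, auto)
  ultimately show ?case
    by (rule_tac Lim_null_comparison[rotated]) auto
next
  case (lim f s)
  show ?case
  proof (rule L1_translation_approx[OF lim.hyps(4)])
    fix e :: real assume e: "e > 0"
    have "(\<lambda>i. \<integral>z. \<bar>f z - s i z\<bar> \<partial>lborel) \<longlonglongrightarrow> (\<integral>z. 0 \<partial>(lborel :: 'a measure))"
    proof (rule integral_dominated_convergence[where w="\<lambda>z. 3 * norm (f z)"])
      show "AE z in lborel. (\<lambda>i. \<bar>f z - s i z\<bar>) \<longlonglongrightarrow> 0"
      proof (intro AE_I2)
        fix z :: 'a
        have "(\<lambda>i. f z - s i z) \<longlonglongrightarrow> 0"
          using tendsto_diff[OF tendsto_const lim.hyps(2)[of z], of "f z"] by simp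
        then show "(\<lambda>i. \<bar>f z - s i z\<bar>) \<longlonglongrightarrow> 0" by (rule tendsto_rabs_zero)
      qed
      show "AE z in lborel. norm \<bar>f z - s i z\<bar> \<le> 3 * norm (f z)" for i
        using lim.hyps(3)[of _ i] by (intro AE_I2) (smt (verit) real_norm_def space_lborel UNIV_I space_borel)
    qed (use lim.hyps in \<open>auto dest: borel_measurable_integrable\<close>)
    then have "\<forall>\<^sub>F i in sequentially. (\<integral>z. \<bar>f z - s i z\<bar> \<partial>lborel) < e"
      using e by (intro order_tendstoD(2)) auto
    then obtain i where "(\<integral>z. \<bar>f z - s i z\<bar> \<partial>lborel) < e" by (auto simp: eventually_sequentially)
    then show "\<exists>v. integrable lborel v \<and> (\<integral>z. \<bar>f z - v z\<bar> \<partial>lborel) < e \<and>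
      (\<lambda>n. \<integral>z. \<bar>v (z + u n) - v z\<bar> \<partial>lborel) \<longlonglongrightarrow> 0"
      using lim.hyps(1) lim.IH by blast
  qed
qed

section \<open>Images of Lebesgue measure under injective differentiable maps\<close>

text \<open>
  The inverse \<open>Q\<close> of \<open>P\<close> is differentiable on the open image of \<open>U\<close> and therefore maps null sets to null
  sets; so the image measure is absolutely continuous, and \<open>w\<close> is its density, restricted to the
  image of \<open>S \<inter> U\<close>.
\<close>
lemma image_density_injective:
  fixes P :: "'a::euclidean_space \<Rightarrow> 'a" and P' :: "'a \<Rightarrow> 'a \<Rightarrow> 'a"
  assumes "open U" and inj: "inj_on P U" and P[measurable]: "P \<in> borel_measurable borel"
    and der: "\<And>s. s \<in> U \<Longrightarrow> (P has_derivative P' s) (at s)"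
    and der_inj: "\<And>s. s \<in> U \<Longrightarrow> inj (P' s)"
    and S[measurable]: "S \<in> sets borel" and fin: "emeasure lborel S < \<infinity>"
  obtains w :: "'a \<Rightarrow> real" and Q :: "'a \<Rightarrow> 'a" where
    "integrable lborel w" "\<And>z. 0 \<le> w z" "Q \<in> borel_measurable borel"
    "\<And>z. w z \<noteq> 0 \<Longrightarrow> z \<in> P ` (S \<inter> U) \<and> Q differentiable (at z)"
    "\<And>(\<phi> :: 'a \<Rightarrow> real) G. \<phi> \<in> borel_measurable borel \<Longrightarrow> G \<in> borel_measurable borel \<Longrightarrow>
       (\<integral>s. indicator (S \<inter> U) s * (\<phi> s * G (P s)) \<partial>lborel) = (\<integral>z. w z * (\<phi> (Q z) * G z) \<partial>lborel)"
proof -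
  define V where "V = P ` U"
  define Q where "Q z = (if z \<in> V then inv_into U P z else 0)" for z
  have cont: "continuous_on U P"
    using der by (intro has_derivative_continuous_on) (auto intro: has_derivative_at_withinI)
  have V: "open V" unfolding V_def using cont \<open>open U\<close> inj by (rule invariance_of_domain)
  have QP: "Q (P s) = s" if "s \<in> U" for s
    using that inj by (simp add: Q_def V_def)
  have QV: "Q z \<in> U" "P (Q z) = z" if "z \<in> V" for z
    using that by (auto simp: Q_def V_def inv_into_into f_inv_into_f)
  have diff: "Q differentiable (at z)" if z: "z \<in> V" for z
  proof -
    obtain s where s: "s \<in> U" "z = P s" using z by (auto simp: V_def)
    have lin: "linear (P' s)" using der[OF s(1)] by (rule has_derivative_linear)
    obtain g' where "linear g'" and id: "P' s \<circ> g' = id"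
      using linear_injective_imp_surjective[OF lin der_inj[OF s(1)]] linear_surjective_right_inverse[OF lin]
      by blast
    show ?thesis
      using has_derivative_inverse_strong[OF \<open>open U\<close> s(1) cont _ der[OF s(1)] id, of Q] QP s(2)
      by (auto simp: differentiable_def)
  qed
  have contQ: "continuous_on V Q"
    using diff by (intro continuous_at_imp_continuous_on ballI differentiable_imp_continuous_within)
  have [measurable]: "V \<in> sets borel" "U \<in> sets borel" using V \<open>open U\<close> by auto
  have Q[measurable]: "Q \<in> borel_measurable borel"
  proof -
    have "(\<lambda>z. if z \<in> V then Q z else 0) \<in> borel_measurable borel"
      using contQ by (intro borel_measurable_continuous_on_if) auto
    also have "(\<lambda>z. if z \<in> V then Q z else 0) = Q" by (auto simp: Q_def)
    finally show ?thesis .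
  qed
  let ?D = "S \<inter> U"
  have im: "P ` ?D = V \<inter> Q -` S"
  proof (intro subset_antisym subsetI)
    fix z assume "z \<in> P ` ?D" then show "z \<in> V \<inter> Q -` S" by (auto simp: V_def QP)
  next
    fix z assume "z \<in> V \<inter> Q -` S"
    then show "z \<in> P ` ?D" using QV[of z] by (intro image_eqI[of _ _ "Q z"]) auto
  qed
  have imm[measurable]: "P ` ?D \<in> sets borel"
    unfolding im using measurable_sets[OF Q S] by auto
  define \<mu> where "\<mu> = density lborel (\<lambda>s. indicator ?D s :: ennreal)"
  define \<nu> where "\<nu> = distr \<mu> borel P"
  have sets[simp]: "sets \<mu> = sets borel" "space \<mu> = UNIV" "sets \<nu> = sets borel" by (auto simp: \<mu>_def \<nu>_def)
  have measP[measurable]: "P \<in> borel_measurable \<mu>" by (simp add: \<mu>_def)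
  have em: "emeasure \<nu> A = emeasure lborel (?D \<inter> P -` A)" if [measurable]: "A \<in> sets borel" for A
  proof -
    have [measurable]: "P -` A \<in> sets borel" using measurable_sets[OF P that] by simp
    have "emeasure \<nu> A = emeasure \<mu> (P -` A)" by (simp add: \<nu>_def emeasure_distr)
    also have "\<dots> = emeasure lborel (?D \<inter> P -` A)"
      unfolding \<mu>_def
      by (subst emeasure_density) (auto simp: indicator_inter_arith[symmetric] nn_integral_indicator simp del: times_ereal.simps)
    finally show ?thesis .
  qed
  have ac: "absolutely_continuous lborel \<nu>"
    unfolding absolutely_continuous_def
  proof
    fix N :: "'a set" assume N: "N \<in> null_sets lborel"
    then have [measurable]: "N \<in> sets borel" by auto
    have [measurable]: "P -` N \<in> sets borel" using measurable_sets[OF P, of N] by simp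
    have "negligible (N \<inter> V)"
      using N by (intro negligible_Int) (simp add: negligible_iff_null_sets null_sets_completionI)
    then have "negligible (Q ` (N \<inter> V))"
      using diff by (intro negligible_differentiable_image_negligible[OF order_refl])
        (auto simp: differentiable_on_def intro: differentiable_at_withinI)
    moreover have "?D \<inter> P -` N \<subseteq> Q ` (N \<inter> V)"
    proof
      fix s assume "s \<in> ?D \<inter> P -` N"
      then show "s \<in> Q ` (N \<inter> V)" by (intro image_eqI[of _ _ "P s"]) (auto simp: QP V_def)
    qed
    ultimately have "negligible (?D \<inter> P -` N)" by (rule negligible_subset)
    then have "emeasure lebesgue (?D \<inter> P -` N) = 0"
      by (simp add: negligible_iff_null_sets null_setsD1)
    then have "emeasure lborel (?D \<inter> P -` N) = 0" by simp
    then show "N \<in> null_sets \<nu>" by (simp add: null_sets_def em)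
  qed
  have fin\<nu>: "finite_measure \<nu>"
  proof (rule finite_measureI)
    have "emeasure \<nu> (space \<nu>) = emeasure lborel (?D \<inter> P -` UNIV)"
      by (subst em[symmetric]) (auto simp: \<nu>_def)
    also have "\<dots> \<le> emeasure lborel S" by (intro emeasure_mono) auto
    finally show "emeasure \<nu> (space \<nu>) \<noteq> \<infinity>" using fin by auto
  qed
  interpret \<nu>: finite_measure \<nu> by (rule fin\<nu>)
  let ?r = "\<lambda>z. enn2real (RN_deriv lborel \<nu> z)"
  define w where "w z = ?r z * indicator (P ` ?D) z" for z
  have rn_int: "integral\<^sup>L \<nu> K = (\<integral>z. ?r z * K z \<partial>lborel)" if "K \<in> borel_measurable borel" for K :: "'a \<Rightarrow> real"
    using that by (intro sigma_finite_measure.RN_deriv_integral[OF sigma_finite_lborel] ac \<nu>.sigma_finite_measure_axioms) auto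
  show ?thesis
  proof (rule that)
    have "integrable lborel (\<lambda>z. ?r z * indicator (P ` ?D) z)"
    proof (subst sigma_finite_measure.RN_deriv_integrable[OF sigma_finite_lborel, symmetric])
      have [measurable]: "indicat_real (P ` ?D) \<in> borel_measurable borel" by measurable
      then have "indicat_real (P ` ?D) \<in> borel_measurable \<nu>" by (simp add: \<nu>_def)
      then show "integrable \<nu> (indicat_real (P ` ?D))"
        by (intro \<nu>.integrable_const_bound[where B=1]) auto
      show "indicat_real (P ` ?D) \<in> borel_measurable lborel" by measurable
    qed (auto intro!: ac \<nu>.sigma_finite_measure_axioms)
    then show "integrable lborel w" by (simp add: w_def[abs_def])
    show "0 \<le> w z" for z by (simp add: w_def)
    show "Q \<in> borel_measurable borel" by measurable
    show "z \<in> P ` ?D \<and> Q differentiable (at z)" if "w z \<noteq> 0" for z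
      using that diff[of z] by (auto simp: w_def V_def indicator_def split: if_splits)
    fix \<phi> G :: "'a \<Rightarrow> real" assume [measurable]: "\<phi> \<in> borel_measurable borel" "G \<in> borel_measurable borel"
    let ?K = "\<lambda>z. indicator (P ` ?D) z * (\<phi> (Q z) * G z)"
    have "(\<integral>s. indicator ?D s * (\<phi> s * G (P s)) \<partial>lborel) = (\<integral>s. indicator ?D s * ?K (P s) \<partial>lborel)"
      by (intro Bochner_Integration.integral_cong refl) (auto split: split_indicator simp: QP)
    also have "\<dots> = (\<integral>s. ?K (P s) \<partial>\<mu>)"
    proof -
      have "(\<integral>s. ?K (P s) \<partial>\<mu>) = (\<integral>s. (indicator ?D s :: real) *\<^sub>R ?K (P s) \<partial>lborel)"
        unfolding \<mu>_def by (subst integral_density[symmetric]) (auto simp: ennreal_indicator)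
      then show ?thesis by simp
    qed
    also have "\<dots> = integral\<^sup>L \<nu> ?K"
      unfolding \<nu>_def by (subst integral_distr) (auto simp: \<mu>_def)
    also have "\<dots> = (\<integral>z. ?r z * ?K z \<partial>lborel)"
      by (rule rn_int) measurable
    also have "\<dots> = (\<integral>z. w z * (\<phi> (Q z) * G z) \<partial>lborel)"
      by (simp add: w_def mult_ac)
    finally show "(\<integral>s. indicator ?D s * (\<phi> s * G (P s)) \<partial>lborel) = (\<integral>z. w z * (\<phi> (Q z) * G z) \<partial>lborel)" .
  qed
qed

section \<open>The map of power sums\<close>

abbreviation square :: "(real \<times> real) set" where
  "square \<equiv> {0..1} \<times> {0..1}"

text \<open>
  The uniform distribution on the unit square. All averages over \<open>[0,N]\<^sup>2\<close> are rescaled to it, so that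
  they become integrals over one fixed probability space.
\<close>
definition unit_sq :: "(real \<times> real) measure" where
  "unit_sq = density lborel (indicator square)"

lemma box_borel[measurable]: "{a..b} \<times> {c..d} \<in> sets (borel :: (real \<times> real) measure)"
  by (intro borel_closed closed_Times) auto

lemma emeasure_box: "emeasure lborel ({0..a} \<times> {0..b} :: (real \<times> real) set) = ennreal (a * b)" if "0 \<le> a" "0 \<le> b"
  using that by (simp add: lborel_prod[symmetric] lborel.emeasure_pair_measure_Times ennreal_mult)

lemma sets_unit_sq[measurable_cong, simp]: "sets unit_sq = sets borel" "space unit_sq = UNIV"
  by (auto simp: unit_sq_def)

interpretation unit_sq: prob_space unit_sq
proof
  have "emeasure unit_sq UNIV = emeasure lborel square"
    unfolding unit_sq_def by (subst emeasure_density) auto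
  also have "\<dots> = 1" using emeasure_box[of 1 1] by simp
  finally show "emeasure unit_sq (space unit_sq) = 1" by simp
qed

lemma measure_unit_sq_UNIV[simp]: "measure unit_sq UNIV = 1"
  using unit_sq.prob_space by simp

lemma measurable_unit_sq[simp]: "measurable unit_sq N = measurable borel N"
  by (rule measurable_cong_sets) auto

lemma integral_unit_sq:
  fixes H :: "real \<times> real \<Rightarrow> real"
  assumes [measurable]: "H \<in> borel_measurable borel"
  shows "(\<integral>s. H s \<partial>unit_sq) = (\<integral>s. indicator square s * H s \<partial>lborel)"
proof -
  have "(\<integral>s. H s \<partial>unit_sq) = (\<integral>s. (indicator square s :: real) *\<^sub>R H s \<partial>lborel)"
    unfolding unit_sq_def by (subst integral_density[symmetric]) (auto simp: ennreal_indicator)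
  then show ?thesis by simp
qed

lemma (in prob_space) integral_abs_bound_const:
  fixes H :: "'a \<Rightarrow> real"
  assumes "\<And>x. x \<in> space M \<Longrightarrow> \<bar>H x\<bar> \<le> C" "0 \<le> C"
  shows "\<bar>\<integral>x. H x \<partial>M\<bar> \<le> C"
proof (cases "integrable M H")
  case True
  have "\<bar>\<integral>x. H x \<partial>M\<bar> \<le> (\<integral>x. \<bar>H x\<bar> \<partial>M)" by (rule integral_abs_bound)
  also have "\<dots> \<le> (\<integral>x. C \<partial>M)" using True assms by (intro integral_mono) auto
  finally show ?thesis by (simp add: prob_space)
qed (use assms in \<open>simp add: not_integrable_integral_eq\<close>)

lemma AE_not_hyperplane:
  fixes a :: "real \<times> real"
  assumes "a \<noteq> 0"
  shows "AE z in lborel. a \<bullet> z \<noteq> r"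
proof -
  have "negligible {z. a \<bullet> z = r}" using assms by (intro negligible_hyperplane) auto
  moreover have [measurable]: "{z. a \<bullet> z = r} \<in> sets borel" by measurable
  ultimately have "{z. a \<bullet> z = r} \<in> null_sets lborel"
    by (auto simp: negligible_iff_null_sets null_sets_def)
  then show ?thesis using AE_not_in by fastforce
qed

lemma AE_ne_coordinate:
  "AE z in lborel. fst z \<noteq> (c :: real) \<and> snd z \<noteq> (d :: real)"
proof -
  have "AE z in lborel. (1, 0) \<bullet> (z :: real \<times> real) \<noteq> c" "AE z in lborel. (0, 1) \<bullet> (z :: real \<times> real) \<noteq> d"
    by (intro AE_not_hyperplane; simp add: zero_prod_def)+
  then show ?thesis by eventually_elim (auto simp: inner_prod_def)
qed

definition power_sums :: "real \<times> real \<Rightarrow> real \<times> real" where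
  "power_sums s = (fst s ^ 2 + snd s ^ 2, fst s ^ 3 + snd s ^ 3)"

text \<open>
  The dilation under which \<open>power_sums\<close> is homogeneous.
\<close>
definition dil :: "real \<Rightarrow> real \<times> real \<Rightarrow> real \<times> real" where
  "dil N z = (N ^ 2 * fst z, N ^ 3 * snd z)"

lemma borel_fst_snd[measurable]:
  "(fst :: real \<times> real \<Rightarrow> real) \<in> borel_measurable borel"
  "(snd :: real \<times> real \<Rightarrow> real) \<in> borel_measurable borel"
  by (auto intro!: borel_measurable_continuous_onI continuous_intros)

lemma power_sums_borel[measurable]: "power_sums \<in> borel_measurable borel"
  unfolding power_sums_def[abs_def] by (intro borel_measurable_continuous_onI continuous_intros)

lemma dil_borel[measurable]: "dil N \<in> borel_measurable borel"
  unfolding dil_def[abs_def] by (intro borel_measurable_continuous_onI continuous_intros)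

lemma power_sums_scaleR: "power_sums (N *\<^sub>R s) = dil N (power_sums s)"
  by (simp add: power_sums_def dil_def power_mult_distrib algebra_simps)

text \<open>
  On a circle, the sum of cubes grows as the two coordinates move apart.
  With \<open>k = c\<^sup>2 - a\<^sup>2 = b\<^sup>2 - d\<^sup>2\<close>, the quotients \<open>(c\<^sup>3 - a\<^sup>3) / k\<close> and \<open>(b\<^sup>3 - d\<^sup>3) / k\<close> are separated by
  \<open>c + a/2\<close> and \<open>d + b/2\<close>.
\<close>
lemma power_sums_less:
  fixes a b c d :: real
  assumes "0 < a" "a < c" "c < d" "d < b" "a^2 + b^2 = c^2 + d^2"
  shows "c^3 + d^3 < a^3 + b^3"
proof -
  have "c^2 - a^2 > 0" using assms by (simp add: power_strict_mono)
  have id: "(p^3 - q^3) * (p + q) = (p^2 - q^2) * (p^2 + p*q + q^2)" for p q :: real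
    by (simp add: algebra_simps power2_eq_square power3_eq_cube)
  let ?k = "c^2 - a^2"
  have "(c^3 - a^3) * (c + a) < ?k * ((c + a/2) * (c + a))"
  proof -
    have "c^2 + c*a + a^2 < (c + a/2) * (c + a)"
      using assms(1,2) by (simp add: algebra_simps power2_eq_square)
    then show ?thesis unfolding id using \<open>?k > 0\<close> by (rule mult_strict_left_mono)
  qed
  then have 1: "c^3 - a^3 < ?k * (c + a/2)"
    using assms by (simp add: mult.assoc[symmetric] mult_less_cancel_right)
  have "(b^3 - d^3) * (b + d) > ?k * ((d + b/2) * (b + d))"
  proof -
    have "b^2 + b*d + d^2 > (d + b/2) * (b + d)"
      using assms(1-4) by (simp add: algebra_simps power2_eq_square)
    moreover have "b^2 - d^2 = ?k" using assms(5) by simp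
    ultimately show ?thesis unfolding id using \<open>?k > 0\<close> by simp
  qed
  then have 2: "b^3 - d^3 > ?k * (d + b/2)"
    using assms by (simp add: mult.assoc[symmetric] mult_less_cancel_right)
  have "?k * (c + a/2) < ?k * (d + b/2)"
    using assms \<open>?k > 0\<close> by (intro mult_strict_left_mono) auto
  with 1 2 show ?thesis by simp
qed

lemma power_sums_inj_ordered:
  fixes a b c d :: real
  assumes "0 < a" "a < b" "0 < c" "c < d" "a^2 + b^2 = c^2 + d^2" "a^3 + b^3 = c^3 + d^3"
  shows "a = c \<and> b = d"
proof -
  have key: False if "0 < a" "a < b" "0 < c" "c < d" "a^2 + b^2 = c^2 + d^2" "a^3 + b^3 = c^3 + d^3" "a < c"
    for a b c d :: real
  proof -
    have "a^2 < c^2" using that by (simp add: power_strict_mono)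
    then have "d^2 < b^2" using that by simp
    then have "d < b" using that by (simp add: power2_less_imp_less)
    then show False using power_sums_less[of a c d b] that by simp
  qed
  have "a = c" using key[of a b c d] key[of c d a b] assms by (metis linorder_neqE_linordered_idom)
  then have "b^2 = d^2" using assms by simp
  then show ?thesis using \<open>a = c\<close> assms by (simp add: power2_eq_iff)
qed

text \<open>
  The two halves of the open quadrant off the diagonal. On each of them the power sums are injective
  with invertible derivative; on their union they take every value twice.
\<close>
definition wedge :: "bool \<Rightarrow> (real \<times> real) set" where
  "wedge lower = (if lower then {s. 0 < fst s \<and> fst s < snd s} else {s. 0 < snd s \<and> snd s < fst s})"

lemma open_wedge: "open (wedge i)"
  by (auto simp: wedge_def Collect_conj_eq intro!: open_Int open_Collect_less continuous_intros)

lemma power_sums_inj_wedge: "inj_on power_sums (wedge i)"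
proof (rule inj_onI)
  fix s t assume "s \<in> wedge i" "t \<in> wedge i" "power_sums s = power_sums t"
  then show "s = t"
    using power_sums_inj_ordered[of "fst s" "snd s" "fst t" "snd t"]
      power_sums_inj_ordered[of "snd s" "fst s" "snd t" "fst t"]
    by (cases i; auto simp: wedge_def power_sums_def prod_eq_iff add.commute)
qed

lemma power_sums_has_derivative:
  "(power_sums has_derivative
     (\<lambda>h. (2 * fst s * fst h + 2 * snd s * snd h, 3 * fst s ^ 2 * fst h + 3 * snd s ^ 2 * snd h))) (at s)"
  unfolding power_sums_def[abs_def]
  by (auto intro!: derivative_eq_intros simp: algebra_simps)

lemma power_sums_derivative_inj:
  assumes "s \<in> wedge i"
  shows "inj (\<lambda>h :: real \<times> real.
    (2 * fst s * fst h + 2 * snd s * snd h, 3 * fst s ^ 2 * fst h + 3 * snd s ^ 2 * snd h))"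
    (is "inj ?D")
proof -
  have lin: "linear ?D" using power_sums_has_derivative by (rule has_derivative_linear)
  show ?thesis
    unfolding linear_injective_0[OF lin]
  proof (intro allI impI)
    fix h assume "?D h = 0"
    then have e: "fst s * fst h + snd s * snd h = 0" "fst s ^ 2 * fst h + snd s ^ 2 * snd h = 0"
      by (simp_all add: zero_prod_def)
    have nz: "fst s \<noteq> 0" "snd s \<noteq> 0" "fst s \<noteq> snd s" using assms by (auto simp: wedge_def split: if_splits)
    have "fst s * (snd s - fst s) * fst h = 0" "snd s * (snd s - fst s) * snd h = 0"
      using e by algebra+
    with nz show "h = 0" by (simp add: prod_eq_iff)
  qed
qed

lemma power_sums_wedge_density:
  obtains w :: "real \<times> real \<Rightarrow> real" and Q where
    "integrable lborel w" "\<And>z. 0 \<le> w z" "Q \<in> borel_measurable borel"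
    "\<And>z. w z \<noteq> 0 \<Longrightarrow> z \<in> {0..2} \<times> {0..2} \<and> Q differentiable (at z)"
    "\<And>(\<phi> :: real \<times> real \<Rightarrow> real) G. \<phi> \<in> borel_measurable borel \<Longrightarrow> G \<in> borel_measurable borel \<Longrightarrow>
       (\<integral>s. indicator (square \<inter> wedge i) s * (\<phi> s * G (power_sums s)) \<partial>lborel)
         = (\<integral>z. w z * (\<phi> (Q z) * G z) \<partial>lborel)"
proof -
  have fin: "emeasure lborel square < \<infinity>" using emeasure_box[of 1 1] by simp
  note A = image_density_injective[OF open_wedge power_sums_inj_wedge power_sums_borel power_sums_has_derivative
      power_sums_derivative_inj[of _ i] box_borel fin]
  obtain w :: "real \<times> real \<Rightarrow> real" and Q where wQ: "integrable lborel w" "\<And>z. 0 \<le> w z" "Q \<in> borel_measurable borel"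
    "\<And>z. w z \<noteq> 0 \<Longrightarrow> z \<in> power_sums ` (square \<inter> wedge i) \<and> Q differentiable (at z)"
    "\<And>(\<phi> :: real \<times> real \<Rightarrow> real) G. \<phi> \<in> borel_measurable borel \<Longrightarrow> G \<in> borel_measurable borel \<Longrightarrow>
       (\<integral>s. indicator (square \<inter> wedge i) s * (\<phi> s * G (power_sums s)) \<partial>lborel)
         = (\<integral>z. w z * (\<phi> (Q z) * G z) \<partial>lborel)"
    by (rule A) blast+
  have "power_sums s \<in> {0..2} \<times> {0..2}" if "s \<in> square" for s
    using that power_le_one[of "fst s"] power_le_one[of "snd s"]
    by (auto simp: power_sums_def intro: order_trans[OF add_mono, of _ 1 _ 1])
  then show ?thesis using wQ by (intro that[of w Q]) blast+
qed

lemma integral_unit_sq_wedges: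
  fixes H :: "real \<times> real \<Rightarrow> real"
  assumes [measurable]: "H \<in> borel_measurable borel" and bd: "\<And>s. \<bar>H s\<bar> \<le> C"
  shows "(\<integral>s. H s \<partial>unit_sq) =
    (\<integral>s. indicator (square \<inter> wedge True) s * H s \<partial>lborel) + (\<integral>s. indicator (square \<inter> wedge False) s * H s \<partial>lborel)"
proof -
  have [measurable]: "wedge i \<in> sets borel" for i using open_wedge by simp
  have int: "integrable lborel (\<lambda>s. indicator (square \<inter> wedge i) s * H s)" for i
  proof (rule Bochner_Integration.integrable_bound)
    show "integrable lborel (\<lambda>s. C * indicator square s)" using emeasure_box[of 1 1] by simp
    have "0 \<le> C" using bd[of 0] by linarith
    then show "AE s in lborel. norm (indicator (square \<inter> wedge i) s * H s) \<le> norm (C * indicator square s)"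
      using bd by (auto split: split_indicator)
  qed measurable
  have diagonal: "AE s in lborel. fst s \<noteq> (snd s :: real)"
    using AE_not_hyperplane[of "(1, -1)" 0] by (auto simp: zero_prod_def inner_prod_def)
  have "(\<integral>s. H s \<partial>unit_sq) = (\<integral>s. indicator square s * H s \<partial>lborel)" by (rule integral_unit_sq) simp
  also have "\<dots> = (\<integral>s. indicator (square \<inter> wedge True) s * H s + indicator (square \<inter> wedge False) s * H s \<partial>lborel)"
  proof (rule integral_cong_AE)
    have "AE s in lborel. fst s \<noteq> 0 \<and> snd s \<noteq> 0 \<and> fst s \<noteq> (snd s :: real)"
      using AE_ne_coordinate[of 0 0] diagonal
      by eventually_elim auto
    then show "AE s in lborel. indicator square s * H s =
        indicator (square \<inter> wedge True) s * H s + indicator (square \<inter> wedge False) s * H s"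
      by eventually_elim (auto split: split_indicator simp: wedge_def)
  qed measurable
  also have "\<dots> = (\<integral>s. indicator (square \<inter> wedge True) s * H s \<partial>lborel) + (\<integral>s. indicator (square \<inter> wedge False) s * H s \<partial>lborel)"
    using int by simp
  finally show ?thesis .
qed

section \<open>Averages along the power sums\<close>

text \<open>
  Increments of \<open>Q\<close> are at most proportional to the displacement, so a factor that is negligible
  against the displacement is negligible against the increment.
\<close>
lemma differentiable_scaled_increment:
  fixes Q :: "'a::real_normed_vector \<Rightarrow> 'b::real_normed_vector" and N :: "nat \<Rightarrow> real"
  assumes "Q differentiable (at z)" and h: "h \<longlonglongrightarrow> 0" and Nh: "(\<lambda>n. N n * norm (h n)) \<longlonglongrightarrow> 0"
  shows "(\<lambda>n. N n * norm (Q (z + h n) - Q z)) \<longlonglongrightarrow> 0"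
proof -
  obtain Q' where Q': "(Q has_derivative Q') (at z)" using assms(1) by (auto simp: differentiable_def)
  then have bl: "bounded_linear Q'" by (rule has_derivative_bounded_linear)
  then obtain B where B: "\<And>y. norm (Q' y) \<le> norm y * B" using bounded_linear.bounded by blast
  obtain d where d: "d > 0" "\<And>y. norm (y - z) < d \<Longrightarrow> norm (Q y - Q z - Q' (y - z)) \<le> 1 * norm (y - z)"
    using Q' unfolding has_derivative_at_alt by (metis zero_less_one)
  have ev: "\<forall>\<^sub>F n in sequentially. norm (h n) < d"
    using tendsto_norm_zero[OF h] d(1) by (rule order_tendstoD)
  have "(\<lambda>n. (1 + B) * \<bar>N n * norm (h n)\<bar>) \<longlonglongrightarrow> 0"
    using tendsto_mult_right_zero[OF tendsto_rabs_zero[OF Nh], of "1 + B"] .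
  then show ?thesis
  proof (rule Lim_null_comparison[rotated])
    show "\<forall>\<^sub>F n in sequentially. norm (N n * norm (Q (z + h n) - Q z)) \<le> (1 + B) * \<bar>N n * norm (h n)\<bar>"
      using ev
    proof eventually_elim
      case (elim n)
      have "norm (Q (z + h n) - Q z) \<le> norm (Q (z + h n) - Q z - Q' (h n)) + norm (Q' (h n))"
        by norm
      also have "\<dots> \<le> (1 + B) * norm (h n)"
        using d(2)[of "z + h n"] B[of "h n"] elim by (simp add: algebra_simps)
      finally have "\<bar>N n\<bar> * norm (Q (z + h n) - Q z) \<le> \<bar>N n\<bar> * ((1 + B) * norm (h n))"
        by (intro mult_left_mono) auto
      then show ?case by (simp add: abs_mult mult_ac)
    qed
  qed
qed

text \<open>
  In the coordinates \<open>z = P(s)\<close> the shift of \<open>G\<close> by \<open>v\<close> is a translation of \<open>z\<close> by a vector of length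
  \<open>O(N\<^sup>-\<^sup>2)\<close>, which is moved from \<open>G\<close> to the other factor \<open>w(z) F(N Q(z))\<close>. There the density \<open>w\<close> changes
  little in the mean, and the argument of \<open>F\<close> changes by \<open>N O(N\<^sup>-\<^sup>2)\<close> because \<open>Q\<close> is differentiable.
\<close>
lemma density_shift_average_tendsto_0:
  fixes w F G :: "real \<times> real \<Rightarrow> real" and N :: "nat \<Rightarrow> real"
  assumes w: "integrable lborel w" "\<And>z. 0 \<le> w z" and Q[measurable]: "Q \<in> borel_measurable borel"
    and Q_diff: "\<And>z. w z \<noteq> 0 \<Longrightarrow> Q differentiable (at z)"
    and F[measurable]: "F \<in> borel_measurable borel" and FC: "\<And>t. \<bar>F t\<bar> \<le> C"
    and FL: "uniformly_continuous_on UNIV F"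
    and G[measurable]: "G \<in> borel_measurable borel" and GD: "\<And>z. \<bar>G z\<bar> \<le> D"
    and N: "filterlim N at_top sequentially"
  shows "(\<lambda>n. \<integral>z. w z * (F (N n *\<^sub>R Q z) * (G (dil (N n) z) - G (dil (N n) z + v))) \<partial>lborel) \<longlonglongrightarrow> 0"
proof -
  have wm[measurable]: "w \<in> borel_measurable borel" using w by (auto dest: borel_measurable_integrable)
  have C0: "0 \<le> C" using FC[of 0] by linarith
  have D0: "0 \<le> D" using GD[of 0] by linarith
  \<comment> \<open>Chosen so that the dilation turns a translation by \<open>h n\<close> into one by \<open>- v\<close>.\<close>
  define h where "h n = (- fst v / N n ^ 2, - snd v / N n ^ 3)" for n
  have ev1: "\<forall>\<^sub>F n in sequentially. 1 \<le> N n" using N unfolding filterlim_at_top by blast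
  have hle: "norm (h n) \<le> norm v / N n ^ 2" if "1 \<le> N n" for n
  proof -
    have "norm (h n) \<le> norm ((1 / N n ^ 2) *\<^sub>R v)"
    proof (rule norm_le_componentwise)
      fix b :: "real \<times> real" assume "b \<in> Basis"
      have "N n ^ 2 \<le> N n ^ 3" using that by (intro power_increasing) auto
      then have "\<bar>snd v\<bar> / N n ^ 3 \<le> \<bar>snd v\<bar> / N n ^ 2"
        using that by (intro divide_left_mono mult_pos_pos) auto
      with \<open>b \<in> Basis\<close> that show "\<bar>h n \<bullet> b\<bar> \<le> \<bar>((1 / N n ^ 2) *\<^sub>R v) \<bullet> b\<bar>"
        by (auto simp: h_def Basis_prod_def inner_prod_def abs_divide)
    qed
    then show ?thesis using that by simp
  qed
  have inv: "(\<lambda>n. inverse (N n)) \<longlonglongrightarrow> 0" using N by (rule tendsto_inverse_0_at_top)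
  have Nh: "(\<lambda>n. N n * norm (h n)) \<longlonglongrightarrow> 0"
  proof (rule Lim_null_comparison)
    show "\<forall>\<^sub>F n in sequentially. norm (N n * norm (h n)) \<le> norm v * inverse (N n)"
      using ev1
    proof eventually_elim
      case (elim n)
      have "N n * norm (h n) \<le> N n * (norm v / N n ^ 2)" using hle[OF elim] elim by (intro mult_left_mono) auto
      also have "\<dots> = norm v * inverse (N n)" using elim by (simp add: field_simps power2_eq_square)
      finally show ?case using elim by simp
    qed
    show "(\<lambda>n. norm v * inverse (N n)) \<longlonglongrightarrow> 0" using tendsto_mult_right_zero[OF inv] .
  qed
  have h: "h \<longlonglongrightarrow> 0"
  proof (rule Lim_null_comparison[OF _ Nh])
    show "\<forall>\<^sub>F n in sequentially. norm (h n) \<le> N n * norm (h n)"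
      using ev1 by eventually_elim (simp add: mult_le_cancel_right1)
  qed
  have wtr: "integrable lborel (\<lambda>z. w (z + a))" for a using w by (simp add: lborel_integrable_translate)
  let ?E1 = "\<lambda>n. \<integral>z. \<bar>w (z + h n) - w z\<bar> \<partial>lborel"
  let ?e2 = "\<lambda>n z. w z * \<bar>F (N n *\<^sub>R Q z) - F (N n *\<^sub>R Q (z + h n))\<bar>"
  have e2b: "\<bar>?e2 n z\<bar> \<le> 2 * C * w z" for n z
    using mult_left_mono[OF _ w(2)[of z], of "\<bar>F (N n *\<^sub>R Q z) - F (N n *\<^sub>R Q (z + h n))\<bar>" "2 * C"]
      FC[of "N n *\<^sub>R Q z"] FC[of "N n *\<^sub>R Q (z + h n)"] w(2)[of z] by (simp add: mult_ac)
  have int2: "integrable lborel (?e2 n)" for n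
    by (rule Bochner_Integration.integrable_bound[where f="\<lambda>z. 2 * C * w z"])
      (use w e2b in \<open>auto intro!: order_trans[OF _ abs_ge_self]\<close>)
  have E1: "?E1 \<longlonglongrightarrow> 0" using w(1) h by (rule L1_translation_continuous)
  have "(\<lambda>n. \<integral>z. ?e2 n z \<partial>lborel) \<longlonglongrightarrow> (\<integral>z. 0 \<partial>(lborel :: (real \<times> real) measure))"
  proof (rule integral_dominated_convergence[where w="\<lambda>z. 2 * C * w z"])
    show "AE z in lborel. (\<lambda>n. ?e2 n z) \<longlonglongrightarrow> 0"
    proof (intro AE_I2)
      fix z :: "real \<times> real"
      show "(\<lambda>n. ?e2 n z) \<longlonglongrightarrow> 0"
      proof (cases "w z = 0")
        case False
        have "(\<lambda>n. norm (N n *\<^sub>R Q z - N n *\<^sub>R Q (z + h n))) \<longlonglongrightarrow> 0"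
          using differentiable_scaled_increment[OF Q_diff[OF False] h Nh, THEN tendsto_rabs_zero]
          by (simp add: scaleR_diff_right[symmetric] norm_minus_commute abs_mult)
        then have "(\<lambda>n. dist (F (N n *\<^sub>R Q z)) (F (N n *\<^sub>R Q (z + h n)))) \<longlonglongrightarrow> 0"
          using FL unfolding uniformly_continuous_on_sequentially by (simp add: dist_norm)
        then show ?thesis by (intro tendsto_mult_right_zero) (simp add: dist_real_def)
      qed simp
    qed
    show "AE z in lborel. norm (?e2 n z) \<le> 2 * C * w z" for n using e2b by simp
  qed (use w in auto)
  then have E2: "(\<lambda>n. \<integral>z. ?e2 n z \<partial>lborel) \<longlonglongrightarrow> 0" by simp
  show ?thesis
  proof (rule Lim_null_comparison)
    have "(\<lambda>n. D * ((\<integral>z. ?e2 n z \<partial>lborel) + C * ?E1 n)) \<longlonglongrightarrow> D * (0 + C * 0)"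
      by (intro tendsto_intros E1 E2)
    then show "(\<lambda>n. D * ((\<integral>z. ?e2 n z \<partial>lborel) + C * ?E1 n)) \<longlonglongrightarrow> 0" by simp
    show "\<forall>\<^sub>F n in sequentially. norm (\<integral>z. w z * (F (N n *\<^sub>R Q z) * (G (dil (N n) z) - G (dil (N n) z + v))) \<partial>lborel)
        \<le> D * ((\<integral>z. ?e2 n z \<partial>lborel) + C * ?E1 n)"
      using ev1
    proof eventually_elim
      case (elim n)
      let ?\<Phi> = "\<lambda>z. w z * F (N n *\<^sub>R Q z)" and ?H = "\<lambda>z. G (dil (N n) z)"
      have \<Phi>b: "\<bar>?\<Phi> z\<bar> \<le> C * w z" for z
        using mult_left_mono[OF FC[of "N n *\<^sub>R Q z"] w(2)[of z]] w(2)[of z] by (simp add: abs_mult mult_ac)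
      have \<Phi>: "integrable lborel ?\<Phi>"
        by (rule Bochner_Integration.integrable_bound[where f="\<lambda>z. C * w z"])
          (use w \<Phi>b in \<open>auto intro!: order_trans[OF _ abs_ge_self]\<close>)
      have \<Phi>tr: "integrable lborel (\<lambda>z. ?\<Phi> (z + h n))"
        using \<Phi> by (subst lborel_integrable_translate) auto
      have bdint: "integrable lborel (\<lambda>z. f z * k z)"
        if "integrable lborel f" "k \<in> borel_measurable borel" "\<And>z. \<bar>k z\<bar> \<le> D" for f k :: "real \<times> real \<Rightarrow> real"
      proof (rule Bochner_Integration.integrable_bound[where f="\<lambda>z. D * f z"])
        show "AE z in lborel. norm (f z * k z) \<le> norm (D * f z)"
          using mult_right_mono[OF that(3), of "\<bar>f _\<bar>"] D0 by (auto simp: abs_mult mult_ac)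
      qed (use that in auto)
      have b1: "integrable lborel (\<lambda>z. ?\<Phi> z * ?H z)" by (rule bdint[OF \<Phi>]) (use GD in auto)
      have b2: "integrable lborel (\<lambda>z. ?\<Phi> z * G (dil (N n) z + v))" by (rule bdint[OF \<Phi>]) (use GD in auto)
      have b3: "integrable lborel (\<lambda>z. ?\<Phi> (z + h n) * ?H z)" by (rule bdint[OF \<Phi>tr]) (use GD in auto)
      have dil_h: "dil (N n) (z + h n) = dil (N n) z - v" for z
        using elim by (auto simp: dil_def h_def prod_eq_iff field_simps)
      have "(\<integral>z. w z * (F (N n *\<^sub>R Q z) * (G (dil (N n) z) - G (dil (N n) z + v))) \<partial>lborel)
         = (\<integral>z. ?\<Phi> z * ?H z - ?\<Phi> z * G (dil (N n) z + v) \<partial>lborel)"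
        by (simp add: algebra_simps)
      also have "\<dots> = (\<integral>z. ?\<Phi> z * ?H z \<partial>lborel) - (\<integral>z. ?\<Phi> z * G (dil (N n) z + v) \<partial>lborel)"
        by (rule Bochner_Integration.integral_diff[OF b1 b2])
      also have "(\<integral>z. ?\<Phi> z * G (dil (N n) z + v) \<partial>lborel) = (\<integral>z. ?\<Phi> (z + h n) * G (dil (N n) (z + h n) + v) \<partial>lborel)"
        by (rule lborel_integral_translate[symmetric]) measurable
      also have "\<dots> = (\<integral>z. ?\<Phi> (z + h n) * ?H z \<partial>lborel)" by (simp add: dil_h)
      also have "(\<integral>z. ?\<Phi> z * ?H z \<partial>lborel) - (\<integral>z. ?\<Phi> (z + h n) * ?H z \<partial>lborel)
          = (\<integral>z. ?\<Phi> z * ?H z - ?\<Phi> (z + h n) * ?H z \<partial>lborel)"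
        by (rule Bochner_Integration.integral_diff[OF b1 b3, symmetric])
      finally have eq: "(\<integral>z. w z * (F (N n *\<^sub>R Q z) * (G (dil (N n) z) - G (dil (N n) z + v))) \<partial>lborel)
          = (\<integral>z. ?\<Phi> z * ?H z - ?\<Phi> (z + h n) * ?H z \<partial>lborel)" .
      have le: "norm (\<integral>z. ?\<Phi> z * ?H z - ?\<Phi> (z + h n) * ?H z \<partial>lborel)
          \<le> (\<integral>z. D * (?e2 n z + C * \<bar>w (z + h n) - w z\<bar>) \<partial>lborel)"
      proof (rule Bochner_Integration.integral_norm_bound_integral)
        show "integrable lborel (\<lambda>z. ?\<Phi> z * ?H z - ?\<Phi> (z + h n) * ?H z)"
          using b1 b3 by (rule Bochner_Integration.integrable_diff)
        show "integrable lborel (\<lambda>z. D * (?e2 n z + C * \<bar>w (z + h n) - w z\<bar>))"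
          using int2 w wtr by auto
        fix z
        have "?\<Phi> z - ?\<Phi> (z + h n) = w z * (F (N n *\<^sub>R Q z) - F (N n *\<^sub>R Q (z + h n)))
            - (w (z + h n) - w z) * F (N n *\<^sub>R Q (z + h n))" by (simp add: algebra_simps)
        also have "\<bar>\<dots>\<bar> \<le> \<bar>w z * (F (N n *\<^sub>R Q z) - F (N n *\<^sub>R Q (z + h n)))\<bar>
            + \<bar>(w (z + h n) - w z) * F (N n *\<^sub>R Q (z + h n))\<bar>" by (rule abs_triangle_ineq4)
        also have "\<dots> \<le> ?e2 n z + C * \<bar>w (z + h n) - w z\<bar>"
          using mult_right_mono[OF FC[of "N n *\<^sub>R Q (z + h n)"], of "\<bar>w (z + h n) - w z\<bar>"] w(2)[of z]
          by (simp add: abs_mult mult_ac)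
        finally have 1: "\<bar>?\<Phi> z - ?\<Phi> (z + h n)\<bar> \<le> ?e2 n z + C * \<bar>w (z + h n) - w z\<bar>" .
        have "norm (?\<Phi> z * ?H z - ?\<Phi> (z + h n) * ?H z) = \<bar>?H z\<bar> * \<bar>?\<Phi> z - ?\<Phi> (z + h n)\<bar>"
          unfolding left_diff_distrib[symmetric] real_norm_def abs_mult by (rule mult.commute)
        also have "\<dots> \<le> D * (?e2 n z + C * \<bar>w (z + h n) - w z\<bar>)"
          using GD 1 D0 by (intro mult_mono) auto
        finally show "norm (?\<Phi> z * ?H z - ?\<Phi> (z + h n) * ?H z) \<le> D * (?e2 n z + C * \<bar>w (z + h n) - w z\<bar>)" .
      qed
      have "(\<integral>z. D * (?e2 n z + C * \<bar>w (z + h n) - w z\<bar>) \<partial>lborel) = D * ((\<integral>z. ?e2 n z \<partial>lborel) + C * ?E1 n)"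
        using int2 w wtr by simp
      with le eq show ?case by (simp only:)
    qed
  qed
qed

text \<open>
  Averages along the power sums do not distinguish, in the limit, \<open>G\<close> from its translates.
\<close>
lemma shift_average_tendsto_0:
  fixes F G :: "real \<times> real \<Rightarrow> real" and N :: "nat \<Rightarrow> real"
  assumes F[measurable]: "F \<in> borel_measurable borel" and FC: "\<And>t. \<bar>F t\<bar> \<le> C"
    and FL: "uniformly_continuous_on UNIV F"
    and G[measurable]: "G \<in> borel_measurable borel" and GD: "\<And>z. \<bar>G z\<bar> \<le> D"
    and N: "filterlim N at_top sequentially"
  shows "(\<lambda>n. \<integral>s. F (N n *\<^sub>R s) * (G (dil (N n) (power_sums s)) - G (dil (N n) (power_sums s) + v)) \<partial>unit_sq) \<longlonglongrightarrow> 0"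
proof -
  let ?H = "\<lambda>n s. F (N n *\<^sub>R s) * (G (dil (N n) (power_sums s)) - G (dil (N n) (power_sums s) + v))"
  have piece: "(\<lambda>n. \<integral>s. indicator (square \<inter> wedge i) s * ?H n s \<partial>lborel) \<longlonglongrightarrow> 0" for i
  proof -
    obtain w :: "real \<times> real \<Rightarrow> real" and Q where wQ:
      "integrable lborel w" "\<And>z. 0 \<le> w z" "Q \<in> borel_measurable borel"
      "\<And>z. w z \<noteq> 0 \<Longrightarrow> z \<in> {0..2} \<times> {0..2} \<and> Q differentiable (at z)"
      "\<And>(\<phi> :: real \<times> real \<Rightarrow> real) G. \<phi> \<in> borel_measurable borel \<Longrightarrow> G \<in> borel_measurable borel \<Longrightarrow>
       (\<integral>s. indicator (square \<inter> wedge i) s * (\<phi> s * G (power_sums s)) \<partial>lborel)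
         = (\<integral>z. w z * (\<phi> (Q z) * G z) \<partial>lborel)"
      using power_sums_wedge_density[of i] by blast
    have "(\<integral>s. indicator (square \<inter> wedge i) s * ?H n s \<partial>lborel) =
      (\<integral>z. w z * (F (N n *\<^sub>R Q z) * (G (dil (N n) z) - G (dil (N n) z + v))) \<partial>lborel)" for n
      by (rule wQ(5)[of "\<lambda>s. F (N n *\<^sub>R s)" "\<lambda>z. G (dil (N n) z) - G (dil (N n) z + v)"]) measurable
    then show ?thesis
      using density_shift_average_tendsto_0[OF wQ(1-3) _ F FC FL G GD N] wQ(4) by simp
  qed
  have "\<bar>?H n s\<bar> \<le> C * (2 * D)" for n s
    unfolding abs_mult using FC[of "N n *\<^sub>R s"] GD[of "dil (N n) (power_sums s)"] GD[of "dil (N n) (power_sums s) + v"]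
    by (intro mult_mono) auto
  then have "(\<integral>s. ?H n s \<partial>unit_sq) = (\<integral>s. indicator (square \<inter> wedge True) s * ?H n s \<partial>lborel)
     + (\<integral>s. indicator (square \<inter> wedge False) s * ?H n s \<partial>lborel)" for n
    by (intro integral_unit_sq_wedges) auto
  then show ?thesis using tendsto_add[OF piece[of True] piece[of False]] by simp
qed

lemma density_truncation:
  fixes w :: "'a \<Rightarrow> real"
  assumes w: "integrable M w" and "e > 0"
  obtains K :: real where "0 \<le> K" "(\<integral>z. max 0 (w z - K) \<partial>M) < e" "integrable M (\<lambda>z. max 0 (w z - K))"
proof -
  have "(\<lambda>n. \<integral>z. max 0 (w z - real n) \<partial>M) \<longlonglongrightarrow> (\<integral>z. 0 \<partial>M)"
  proof (rule integral_dominated_convergence[where w="\<lambda>z. \<bar>w z\<bar>"])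
    show "AE z in M. (\<lambda>n. max 0 (w z - real n)) \<longlonglongrightarrow> 0"
    proof (intro AE_I2)
      fix z
      obtain n0 where "w z \<le> real n0" using real_arch_simple by blast
      then have "\<forall>\<^sub>F n in sequentially. max 0 (w z - real n) = 0"
        unfolding eventually_sequentially by (intro exI[of _ n0]) auto
      then show "(\<lambda>n. max 0 (w z - real n)) \<longlonglongrightarrow> 0" by (rule tendsto_eventually)
    qed
  qed (use w in auto)
  then have "\<forall>\<^sub>F n in sequentially. (\<integral>z. max 0 (w z - real n) \<partial>M) < e"
    using \<open>e > 0\<close> by (intro order_tendstoD(2)) auto
  then obtain n where "(\<integral>z. max 0 (w z - real n) \<partial>M) < e" by (auto simp: eventually_sequentially)
  moreover have "integrable M (\<lambda>z. max 0 (w z - real n))"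
    by (rule Bochner_Integration.integrable_bound[OF w]) (use w in auto)
  ultimately show ?thesis by (intro that[of "real n"]) auto
qed

lemma lborel_integral_scale_pair:
  fixes f :: "real \<times> real \<Rightarrow> real"
  assumes [measurable]: "f \<in> borel_measurable borel" and ab: "0 < a" "0 < b"
  shows "(\<integral>z. f z \<partial>lborel) = a * b * (\<integral>s. f (a * fst s, b * snd s) \<partial>lborel)"
proof -
  let ?c = "\<lambda>j :: real \<times> real. if j = (1, 0) then a else b"
  have T: "0 + (\<Sum>j\<in>Basis. (?c j * (x \<bullet> j)) *\<^sub>R j) = (a * fst x, b * snd x)" for x :: "real \<times> real"
    by (simp add: Basis_prod_def sum.union_disjoint image_iff inner_prod_def prod_eq_iff)
  have p: "(\<Prod>j\<in>Basis. \<bar>?c j\<bar>) = a * b"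
    using ab by (simp add: Basis_prod_def prod.union_disjoint image_iff)
  have "lborel = density (distr lborel borel (\<lambda>s :: real \<times> real. (a * fst s, b * snd s))) (\<lambda>_. ennreal (a * b))"
    using lborel_affine_euclidean[of ?c 0, unfolded T p] ab by auto
  then have "(\<integral>z. f z \<partial>lborel) = (\<integral>z. f z \<partial>density (distr lborel borel (\<lambda>s. (a * fst s, b * snd s))) (\<lambda>_. ennreal (a * b)))"
    by simp
  also have "\<dots> = (\<integral>s. (a * b) *\<^sub>R f (a * fst s, b * snd s) \<partial>lborel)"
    using ab by (subst integral_density) (auto simp: integral_distr)
  finally show ?thesis by simp
qed

lemma integral_unit_sq_scale:
  fixes H :: "real \<times> real \<Rightarrow> real"
  assumes [measurable]: "H \<in> borel_measurable borel" and ab: "0 < a" "0 < b"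
  shows "a * b * (\<integral>s. H (a * fst s, b * snd s) \<partial>unit_sq) = (\<integral>z. indicator ({0..a} \<times> {0..b}) z * H z \<partial>lborel)"
proof -
  have "a * b * (\<integral>s. H (a * fst s, b * snd s) \<partial>unit_sq) = a * b * (\<integral>s. indicator square s * H (a * fst s, b * snd s) \<partial>lborel)"
    by (subst integral_unit_sq) auto
  also have "(\<integral>s. indicator square s * H (a * fst s, b * snd s) \<partial>lborel) =
      (\<integral>s. indicator ({0..a} \<times> {0..b}) (a * fst s, b * snd s) * H (a * fst s, b * snd s) \<partial>lborel)"
    using ab by (intro Bochner_Integration.integral_cong refl)
      (auto split: split_indicator simp: zero_le_mult_iff mult_le_cancel_left1)
  also have "a * b * \<dots> = (\<integral>z. indicator ({0..a} \<times> {0..b}) z * H z \<partial>lborel)"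
    using ab by (subst (2) lborel_integral_scale_pair[of _ a b]) auto
  finally show ?thesis .
qed

text \<open>
  Where the density of the image measure exceeds a large constant, the excess has small integral and
  contributes at most \<open>D * e\<close>; the rest of the image measure is bounded by a multiple of Lebesgue measure on
  \<open>[0,2]\<^sup>2\<close>, which contains the image of the unit square. This plays the part of a maximal inequality:
  as \<open>K\<close> depends only on \<open>e\<close>, the estimate holds uniformly for all dilates of a function.
\<close>
lemma power_sums_average_le:
  fixes e :: real
  assumes "e > 0"
  obtains K where "0 \<le> K" "\<And>D k. k \<in> borel_measurable borel \<Longrightarrow> (\<And>z. 0 \<le> k z \<and> k z \<le> D) \<Longrightarrow>
    (\<integral>s. k (power_sums s) \<partial>unit_sq) \<le> K * (\<integral>s. k (2 *\<^sub>R s) \<partial>unit_sq) + D * e"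
proof -
  have piece: "\<exists>K\<ge>0. \<forall>D k. k \<in> borel_measurable borel \<longrightarrow> (\<forall>z. 0 \<le> k z \<and> k z \<le> D) \<longrightarrow>
    (\<integral>s. indicator (square \<inter> wedge i) s * k (power_sums s) \<partial>lborel)
      \<le> K * (\<integral>z. indicator ({0..2} \<times> {0..2}) z * k z \<partial>lborel) + D * (e/2)" for i
  proof -
    obtain w :: "real \<times> real \<Rightarrow> real" and Q where wQ:
      "integrable lborel w" "\<And>z. 0 \<le> w z" "Q \<in> borel_measurable borel"
      "\<And>z. w z \<noteq> 0 \<Longrightarrow> z \<in> {0..2} \<times> {0..2} \<and> Q differentiable (at z)"
      "\<And>(\<phi> :: real \<times> real \<Rightarrow> real) G. \<phi> \<in> borel_measurable borel \<Longrightarrow> G \<in> borel_measurable borel \<Longrightarrow>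
       (\<integral>s. indicator (square \<inter> wedge i) s * (\<phi> s * G (power_sums s)) \<partial>lborel)
         = (\<integral>z. w z * (\<phi> (Q z) * G z) \<partial>lborel)"
      using power_sums_wedge_density[of i] by blast
    have wm[measurable]: "w \<in> borel_measurable borel" using wQ(1) by (auto dest: borel_measurable_integrable)
    obtain K where K: "0 \<le> K" "(\<integral>z. max 0 (w z - K) \<partial>lborel) < e/2" "integrable lborel (\<lambda>z. max 0 (w z - K))"
      using density_truncation[OF wQ(1), of "e/2"] assms by auto
    show ?thesis
    proof (intro exI[of _ K] conjI K(1) allI impI)
      fix D and k :: "real \<times> real \<Rightarrow> real"
      assume [measurable]: "k \<in> borel_measurable borel" and "\<forall>z. 0 \<le> k z \<and> k z \<le> D"
      then have k: "0 \<le> k z" "k z \<le> D" for z by blast+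
      have D0: "0 \<le> D" using k by (meson order_trans)
      have int: "integrable lborel (\<lambda>z. indicator ({0..2} \<times> {0..2}) z * k z)"
      proof (rule Bochner_Integration.integrable_bound)
          show "integrable lborel (\<lambda>z. D * indicator ({0..2} \<times> {0..2} :: (real \<times> real) set) z)"
            using emeasure_box[of 2 2] by simp
          show "AE z in lborel. norm (indicator ({0..2} \<times> {0..2}) z * k z)
              \<le> norm (D * indicator ({0..2} \<times> {0..2}) z)"
            using k D0 by (auto split: split_indicator)
        qed measurable
      have "(\<integral>s. indicator (square \<inter> wedge i) s * k (power_sums s) \<partial>lborel) = (\<integral>z. w z * k z \<partial>lborel)"
        using wQ(5)[of "\<lambda>_. 1" k] by simp
      also have "\<dots> \<le> (\<integral>z. K * (indicator ({0..2} \<times> {0..2}) z * k z) + D * max 0 (w z - K) \<partial>lborel)"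
      proof (rule integral_mono)
        show "integrable lborel (\<lambda>z. w z * k z)"
        proof (rule Bochner_Integration.integrable_bound[where f="\<lambda>z. D * w z"])
          show "AE z in lborel. norm (w z * k z) \<le> norm (D * w z)"
            using k wQ(2) D0 by (intro AE_I2) (auto simp: abs_mult mult.commute[of D] intro!: mult_left_mono)
        qed (use wQ in auto)
        show "integrable lborel (\<lambda>z. K * (indicator ({0..2} \<times> {0..2}) z * k z) + D * max 0 (w z - K))"
          using K(3) int by simp
      next
        fix z
        show "w z * k z \<le> K * (indicator ({0..2} \<times> {0..2}) z * k z) + D * max 0 (w z - K)"
        proof (cases "w z = 0")
          case True then show ?thesis using K(1) k[of z] D0 by simp
        next
          case False
          have "w z * k z = K * k z + (w z - K) * k z" by (simp add: algebra_simps)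
          also have "(w z - K) * k z \<le> max 0 (w z - K) * k z" using k by (intro mult_right_mono) auto
          also have "\<dots> \<le> max 0 (w z - K) * D" using k by (intro mult_left_mono) auto
          finally show ?thesis using wQ(4)[OF False] by (simp add: mult.commute)
        qed
      qed
      also have "\<dots> = K * (\<integral>z. indicator ({0..2} \<times> {0..2}) z * k z \<partial>lborel) + D * (\<integral>z. max 0 (w z - K) \<partial>lborel)"
        using K(3) int by simp
      also have "\<dots> \<le> K * (\<integral>z. indicator ({0..2} \<times> {0..2}) z * k z \<partial>lborel) + D * (e/2)"
        using K(2) D0 by (intro add_left_mono mult_left_mono) auto
      finally show "(\<integral>s. indicator (square \<inter> wedge i) s * k (power_sums s) \<partial>lborel)
        \<le> K * (\<integral>z. indicator ({0..2} \<times> {0..2}) z * k z \<partial>lborel) + D * (e/2)" .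
    qed
  qed
  obtain K1 where K1: "0 \<le> K1" "\<forall>D k. k \<in> borel_measurable borel \<longrightarrow> (\<forall>z. 0 \<le> k z \<and> k z \<le> D) \<longrightarrow>
    (\<integral>s. indicator (square \<inter> wedge True) s * k (power_sums s) \<partial>lborel)
      \<le> K1 * (\<integral>z. indicator ({0..2} \<times> {0..2}) z * k z \<partial>lborel) + D * (e/2)"
    using piece[of True] by blast
  obtain K2 where K2: "0 \<le> K2" "\<forall>D k. k \<in> borel_measurable borel \<longrightarrow> (\<forall>z. 0 \<le> k z \<and> k z \<le> D) \<longrightarrow>
    (\<integral>s. indicator (square \<inter> wedge False) s * k (power_sums s) \<partial>lborel)
      \<le> K2 * (\<integral>z. indicator ({0..2} \<times> {0..2}) z * k z \<partial>lborel) + D * (e/2)"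
    using piece[of False] by blast
  show ?thesis
  proof (rule that[of "4 * (K1 + K2)"])
    show "0 \<le> 4 * (K1 + K2)" using K1(1) K2(1) by simp
    fix D :: real and k :: "real \<times> real \<Rightarrow> real"
    assume [measurable]: "k \<in> borel_measurable borel" and k: "\<And>z. 0 \<le> k z \<and> k z \<le> D"
    have "\<bar>k z\<bar> \<le> D" for z using k[of z] by simp
    then have "(\<integral>s. k (power_sums s) \<partial>unit_sq) = (\<integral>s. indicator (square \<inter> wedge True) s * k (power_sums s) \<partial>lborel)
        + (\<integral>s. indicator (square \<inter> wedge False) s * k (power_sums s) \<partial>lborel)"
      by (intro integral_unit_sq_wedges[where C=D]) auto
    also have "\<dots> \<le> (K1 + K2) * (\<integral>z. indicator ({0..2} \<times> {0..2}) z * k z \<partial>lborel) + D * e"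
      using K1(2)[rule_format, of k D] K2(2)[rule_format, of k D] k by (simp add: algebra_simps)
    also have "(\<integral>z. indicator ({0..2} \<times> {0..2}) z * k z \<partial>lborel) = 4 * (\<integral>s. k (2 *\<^sub>R s) \<partial>unit_sq)"
      using integral_unit_sq_scale[of k 2 2] by (simp add: scaleR_prod_def)
    finally show "(\<integral>s. k (power_sums s) \<partial>unit_sq) \<le> 4 * (K1 + K2) * (\<integral>s. k (2 *\<^sub>R s) \<partial>unit_sq) + D * e"
      by (simp add: algebra_simps)
  qed
qed

section \<open>Means over rectangles\<close>

lemma box_borel_half_open[measurable]: "{a..<b} \<times> {c..<d} \<in> sets (borel :: (real \<times> real) measure)"
  unfolding borel_prod[symmetric] by measurable

lemma integral_half_open_box:
  fixes H :: "real \<times> real \<Rightarrow> real"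
  assumes [measurable]: "H \<in> borel_measurable borel"
  shows "(\<integral>z. indicator ({a..b} \<times> {c..d}) z * H z \<partial>lborel) = (\<integral>z. indicator ({a..<b} \<times> {c..<d}) z * H z \<partial>lborel)"
proof (rule integral_cong_AE)
  show "AE z in lborel. indicator ({a..b} \<times> {c..d}) z * H z = indicator ({a..<b} \<times> {c..<d}) z * H z"
    using AE_ne_coordinate[of b d] by eventually_elim (auto split: split_indicator)
qed measurable

lemma integrable_box:
  fixes H :: "real \<times> real \<Rightarrow> real"
  assumes [measurable]: "H \<in> borel_measurable borel" "A \<in> sets borel" and bd: "\<And>z. \<bar>H z\<bar> \<le> C"
    and A: "emeasure lborel A < \<infinity>"
  shows "integrable lborel (\<lambda>z. indicator A z * H z)"
proof (rule Bochner_Integration.integrable_bound)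
  show "integrable lborel (\<lambda>z. C * indicator A z)" using A by simp
  have "0 \<le> C" using bd[of 0] by linarith
  then show "AE z in lborel. norm (indicator A z * H z) \<le> norm (C * indicator A z)"
    using bd by (intro AE_I2) (auto split: split_indicator)
qed measurable

lemma indicator_grid: "indicator {0..<real m} (t::real) = (\<Sum>j<m. indicator {real j..<real j + 1} t :: real)"
  by (induction m) (auto split: split_indicator)

text \<open>
  The mean of \<open>H\<close> over the rectangle \<open>[0,a] \<times> [0,b]\<close>, when \<open>a\<close> and \<open>b\<close> are positive.
\<close>
definition rect_mean :: "(real \<times> real \<Rightarrow> real) \<Rightarrow> real \<Rightarrow> real \<Rightarrow> real" where
  "rect_mean H a b = (\<integral>s. H (a * fst s, b * snd s) \<partial>unit_sq)"

lemma rect_mean_grid: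
  fixes H :: "real \<times> real \<Rightarrow> real"
  assumes [measurable]: "H \<in> borel_measurable borel" and bd: "\<And>z. \<bar>H z\<bar> \<le> C"
    and mn: "0 < m" "0 < n"
  shows "rect_mean H (real m) (real n) =
    (\<Sum>j<m. \<Sum>k<n. \<integral>s. H (s + (real j, real k)) \<partial>unit_sq) / (real m * real n)"
proof -
  let ?I = "\<lambda>j k. {real j..<real j + 1} \<times> {real k..<real k + 1}"
  have fin: "emeasure lborel (?I j k) < \<infinity>" for j k
    by (simp add: lborel_prod[symmetric] lborel.emeasure_pair_measure_Times ennreal_mult)
  have cint: "integrable lborel (\<lambda>z. indicator (?I j k) z * H z)" for j k
    by (rule integrable_box[OF assms(1) _ bd fin]) measurable
  have cell: "(\<integral>z. indicator (?I j k) z * H z \<partial>lborel) = (\<integral>s. H (s + (real j, real k)) \<partial>unit_sq)" for j k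
  proof -
    have "(\<integral>z. indicator (?I j k) z * H z \<partial>lborel) =
        (\<integral>s. indicator (?I j k) (s + (real j, real k)) * H (s + (real j, real k)) \<partial>lborel)"
      by (rule lborel_integral_translate[symmetric]) measurable
    also have "\<dots> = (\<integral>s. indicator ({0..<1} \<times> {0..<1}) s * H (s + (real j, real k)) \<partial>lborel)"
      by (intro Bochner_Integration.integral_cong refl) (auto split: split_indicator)
    also have "\<dots> = (\<integral>s. H (s + (real j, real k)) \<partial>unit_sq)"
      by (subst integral_half_open_box[symmetric], simp, subst integral_unit_sq) auto
    finally show ?thesis .
  qed
  have grid: "indicator ({0..<real m} \<times> {0..<real n}) z = (\<Sum>j<m. \<Sum>k<n. indicator (?I j k) z :: real)" for z
    by (cases z) (simp add: indicator_times indicator_grid sum_product)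
  have "real m * real n * rect_mean H (real m) (real n) = (\<integral>z. indicator ({0..real m} \<times> {0..real n}) z * H z \<partial>lborel)"
    unfolding rect_mean_def using mn by (intro integral_unit_sq_scale) auto
  also have "\<dots> = (\<integral>z. (\<Sum>j<m. \<Sum>k<n. indicator (?I j k) z * H z) \<partial>lborel)"
    by (simp add: integral_half_open_box grid sum_distrib_right)
  also have "\<dots> = (\<Sum>j<m. \<integral>z. (\<Sum>k<n. indicator (?I j k) z * H z) \<partial>lborel)"
    by (intro Bochner_Integration.integral_sum Bochner_Integration.integrable_sum cint)
  also have "\<dots> = (\<Sum>j<m. \<Sum>k<n. \<integral>z. indicator (?I j k) z * H z \<partial>lborel)"
    by (intro sum.cong refl Bochner_Integration.integral_sum cint)
  also have "\<dots> = (\<Sum>j<m. \<Sum>k<n. \<integral>s. H (s + (real j, real k)) \<partial>unit_sq)"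
    by (simp only: cell)
  finally show ?thesis using mn by (simp add: field_simps)
qed

lemma rect_mean_compare:
  fixes H :: "real \<times> real \<Rightarrow> real"
  assumes [measurable]: "H \<in> borel_measurable borel" and bd: "\<And>z. \<bar>H z\<bar> \<le> C"
    and ab: "0 < m" "m \<le> a" "0 < n" "n \<le> b"
  shows "\<bar>rect_mean H a b - (m / a) * (n / b) * rect_mean H m n\<bar> \<le> C * (1 - (m / a) * (n / b))"
proof -
  let ?A = "{0..a} \<times> {0..b}" and ?B = "{0..m} \<times> {0..n}"
  have fin: "emeasure lborel ?A < \<infinity>" "emeasure lborel ?B < \<infinity>"
    using ab by (auto simp: emeasure_box)
  note int = integrable_box[OF assms(1) _ bd fin(1)] integrable_box[OF assms(1) _ bd fin(2)]
  have eq: "a * b * rect_mean H a b = (\<integral>z. indicator ?A z * H z \<partial>lborel)"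
    "m * n * rect_mean H m n = (\<integral>z. indicator ?B z * H z \<partial>lborel)"
    unfolding rect_mean_def using ab by (auto intro!: integral_unit_sq_scale)
  have "\<bar>a * b * rect_mean H a b - m * n * rect_mean H m n\<bar>
      = \<bar>\<integral>z. indicator ?A z * H z - indicator ?B z * H z \<partial>lborel\<bar>"
    using int unfolding eq by simp
  also have "\<dots> \<le> (\<integral>z. C * (indicator ?A z - indicator ?B z) \<partial>lborel)"
  proof (rule Bochner_Integration.integral_abs_bound_integral)
    show "integrable lborel (\<lambda>z. indicator ?A z * H z - indicator ?B z * H z)" using int by simp
    show "integrable lborel (\<lambda>z. C * (indicator ?A z - indicator ?B z))" using fin by simp
    fix z show "\<bar>indicator ?A z * H z - indicator ?B z * H z\<bar> \<le> C * (indicator ?A z - indicator ?B z)"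
      using bd[of z] ab by (cases z) (auto split: split_indicator)
  qed
  also have "\<dots> = C * (a * b - m * n)"
    using fin ab by (simp add: measure_def emeasure_box)
  finally have "\<bar>a * b * rect_mean H a b - m * n * rect_mean H m n\<bar> \<le> C * (a * b - m * n)" .
  then have "\<bar>a * b * rect_mean H a b - m * n * rect_mean H m n\<bar> / (a * b) \<le> C * (a * b - m * n) / (a * b)"
    using ab by (intro divide_right_mono) auto
  moreover have "\<bar>a * b * rect_mean H a b - m * n * rect_mean H m n\<bar> / (a * b)
      = \<bar>rect_mean H a b - (m / a) * (n / b) * rect_mean H m n\<bar>"
  proof -
    have "\<bar>a * b * rect_mean H a b - m * n * rect_mean H m n\<bar> / (a * b)
      = \<bar>(a * b * rect_mean H a b - m * n * rect_mean H m n) / (a * b)\<bar>"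
      using ab by (simp add: abs_divide abs_mult)
    also have "(a * b * rect_mean H a b - m * n * rect_mean H m n) / (a * b) = rect_mean H a b - (m / a) * (n / b) * rect_mean H m n"
      using ab by (simp add: field_simps)
    finally show ?thesis .
  qed
  moreover have "C * (a * b - m * n) / (a * b) = C * (1 - (m / a) * (n / b))"
    using ab by (simp add: field_simps)
  ultimately show ?thesis by simp
qed

lemma floor_ratio_tendsto: "((\<lambda>a. real (nat \<lfloor>a\<rfloor>) / a) \<longlongrightarrow> 1) at_top"
proof -
  have "((\<lambda>a::real. real (nat \<lfloor>a\<rfloor>) / a - 1) \<longlongrightarrow> 0) at_top"
  proof (rule Lim_null_comparison[OF _ tendsto_inverse_0_at_top[OF filterlim_ident]])
    show "\<forall>\<^sub>F a::real in at_top. norm (real (nat \<lfloor>a\<rfloor>) / a - 1) \<le> inverse a"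
      using eventually_gt_at_top[of 0]
    proof eventually_elim
      case (elim a)
      have "norm (real (nat \<lfloor>a\<rfloor>) / a - 1) = \<bar>real_of_int \<lfloor>a\<rfloor> - a\<bar> / a"
        using elim by (simp add: field_simps abs_divide)
      also have "\<dots> \<le> 1 / a" using elim by (intro divide_right_mono) linarith+
      finally show ?case by (simp add: inverse_eq_divide)
    qed
  qed
  then show ?thesis by (rule LIM_zero_cancel)
qed

text \<open>
  Rounding the sides down changes the area by a factor that tends to \<open>1\<close>.
\<close>
lemma rect_mean_tendsto_real:
  fixes H :: "real \<times> real \<Rightarrow> real"
  assumes [measurable]: "H \<in> borel_measurable borel" and bd: "\<And>z. \<bar>H z\<bar> \<le> C"
    and lim: "((\<lambda>(m, n). rect_mean H (real m) (real n)) \<longlongrightarrow> L) (sequentially \<times>\<^sub>F sequentially)"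
  shows "((\<lambda>(a, b). rect_mean H a b) \<longlongrightarrow> L) (at_top \<times>\<^sub>F at_top)"
proof -
  let ?P = "at_top \<times>\<^sub>F at_top :: (real \<times> real) filter"
  let ?f = "\<lambda>a::real. nat \<lfloor>a\<rfloor>"
  have "filterlim ?f sequentially at_top"
    by (rule filterlim_compose[OF filterlim_nat_sequentially filterlim_floor_sequentially])
  then have "filterlim (\<lambda>p. (?f (fst p), ?f (snd p))) (sequentially \<times>\<^sub>F sequentially) ?P"
    by (intro filterlim_Pair; intro filterlim_compose[OF _ filterlim_fst] filterlim_compose[OF _ filterlim_snd])
  from filterlim_compose[OF lim this]
  have 1: "((\<lambda>p. rect_mean H (?f (fst p)) (?f (snd p))) \<longlongrightarrow> L) ?P" by simp
  have 2: "((\<lambda>p. (?f (fst p) / fst p) * (?f (snd p) / snd p)) \<longlongrightarrow> 1 * 1) ?P"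
    by (intro tendsto_mult filterlim_compose[OF floor_ratio_tendsto] filterlim_fst filterlim_snd)
  let ?r = "\<lambda>p. (?f (fst p) / fst p) * (?f (snd p) / snd p)"
  have "((\<lambda>p. C * (1 - ?r p)) \<longlongrightarrow> C * (1 - 1 * 1)) ?P" by (intro tendsto_intros 2)
  then have 3: "((\<lambda>p. C * (1 - ?r p)) \<longlongrightarrow> 0) ?P" by simp
  have ev: "\<forall>\<^sub>F p in ?P. 1 \<le> fst p \<and> 1 \<le> snd p"
    unfolding eventually_prod_filter
    by (intro exI[of _ "\<lambda>a. 1 \<le> a"]) (auto intro: eventually_ge_at_top)
  have "((\<lambda>p. rect_mean H (fst p) (snd p) - ?r p * rect_mean H (?f (fst p)) (?f (snd p))) \<longlongrightarrow> 0) ?P"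
  proof (rule Lim_null_comparison[OF _ 3])
    show "\<forall>\<^sub>F p in ?P. norm (rect_mean H (fst p) (snd p) - ?r p * rect_mean H (?f (fst p)) (?f (snd p))) \<le> C * (1 - ?r p)"
      using ev
    proof eventually_elim
      case (elim p)
      have "0 < \<lfloor>fst p\<rfloor>" "0 < \<lfloor>snd p\<rfloor>" using elim by linarith+
      then have "0 < real (?f (fst p))" "0 < real (?f (snd p))" "real (?f (fst p)) \<le> fst p" "real (?f (snd p)) \<le> snd p"
        by auto
      then show ?case using rect_mean_compare[OF assms(1) bd, of "?f (fst p)" "fst p" "?f (snd p)" "snd p"] by simp
    qed
  qed
  from tendsto_add[OF this tendsto_mult[OF 2 1]] show ?thesis by (simp add: case_prod_beta')
qed

lemma square_translation:
  fixes u :: "nat \<Rightarrow> real \<times> real"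
  assumes "u \<longlonglongrightarrow> 0"
  shows "(\<lambda>n. \<integral>z. \<bar>indicator square (z + u n) - indicator square z :: real\<bar> \<partial>lborel) \<longlonglongrightarrow> 0"
  using assms by (intro L1_translation_continuous) (use emeasure_box[of 1 1] in simp_all)

text \<open>
  Shifting the argument amounts to shifting the square, so only the symmetric difference of the two
  squares contributes. The bound is uniform in \<open>H\<close>; this gives both the invariance of orbit means and
  the uniform continuity of means over small squares.
\<close>
lemma unit_sq_shift_le:
  fixes H :: "real \<times> real \<Rightarrow> real"
  assumes [measurable]: "H \<in> borel_measurable borel" and bd: "\<And>z. \<bar>H z\<bar> \<le> C"
  shows "\<bar>(\<integral>s. H (s + h) \<partial>unit_sq) - (\<integral>s. H s \<partial>unit_sq)\<bar>
    \<le> C * (\<integral>z. \<bar>indicator square (z - h) - indicator square z :: real\<bar> \<partial>lborel)"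
proof -
  let ?i = "indicator square :: real \<times> real \<Rightarrow> real"
  have fin: "emeasure lborel square < \<infinity>" using emeasure_box[of 1 1] by simp
  have int: "integrable lborel ?i" "integrable lborel (\<lambda>z. ?i (z - h))"
    using fin lborel_integrable_translate[of ?i "- h"] by simp_all
  have i1: "integrable lborel (\<lambda>z. ?i z * H z)"
    by (rule integrable_box[OF assms(1) _ bd fin]) measurable
  have "integrable lborel (\<lambda>z. ?i z * H (z + h))"
    using bd by (intro integrable_box[OF _ _ _ fin, where C=C]) auto
  then have i2: "integrable lborel (\<lambda>z. ?i (z - h) * H z)"
    using lborel_integrable_translate[of "\<lambda>z. ?i (z - h) * H z" h] by simp
  have "(\<integral>s. H (s + h) \<partial>unit_sq) = (\<integral>s. ?i s * H (s + h) \<partial>lborel)" by (subst integral_unit_sq) auto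
  also have "\<dots> = (\<integral>z. ?i (z - h) * H z \<partial>lborel)"
    using lborel_integral_translate[of "\<lambda>z. ?i (z - h) * H z" h] by simp
  finally have "\<bar>(\<integral>s. H (s + h) \<partial>unit_sq) - (\<integral>s. H s \<partial>unit_sq)\<bar> = \<bar>\<integral>z. ?i (z - h) * H z - ?i z * H z \<partial>lborel\<bar>"
    using i1 i2 by (simp add: integral_unit_sq)
  also have "\<dots> \<le> (\<integral>z. C * \<bar>?i (z - h) - ?i z\<bar> \<partial>lborel)"
  proof (rule Bochner_Integration.integral_abs_bound_integral)
    fix z
    show "\<bar>?i (z - h) * H z - ?i z * H z\<bar> \<le> C * \<bar>?i (z - h) - ?i z\<bar>"
      unfolding left_diff_distrib[symmetric] abs_mult using bd[of z] by (subst mult.commute) (intro mult_right_mono, auto)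
  qed (use i1 i2 int in auto)
  finally show ?thesis by simp
qed

lemma unit_sq_shift_tendsto_0:
  fixes H :: "nat \<Rightarrow> real \<times> real \<Rightarrow> real" and h :: "nat \<Rightarrow> real \<times> real"
  assumes "\<And>n. H n \<in> borel_measurable borel" and "\<And>n z. \<bar>H n z\<bar> \<le> C" and h: "h \<longlonglongrightarrow> 0"
  shows "(\<lambda>n. (\<integral>s. H n (s + h n) \<partial>unit_sq) - (\<integral>s. H n s \<partial>unit_sq)) \<longlonglongrightarrow> 0"
proof (rule Lim_null_comparison)
  have "(\<lambda>n. - h n) \<longlonglongrightarrow> 0" using tendsto_minus[OF h] by simp
  from tendsto_mult_right_zero[OF square_translation[OF this], of C]
  show "(\<lambda>n. C * (\<integral>z. \<bar>indicator square (z - h n) - indicator square z :: real\<bar> \<partial>lborel)) \<longlonglongrightarrow> 0" by simp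
  show "\<forall>\<^sub>F n in sequentially. norm ((\<integral>s. H n (s + h n) \<partial>unit_sq) - (\<integral>s. H n s \<partial>unit_sq))
      \<le> C * (\<integral>z. \<bar>indicator square (z - h n) - indicator square z :: real\<bar> \<partial>lborel)"
    using unit_sq_shift_le[OF assms(1,2)] by simp
qed

lemma unit_sq_translation_continuous:
  fixes H :: "real \<times> real \<Rightarrow> real" and h :: "nat \<Rightarrow> real \<times> real"
  assumes [measurable]: "H \<in> borel_measurable borel" and bd: "\<And>z. \<bar>H z\<bar> \<le> C" and h: "h \<longlonglongrightarrow> 0"
  shows "(\<lambda>n. \<integral>s. \<bar>H (s + h n) - H s\<bar> \<partial>unit_sq) \<longlonglongrightarrow> 0"
proof -
  \<comment> \<open>A margin around the unit square that contains all translates by vectors of norm at most \<open>1\<close>.\<close>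
  let ?A = "{-1..2} \<times> {-1..2} :: (real \<times> real) set"
  let ?w = "\<lambda>z. indicator ?A z * H z"
  have fin: "emeasure lborel ?A < \<infinity>"
    by (simp add: lborel_prod[symmetric] lborel.emeasure_pair_measure_Times ennreal_mult)
  have w: "integrable lborel ?w" by (rule integrable_box[OF assms(1) _ bd fin]) measurable
  have wtr: "integrable lborel (\<lambda>z. ?w (z + a))" for a
    using w by (subst lborel_integrable_translate) auto
  have "\<forall>\<^sub>F n in sequentially. norm (h n) < 1"
    using tendsto_norm_zero[OF h] by (rule order_tendstoD) simp
  then have ev: "\<forall>\<^sub>F n in sequentially. norm (\<integral>s. \<bar>H (s + h n) - H s\<bar> \<partial>unit_sq)
      \<le> (\<integral>z. \<bar>?w (z + h n) - ?w z\<bar> \<partial>lborel)"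
  proof eventually_elim
    case (elim n)
    have hn: "\<bar>fst (h n)\<bar> \<le> 1" "\<bar>snd (h n)\<bar> \<le> 1"
      using elim norm_fst_le[of "fst (h n)" "snd (h n)"] norm_snd_le[of "snd (h n)" "fst (h n)"] by simp_all
    have "(\<integral>s. \<bar>H (s + h n) - H s\<bar> \<partial>unit_sq) = (\<integral>z. indicator square z * \<bar>H (z + h n) - H z\<bar> \<partial>lborel)"
      by (rule integral_unit_sq) measurable
    also have "\<dots> \<le> (\<integral>z. \<bar>?w (z + h n) - ?w z\<bar> \<partial>lborel)"
    proof (rule integral_mono)
      have "\<bar>\<bar>H (z + h n) - H z\<bar>\<bar> \<le> 2 * C" for z using bd[of z] bd[of "z + h n"] by linarith
      then show "integrable lborel (\<lambda>z. indicator square z * \<bar>H (z + h n) - H z\<bar>)"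
        using emeasure_box[of 1 1] by (intro integrable_box[where C="2*C"]) auto
      show "integrable lborel (\<lambda>z. \<bar>?w (z + h n) - ?w z\<bar>)" using w wtr by simp
      fix z
      have "z \<in> ?A \<and> z + h n \<in> ?A" if "z \<in> square" using that hn by (cases z; cases "h n") auto
      then show "indicator square z * \<bar>H (z + h n) - H z\<bar> \<le> \<bar>?w (z + h n) - ?w z\<bar>"
        by (cases "z \<in> square") auto
    qed
    finally show ?case by (simp add: integral_nonneg_AE)
  qed
  show ?thesis
    by (rule Lim_null_comparison[OF ev L1_translation_continuous[OF w h]])
qed

section \<open>Measurable actions of the plane\<close>

lemma (in prob_space) fubini_bounded:
  fixes k :: "'a \<Rightarrow> 'b \<Rightarrow> real"
  assumes N: "prob_space N" and [measurable]: "(\<lambda>(x, y). k x y) \<in> borel_measurable (M \<Otimes>\<^sub>M N)"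
    and bd: "\<And>x y. \<bar>k x y\<bar> \<le> C"
  shows "(\<integral>x. (\<integral>y. k x y \<partial>N) \<partial>M) = (\<integral>y. (\<integral>x. k x y \<partial>M) \<partial>N)"
proof -
  interpret N: prob_space N by fact
  interpret pair_prob_space M N ..
  have "integrable (M \<Otimes>\<^sub>M N) (\<lambda>(x, y). k x y)"
    using bd by (intro integrable_bounded[where C=C]) auto
  from Fubini_integral[OF this] show ?thesis by simp
qed

text \<open>
  A jointly measurable, measure-preserving action of the plane; two commuting flows combine to one.
\<close>
locale plane_action = prob_space M for M :: "'a measure" +
  fixes U :: "real \<times> real \<Rightarrow> 'a \<Rightarrow> 'a"
  assumes U_joint[measurable]: "(\<lambda>(x, t). U t x) \<in> measurable (M \<Otimes>\<^sub>M borel) M"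
    and U_zero: "x \<in> space M \<Longrightarrow> U 0 x = x"
    and U_add: "x \<in> space M \<Longrightarrow> U (s + t) x = U s (U t x)"
    and U_distr: "distr M M (U t) = M"
begin

lemma U_orbit_meas: "x \<in> space M \<Longrightarrow> (\<lambda>t. U t x) \<in> measurable borel M"
  using measurable_Pair2[OF U_joint, of x] by simp

lemma U_meas[measurable]: "U t \<in> measurable M M"
  using measurable_Pair1[OF U_joint, of t] by simp

lemma U_space: "x \<in> space M \<Longrightarrow> U t x \<in> space M"
  using U_meas by (rule measurable_space)

lemma orbit_fun_meas:
  assumes "f \<in> borel_measurable M" "x \<in> space M"
  shows "(\<lambda>t. f (U t x)) \<in> borel_measurable borel"
  using measurable_compose[OF U_orbit_meas[OF assms(2)] assms(1)] .

lemma joint_fun_meas[measurable (raw)]: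
  assumes [measurable]: "f \<in> borel_measurable M" "\<phi> \<in> borel_measurable (M \<Otimes>\<^sub>M borel)"
  shows "(\<lambda>p. f (U (\<phi> p) (fst p))) \<in> borel_measurable (M \<Otimes>\<^sub>M borel)"
proof -
  have "(\<lambda>p. (\<lambda>(x, t). U t x) (fst p, \<phi> p)) \<in> measurable (M \<Otimes>\<^sub>M borel) M" by measurable
  from measurable_compose[OF this assms(1)] show ?thesis by simp
qed

lemma sets_pair_unit_sq[measurable_cong]: "sets (M \<Otimes>\<^sub>M unit_sq) = sets (M \<Otimes>\<^sub>M borel)"
  by (intro sets_pair_measure_cong) auto

lemma joint_avg_meas:
  assumes [measurable]: "f \<in> borel_measurable M" "\<phi> \<in> borel_measurable borel"
  shows "(\<lambda>(x, s). f (U (\<phi> s) x)) \<in> borel_measurable (M \<Otimes>\<^sub>M unit_sq)"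
proof -
  have "(\<lambda>p. f (U (\<phi> (snd p)) (fst p))) \<in> borel_measurable (M \<Otimes>\<^sub>M borel)" by measurable
  then show ?thesis by (simp add: case_prod_beta' measurable_cong_sets[OF sets_pair_unit_sq refl])
qed

lemma integral_U:
  fixes f :: "'a \<Rightarrow> real"
  assumes "f \<in> borel_measurable M"
  shows "(\<integral>x. f (U t x) \<partial>M) = (\<integral>x. f x \<partial>M)"
  using integral_distr[OF U_meas assms] by (simp add: U_distr)

lemma avg_meas:
  fixes f :: "'a \<Rightarrow> real"
  assumes [measurable]: "f \<in> borel_measurable M" "\<phi> \<in> borel_measurable borel"
  shows "(\<lambda>x. \<integral>s. f (U (\<phi> s) x) \<partial>unit_sq) \<in> borel_measurable M"
  using unit_sq.borel_measurable_lebesgue_integral[OF joint_avg_meas[OF assms]] by simp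

lemma integral_avg:
  fixes f :: "'a \<Rightarrow> real"
  assumes [measurable]: "f \<in> borel_measurable M" "\<phi> \<in> borel_measurable borel"
    and bd: "\<And>x. \<bar>f x\<bar> \<le> C"
  shows "(\<integral>x. (\<integral>s. f (U (\<phi> s) x) \<partial>unit_sq) \<partial>M) = (\<integral>x. f x \<partial>M)"
proof -
  have "(\<integral>x. (\<integral>s. f (U (\<phi> s) x) \<partial>unit_sq) \<partial>M) = (\<integral>s. (\<integral>x. f (U (\<phi> s) x) \<partial>M) \<partial>unit_sq)"
    by (rule fubini_bounded[OF unit_sq.prob_space_axioms joint_avg_meas]) (use bd in auto)
  then show ?thesis by (simp add: integral_U)
qed

abbreviation rect :: "('a \<Rightarrow> real) \<Rightarrow> real \<Rightarrow> real \<Rightarrow> 'a \<Rightarrow> real" where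
  "rect f a b x \<equiv> rect_mean (\<lambda>t. f (U t x)) a b"

lemma scale_borel[measurable]: "(\<lambda>s. (a * fst s, b * snd s)) \<in> borel_measurable (borel :: (real \<times> real) measure)"
  by (intro borel_measurable_continuous_onI continuous_intros)

lemma rect_meas[measurable]:
  "f \<in> borel_measurable M \<Longrightarrow> rect f a b \<in> borel_measurable M"
  unfolding rect_mean_def by (intro avg_meas scale_borel)

lemma rect_bound: "(\<And>x. \<bar>f x\<bar> \<le> C) \<Longrightarrow> \<bar>rect f a b x\<bar> \<le> C"
  unfolding rect_mean_def
  by (rule unit_sq.integral_abs_bound_const) (use abs_ge_zero order_trans in blast)+

lemma integral_rect:
  "f \<in> borel_measurable M \<Longrightarrow> (\<And>x. \<bar>f x\<bar> \<le> C) \<Longrightarrow> (\<integral>x. rect f a b x \<partial>M) = (\<integral>x. f x \<partial>M)"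
  unfolding rect_mean_def by (rule integral_avg) auto

lemma U_iter: "x \<in> space M \<Longrightarrow> (U t ^^ n) x = U (real n *\<^sub>R t) x"
proof (induction n)
  case (Suc n)
  have "(U t ^^ Suc n) x = U t (U (real n *\<^sub>R t) x)" using Suc by simp
  also have "\<dots> = U (t + real n *\<^sub>R t) x" using Suc by (simp add: U_add)
  finally show ?case by (simp add: algebra_simps)
qed (simp add: U_zero)

text \<open>
  The mean over \<open>[0,m] \<times> [0,n]\<close> with integer sides is the ergodic average, for the two unit translations,
  of the mean over the unit square.
\<close>
lemma rect_limit:
  assumes f[measurable]: "f \<in> borel_measurable M" and bd: "\<And>x. \<bar>f x\<bar> \<le> C"
  obtains L where "L \<in> borel_measurable M" "(\<integral>x. L x \<partial>M) = (\<integral>x. f x \<partial>M)"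
    "AE x in M. ((\<lambda>(a, b). rect f a b x) \<longlongrightarrow> L x) (at_top \<times>\<^sub>F at_top)"
proof -
  have mp: "measure_preserving M (U t)" for t
    by unfold_locales (auto simp: U_distr)
  let ?F = "rect f 1 1"
  obtain L where L: "L \<in> borel_measurable M" "(\<integral>x. L x \<partial>M) = (\<integral>x. ?F x \<partial>M)"
    "AE x in M. ((\<lambda>(m, n). (\<Sum>j<m. \<Sum>k<n. ?F ((U (0, 1) ^^ k) ((U (1, 0) ^^ j) x))) / (real m * real n))
        \<longlongrightarrow> L x) (sequentially \<times>\<^sub>F sequentially)"
    using two_parameter_birkhoff[OF mp[of "(1,0)"] mp[of "(0,1)"], of ?F C] rect_bound[where f=f and C=C, OF bd] rect_meas[OF f] by blast
  show ?thesis
  proof (rule that[OF L(1)])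
    show "(\<integral>x. L x \<partial>M) = (\<integral>x. f x \<partial>M)" using L(2) integral_rect[OF f bd] by simp
    show "AE x in M. ((\<lambda>(a, b). rect f a b x) \<longlongrightarrow> L x) (at_top \<times>\<^sub>F at_top)"
      using L(3)
    proof (rule AE_mp, intro AE_I2 impI)
      fix x assume x: "x \<in> space M"
        and lim: "((\<lambda>(m, n). (\<Sum>j<m. \<Sum>k<n. ?F ((U (0, 1) ^^ k) ((U (1, 0) ^^ j) x))) / (real m * real n))
        \<longlongrightarrow> L x) (sequentially \<times>\<^sub>F sequentially)"
      let ?H = "\<lambda>t. f (U t x)"
      have H: "?H \<in> borel_measurable borel" by (rule orbit_fun_meas[OF f x])
      have F: "?F ((U (0, 1) ^^ k) ((U (1, 0) ^^ j) x)) = (\<integral>s. ?H (s + (real j, real k)) \<partial>unit_sq)" for j k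
      proof -
        have "(U (0, 1) ^^ k) ((U (1, 0) ^^ j) x) = U (real j, real k) x"
          using x U_space[OF x] by (simp add: U_iter U_add[symmetric])
        then show ?thesis using U_space[OF x] by (simp add: rect_mean_def U_add[OF x])
      qed
      have "\<forall>\<^sub>F p in sequentially \<times>\<^sub>F sequentially. 0 < fst p \<and> 0 < snd p"
        unfolding eventually_prod_filter
        by (intro exI[of _ "\<lambda>n. 0 < n"]) (auto intro: eventually_gt_at_top)
      then have "\<forall>\<^sub>F p in sequentially \<times>\<^sub>F sequentially.
        (\<lambda>(m, n). (\<Sum>j<m. \<Sum>k<n. ?F ((U (0, 1) ^^ k) ((U (1, 0) ^^ j) x))) / (real m * real n)) p
        = (\<lambda>(m, n). rect_mean ?H (real m) (real n)) p"
        by eventually_elim (simp add: case_prod_beta F rect_mean_grid[OF H bd])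
      from lim[unfolded tendsto_cong[OF this]]
      show "((\<lambda>(a, b). rect f a b x) \<longlongrightarrow> L x) (at_top \<times>\<^sub>F at_top)"
        by (rule rect_mean_tendsto_real[OF H bd])
    qed
  qed
qed

text \<open>
  The limit of the means over \<open>[0,n]\<^sup>2\<close>. The value \<open>0\<close> where this limit does not exist makes the function
  bounded and invariant at every point of the space rather than almost everywhere.
\<close>
definition orbit_mean :: "('a \<Rightarrow> real) \<Rightarrow> 'a \<Rightarrow> real" where
  "orbit_mean f x =
    (if x \<in> space M \<and> convergent (\<lambda>n. rect f (real n) (real n) x) then lim (\<lambda>n. rect f (real n) (real n) x) else 0)"

lemma orbit_mean_meas[measurable]:
  assumes [measurable]: "f \<in> borel_measurable M"
  shows "orbit_mean f \<in> borel_measurable M"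
proof -
  have [measurable]: "Measurable.pred M (\<lambda>x. convergent (\<lambda>n. rect f (real n) (real n) x))"
    unfolding Cauchy_convergent_iff[symmetric] by measurable
  show ?thesis unfolding orbit_mean_def[abs_def] by measurable
qed

lemma orbit_mean_eq:
  assumes "x \<in> space M" "(\<lambda>n. rect f (real n) (real n) x) \<longlonglongrightarrow> L"
  shows "orbit_mean f x = L"
  using assms by (auto simp: orbit_mean_def convergent_def dest: limI)

lemma orbit_mean_bound:
  assumes "\<And>x. \<bar>f x\<bar> \<le> C"
  shows "\<bar>orbit_mean f x\<bar> \<le> C"
proof (cases "x \<in> space M \<and> convergent (\<lambda>n. rect f (real n) (real n) x)")
  case True
  then obtain L where L: "(\<lambda>n. rect f (real n) (real n) x) \<longlonglongrightarrow> L" by (auto simp: convergent_def)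
  have "\<bar>L\<bar> \<le> C"
    by (rule tendsto_upperbound[OF tendsto_rabs[OF L]]) (use rect_bound[where f=f and C=C, OF assms] in auto)
  then show ?thesis using orbit_mean_eq[OF _ L] True by simp
next
  case False
  then show ?thesis using assms[of x] unfolding orbit_mean_def by (auto intro: order_trans[OF abs_ge_zero])
qed

lemma orbit_mean_nonneg:
  assumes "\<And>x. 0 \<le> f x"
  shows "0 \<le> orbit_mean f x"
proof (cases "x \<in> space M \<and> convergent (\<lambda>n. rect f (real n) (real n) x)")
  case True
  then obtain L where L: "(\<lambda>n. rect f (real n) (real n) x) \<longlonglongrightarrow> L" by (auto simp: convergent_def)
  have "0 \<le> L"
    by (rule tendsto_lowerbound[OF L]) (use assms in \<open>auto simp: rect_mean_def\<close>)
  then show ?thesis using orbit_mean_eq[OF _ L] True by simp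
qed (auto simp: orbit_mean_def)

lemma orbit_mean_invariant:
  assumes f: "f \<in> borel_measurable M" and bd: "\<And>x. \<bar>f x\<bar> \<le> C" and x: "x \<in> space M"
  shows "orbit_mean f (U v x) = orbit_mean f x"
proof -
  let ?a = "\<lambda>n::nat. rect f (real n) (real n) (U v x)" and ?b = "\<lambda>n::nat. rect f (real n) (real n) x"
  let ?H = "\<lambda>n t. f (U (real n *\<^sub>R t) x)"
  have "(\<lambda>n. inverse (real n) *\<^sub>R v) \<longlonglongrightarrow> 0 *\<^sub>R v" by (intro tendsto_intros lim_inverse_n)
  then have h: "(\<lambda>n. inverse (real n) *\<^sub>R v) \<longlonglongrightarrow> 0" by simp
  have Hm: "?H n \<in> borel_measurable borel" for n
    using orbit_fun_meas[OF f x] by (rule measurable_compose[rotated]) measurable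
  have "\<forall>\<^sub>F n in sequentially. (\<integral>s. ?H n (s + inverse (real n) *\<^sub>R v) \<partial>unit_sq) - (\<integral>s. ?H n s \<partial>unit_sq) = ?a n - ?b n"
    using eventually_gt_at_top[of 0]
  proof eventually_elim
    case (elim n)
    have "?H n (s + inverse (real n) *\<^sub>R v) = f (U (real n * fst s, real n * snd s) (U v x))" for s
      using elim x by (simp add: U_add[symmetric] scaleR_prod_def plus_prod_def distrib_left mult.assoc[symmetric])
    moreover have "?H n s = f (U (real n * fst s, real n * snd s) x)" for s by (simp add: scaleR_prod_def)
    ultimately show ?case by (simp add: rect_mean_def)
  qed
  from iffD1[OF tendsto_cong[OF this] unit_sq_shift_tendsto_0[OF Hm bd h]]
  have d: "(\<lambda>n. ?a n - ?b n) \<longlonglongrightarrow> 0" .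
  have ab: "?a \<longlonglongrightarrow> L \<longleftrightarrow> ?b \<longlonglongrightarrow> L" for L
    using tendsto_add[OF d, of ?b L] tendsto_diff[OF _ d, of ?a L] by auto
  then have "convergent ?a \<longleftrightarrow> convergent ?b" "lim ?a = lim ?b"
    unfolding convergent_def lim_def by auto
  then show ?thesis using x U_space[OF x] by (simp add: orbit_mean_def)
qed

lemma orbit_mean_AE:
  assumes f[measurable]: "f \<in> borel_measurable M" and bd: "\<And>x. \<bar>f x\<bar> \<le> C"
  shows "AE x in M. ((\<lambda>(a, b). rect f a b x) \<longlongrightarrow> orbit_mean f x) (at_top \<times>\<^sub>F at_top)"
    and "(\<integral>x. orbit_mean f x \<partial>M) = (\<integral>x. f x \<partial>M)"
proof -
  obtain L where L: "L \<in> borel_measurable M" "(\<integral>x. L x \<partial>M) = (\<integral>x. f x \<partial>M)"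
    "AE x in M. ((\<lambda>(a, b). rect f a b x) \<longlongrightarrow> L x) (at_top \<times>\<^sub>F at_top)"
    using rect_limit[OF f bd] by blast
  have AE: "AE x in M. ((\<lambda>(a, b). rect f a b x) \<longlongrightarrow> L x) (at_top \<times>\<^sub>F at_top) \<and> orbit_mean f x = L x"
    using L(3)
  proof (rule AE_mp, intro AE_I2 impI conjI)
    fix x assume x: "x \<in> space M" and l: "((\<lambda>(a, b). rect f a b x) \<longlongrightarrow> L x) (at_top \<times>\<^sub>F at_top)"
    have "filterlim (\<lambda>n::nat. (real n, real n)) (at_top \<times>\<^sub>F at_top) sequentially"
      by (intro filterlim_Pair filterlim_real_sequentially)
    from filterlim_compose[OF l this] show "orbit_mean f x = L x" by (intro orbit_mean_eq[OF x]) simp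
  qed
  then show "AE x in M. ((\<lambda>(a, b). rect f a b x) \<longlongrightarrow> orbit_mean f x) (at_top \<times>\<^sub>F at_top)"
    by eventually_elim simp
  have "(\<integral>x. orbit_mean f x \<partial>M) = (\<integral>x. L x \<partial>M)"
    using AE L(1) by (intro integral_cong_AE) auto
  then show "(\<integral>x. orbit_mean f x \<partial>M) = (\<integral>x. f x \<partial>M)" using L by simp
qed

section \<open>Bilinear averages along an action\<close>

text \<open>
  The double average over \<open>[0,N]\<^sup>2\<close>, rescaled to the unit square.
\<close>
definition bilin :: "real \<Rightarrow> ('a \<Rightarrow> real) \<Rightarrow> ('a \<Rightarrow> real) \<Rightarrow> 'a \<Rightarrow> real" where
  "bilin N f g x = (\<integral>s. f (U (N *\<^sub>R s) x) * g (U (dil N (power_sums s)) x) \<partial>unit_sq)"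

lemma bilin_orbit_meas:
  assumes "f \<in> borel_measurable M" "g \<in> borel_measurable M" "x \<in> space M"
  shows "(\<lambda>s. f (U (N *\<^sub>R s) x)) \<in> borel_measurable borel"
    "(\<lambda>s. g (U (dil N (power_sums s)) x)) \<in> borel_measurable borel"
proof -
  show "(\<lambda>s. f (U (N *\<^sub>R s) x)) \<in> borel_measurable borel"
    by (rule measurable_compose[OF _ orbit_fun_meas[OF assms(1,3)]]) measurable
  show "(\<lambda>s. g (U (dil N (power_sums s)) x)) \<in> borel_measurable borel"
    by (rule measurable_compose[OF _ orbit_fun_meas[OF assms(2,3)]]) measurable
qed

lemma bilin_integrable:
  fixes f g :: "'a \<Rightarrow> real"
  assumes "f \<in> borel_measurable M" "g \<in> borel_measurable M" "x \<in> space M"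
    and "\<And>x. \<bar>f x\<bar> \<le> C" "\<And>x. \<bar>g x\<bar> \<le> D"
  shows "integrable unit_sq (\<lambda>s. f (U (N *\<^sub>R s) x) * g (U (dil N (power_sums s)) x))"
proof (rule unit_sq.integrable_bounded[where C="C * D"])
  have "0 \<le> C" using assms(4)[of x] by linarith
  then show "\<bar>f (U (N *\<^sub>R s) x) * g (U (dil N (power_sums s)) x)\<bar> \<le> C * D" for s
    unfolding abs_mult using assms(4,5) by (intro mult_mono) auto
  note [measurable] = bilin_orbit_meas[OF assms(1-3), of N]
  show "(\<lambda>s. f (U (N *\<^sub>R s) x) * g (U (dil N (power_sums s)) x)) \<in> borel_measurable unit_sq"
    by simp
qed

lemma bilin_diff_left:
  fixes f f' g :: "'a \<Rightarrow> real"
  assumes f: "f \<in> borel_measurable M" "\<And>x. \<bar>f x\<bar> \<le> C" and f': "f' \<in> borel_measurable M" "\<And>x. \<bar>f' x\<bar> \<le> C'"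
    and g: "g \<in> borel_measurable M" "\<And>x. \<bar>g x\<bar> \<le> D" and x: "x \<in> space M"
  shows "bilin N f g x - bilin N f' g x = bilin N (\<lambda>y. f y - f' y) g x"
  using bilin_integrable[where f=f and C=C and D=D, OF f(1) g(1) x f(2) g(2), of N]
    bilin_integrable[where f=f' and C=C' and D=D, OF f'(1) g(1) x f'(2) g(2), of N]
  by (simp add: bilin_def left_diff_distrib)

lemma bilin_diff_right:
  fixes f g g' :: "'a \<Rightarrow> real"
  assumes f: "f \<in> borel_measurable M" "\<And>x. \<bar>f x\<bar> \<le> C" and g: "g \<in> borel_measurable M" "\<And>x. \<bar>g x\<bar> \<le> D"
    and g': "g' \<in> borel_measurable M" "\<And>x. \<bar>g' x\<bar> \<le> D'" and x: "x \<in> space M"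
  shows "bilin N f g x - bilin N f g' x = bilin N f (\<lambda>y. g y - g' y) x"
  using bilin_integrable[where f=f and g=g and C=C and D=D, OF f(1) g(1) x f(2) g(2), of N]
    bilin_integrable[where f=f and g=g' and C=C and D=D', OF f(1) g'(1) x f(2) g'(2), of N]
  by (simp add: bilin_def right_diff_distrib)

lemma bilin_le_left:
  fixes f g :: "'a \<Rightarrow> real"
  assumes f: "f \<in> borel_measurable M" "\<And>x. \<bar>f x\<bar> \<le> C" and g: "g \<in> borel_measurable M" "\<And>x. \<bar>g x\<bar> \<le> D"
    and x: "x \<in> space M"
  shows "\<bar>bilin N f g x\<bar> \<le> D * rect (\<lambda>y. \<bar>f y\<bar>) N N x"
proof -
  note [measurable] = bilin_orbit_meas[OF f(1) g(1) x, of N]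
  have int: "integrable unit_sq (\<lambda>s. \<bar>f (U (N *\<^sub>R s) x)\<bar>)"
    using f(2) by (intro unit_sq.integrable_bounded[where C=C]) auto
  have "\<bar>bilin N f g x\<bar> \<le> (\<integral>s. D * \<bar>f (U (N *\<^sub>R s) x)\<bar> \<partial>unit_sq)"
    unfolding bilin_def
  proof (rule Bochner_Integration.integral_abs_bound_integral)
    show "integrable unit_sq (\<lambda>s. f (U (N *\<^sub>R s) x) * g (U (dil N (power_sums s)) x))"
      by (rule bilin_integrable[where f=f and C=C and g=g and D=D, OF f(1) g(1) x f(2) g(2)])
    show "integrable unit_sq (\<lambda>s. D * \<bar>f (U (N *\<^sub>R s) x)\<bar>)" using int by simp
    fix s show "\<bar>f (U (N *\<^sub>R s) x) * g (U (dil N (power_sums s)) x)\<bar> \<le> D * \<bar>f (U (N *\<^sub>R s) x)\<bar>"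
      unfolding abs_mult using g(2) by (subst mult.commute) (intro mult_right_mono, auto)
  qed
  also have "\<dots> = D * rect (\<lambda>y. \<bar>f y\<bar>) N N x"
    by (simp add: rect_mean_def scaleR_prod_def)
  finally show ?thesis .
qed

lemma bilin_le_right:
  fixes f g :: "'a \<Rightarrow> real"
  assumes K: "\<And>D k. k \<in> borel_measurable borel \<Longrightarrow> (\<And>z. 0 \<le> k z \<and> k z \<le> D) \<Longrightarrow>
    (\<integral>s. k (power_sums s) \<partial>unit_sq) \<le> K * (\<integral>s. k (2 *\<^sub>R s) \<partial>unit_sq) + D * e"
    and f: "f \<in> borel_measurable M" "\<And>x. \<bar>f x\<bar> \<le> C" and g: "g \<in> borel_measurable M" "\<And>x. \<bar>g x\<bar> \<le> D"
    and x: "x \<in> space M"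
  shows "\<bar>bilin N f g x\<bar> \<le> C * (K * rect (\<lambda>y. \<bar>g y\<bar>) (2 * N ^ 2) (2 * N ^ 3) x + D * e)"
proof -
  note [measurable] = bilin_orbit_meas[OF f(1) g(1) x, of N]
  have C0: "0 \<le> C" using f(2)[of x] by linarith
  let ?k = "\<lambda>z. \<bar>g (U (dil N z) x)\<bar>"
  have km: "?k \<in> borel_measurable borel"
    by (rule borel_measurable_abs, rule measurable_compose[OF _ orbit_fun_meas[OF g(1) x]]) measurable
  have int: "integrable unit_sq (\<lambda>s. ?k (power_sums s))"
    using g(2) by (intro unit_sq.integrable_bounded[where C=D]) auto
  have "\<bar>bilin N f g x\<bar> \<le> (\<integral>s. C * ?k (power_sums s) \<partial>unit_sq)"
    unfolding bilin_def
  proof (rule Bochner_Integration.integral_abs_bound_integral)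
    show "integrable unit_sq (\<lambda>s. f (U (N *\<^sub>R s) x) * g (U (dil N (power_sums s)) x))"
      by (rule bilin_integrable[where f=f and C=C and g=g and D=D, OF f(1) g(1) x f(2) g(2)])
    show "integrable unit_sq (\<lambda>s. C * ?k (power_sums s))" using int by simp
    fix s show "\<bar>f (U (N *\<^sub>R s) x) * g (U (dil N (power_sums s)) x)\<bar> \<le> C * ?k (power_sums s)"
      unfolding abs_mult using f(2) by (intro mult_right_mono) auto
  qed
  also have "\<dots> = C * (\<integral>s. ?k (power_sums s) \<partial>unit_sq)" by simp
  also have "\<dots> \<le> C * (K * (\<integral>s. ?k (2 *\<^sub>R s) \<partial>unit_sq) + D * e)"
    using K[OF km, of D] g(2) C0 by (intro mult_left_mono) auto
  also have "(\<integral>s. ?k (2 *\<^sub>R s) \<partial>unit_sq) = rect (\<lambda>y. \<bar>g y\<bar>) (2 * N ^ 2) (2 * N ^ 3) x"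
    by (simp add: rect_mean_def dil_def mult_ac)
  finally show ?thesis .
qed

text \<open>
  By Fubini, the difference is the average over \<open>v\<close> of the effects of replacing \<open>g\<close> by its translate by \<open>S v\<close>,
  each of which tends to \<open>0\<close>.
\<close>
lemma bilin_replace_by_square_mean:
  fixes f g :: "'a \<Rightarrow> real"
  assumes f: "f \<in> borel_measurable M" "\<And>x. \<bar>f x\<bar> \<le> C" and g: "g \<in> borel_measurable M" "\<And>x. \<bar>g x\<bar> \<le> D"
    and x: "x \<in> space M" and uc: "uniformly_continuous_on UNIV (\<lambda>t. f (U t x))"
  shows "((\<lambda>N. bilin N f g x - bilin N f (rect g S S) x) \<longlongrightarrow> 0) at_top"
proof (rule tendsto_at_topI_sequentially)
  fix X :: "nat \<Rightarrow> real" assume X: "filterlim X at_top sequentially"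
  let ?F = "\<lambda>t. f (U t x)" and ?G = "\<lambda>t. g (U t x)"
  let ?p = "\<lambda>n s. dil (X n) (power_sums s)"
  have F[measurable]: "?F \<in> borel_measurable borel" and G[measurable]: "?G \<in> borel_measurable borel"
    using orbit_fun_meas f g x by auto
  have C0: "0 \<le> C" using f(2)[of x] by linarith
  let ?k = "\<lambda>n v s. ?F (X n *\<^sub>R s) * (?G (?p n s) - ?G (?p n s + S *\<^sub>R v))"
  have kb: "\<bar>?k n v s\<bar> \<le> C * (2 * D)" for n v s
    unfolding abs_mult using f(2) C0 g(2)[of "U (?p n s) x"] g(2)[of "U (?p n s + S *\<^sub>R v) x"]
    by (intro mult_mono) auto
  have kpre: "(\<lambda>(v, s). ?k n v s) \<in> borel_measurable (borel \<Otimes>\<^sub>M borel)" for n by measurable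
  have sets_eq: "sets (unit_sq \<Otimes>\<^sub>M unit_sq) = sets (borel \<Otimes>\<^sub>M borel)"
    by (intro sets_pair_measure_cong) auto
  have km: "(\<lambda>(v, s). ?k n v s) \<in> borel_measurable (unit_sq \<Otimes>\<^sub>M unit_sq)" for n
    using kpre by (simp add: measurable_cong_sets[OF sets_eq refl])
  have mean: "rect g S S (U p x) = (\<integral>v. ?G (p + S *\<^sub>R v) \<partial>unit_sq)" for p
    using x by (simp add: rect_mean_def U_add[symmetric] scaleR_prod_def add.commute)
  have inner: "(\<integral>v. ?k n v s \<partial>unit_sq) = ?F (X n *\<^sub>R s) * (?G (?p n s) - rect g S S (U (?p n s) x))" for n s
  proof -
    have "integrable unit_sq (\<lambda>v. ?G (?p n s + S *\<^sub>R v))"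
      using g(2) by (intro unit_sq.integrable_bounded[where C=D]) auto
    then show ?thesis by (simp add: mean)
  qed
  have eq: "(\<integral>v. (\<integral>s. ?k n v s \<partial>unit_sq) \<partial>unit_sq) = bilin (X n) f g x - bilin (X n) f (rect g S S) x" for n
  proof -
    have "(\<integral>v. (\<integral>s. ?k n v s \<partial>unit_sq) \<partial>unit_sq) = (\<integral>s. (\<integral>v. ?k n v s \<partial>unit_sq) \<partial>unit_sq)"
      by (rule unit_sq.fubini_bounded[OF unit_sq.prob_space_axioms km kb])
    also have "\<dots> = bilin (X n) f (\<lambda>y. g y - rect g S S y) x"
      by (simp only: inner bilin_def)
    also have "\<dots> = bilin (X n) f g x - bilin (X n) f (rect g S S) x"
      by (rule bilin_diff_right[where f=f and C=C and g=g and D=D and D'=D, OF f g _ _ x, symmetric]) (use g rect_meas[OF g(1)] rect_bound[where f=g and C=D, OF g(2)] in auto)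
    finally show ?thesis .
  qed
  have "(\<lambda>n. \<integral>v. (\<integral>s. ?k n v s \<partial>unit_sq) \<partial>unit_sq) \<longlonglongrightarrow> (\<integral>v. 0 \<partial>unit_sq)"
  proof (rule integral_dominated_convergence[where w="\<lambda>_. C * (2 * D)"])
    show "AE v in unit_sq. (\<lambda>n. \<integral>s. ?k n v s \<partial>unit_sq) \<longlonglongrightarrow> 0"
      by (intro AE_I2 shift_average_tendsto_0[OF F _ uc G _ X, where C=C and D=D]) (use f g in auto)
    show "AE v in unit_sq. norm (\<integral>s. ?k n v s \<partial>unit_sq) \<le> C * (2 * D)" for n
      unfolding real_norm_def
      by (intro AE_I2 unit_sq.integral_abs_bound_const kb) (use order_trans[OF abs_ge_zero kb] in blast)
    show "(\<lambda>v. \<integral>s. ?k n v s \<partial>unit_sq) \<in> borel_measurable unit_sq" for n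
      using unit_sq.borel_measurable_lebesgue_integral[OF km] by simp
  qed auto
  then show "(\<lambda>n. bilin (X n) f g x - bilin (X n) f (rect g S S) x) \<longlonglongrightarrow> 0"
    by (simp add: eq)
qed

lemma square_means_tendsto_orbit_mean:
  assumes g: "g \<in> borel_measurable M" "\<And>x. \<bar>g x\<bar> \<le> D"
  shows "AE x in M. (\<lambda>n. rect g (real n) (real n) x) \<longlonglongrightarrow> orbit_mean g x"
  using orbit_mean_AE(1)[where f=g and C=D, OF g]
proof eventually_elim
  case (elim x)
  have "filterlim (\<lambda>n::nat. (real n, real n)) (at_top \<times>\<^sub>F at_top) sequentially"
    by (intro filterlim_Pair filterlim_real_sequentially)
  from filterlim_compose[OF elim this] show ?case by simp
qed

text \<open>
  Taking orbit means preserves integrals, so they tend to \<open>0\<close> in the mean along with the functions.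
\<close>
lemma orbit_mean_subseq_zero:
  assumes k: "\<And>n. k n \<in> borel_measurable M" "\<And>n x. 0 \<le> k n x \<and> k n x \<le> D"
    and lim: "(\<lambda>n. \<integral>x. k n x \<partial>M) \<longlonglongrightarrow> 0"
  obtains r :: "nat \<Rightarrow> nat" where "AE x in M. (\<lambda>j. orbit_mean (k (r j)) x) \<longlonglongrightarrow> 0"
proof -
  have kb: "\<bar>k n x\<bar> \<le> D" for n x using k(2)[of n x] by simp
  have nn: "0 \<le> orbit_mean (k n) x" for n x using k(2) by (intro orbit_mean_nonneg) auto
  have "(\<lambda>n. \<integral>x. \<bar>orbit_mean (k n) x\<bar> \<partial>M) \<longlonglongrightarrow> 0"
    using lim nn by (simp add: orbit_mean_AE(2)[where f="k _" and C=D, OF k(1) kb])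
  then obtain r :: "nat \<Rightarrow> nat" where "AE x in M. (\<lambda>j. orbit_mean (k (r j)) x) \<longlonglongrightarrow> 0"
    by (rule AE_subseq_zero[of "\<lambda>n. orbit_mean (k n)" D, rotated 2])
      (use orbit_mean_meas[OF k(1)] orbit_mean_bound[where f="k _" and C=D, OF kb] in auto)
  then show ?thesis by (rule that)
qed

lemma filterlim_power_pair: "filterlim (\<lambda>N::real. (2 * N ^ 2, 2 * N ^ 3)) (at_top \<times>\<^sub>F at_top) at_top"
  by (intro filterlim_Pair filterlim_tendsto_pos_mult_at_top[OF tendsto_const] filterlim_pow_at_top filterlim_ident) auto

text \<open>
  Let \<open>g'\<close> be the orbit mean of \<open>g\<close>, and \<open>g\<^sub>n\<close> the mean of \<open>g\<close> over the square of side \<open>n\<close>. Replacing \<open>g\<close> by \<open>g\<^sub>n\<close>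
  is free as \<open>N\<close> grows. The cost of replacing \<open>g\<^sub>n\<close> by \<open>g'\<close> is, up to a small constant, a multiple of the
  mean of \<open>\<bar>g\<^sub>n - g'\<bar>\<close> over a rectangle with sides \<open>2 N\<^sup>2\<close> and \<open>2 N\<^sup>3\<close>; as \<open>N\<close> grows this tends to an orbit
  mean, which is small for suitable \<open>n\<close>.
\<close>
lemma bilin_limit_uniformly_continuous:
  fixes f g :: "'a \<Rightarrow> real"
  assumes f: "f \<in> borel_measurable M" "\<And>x. \<bar>f x\<bar> \<le> C" and g: "g \<in> borel_measurable M" "\<And>x. \<bar>g x\<bar> \<le> D"
    and uc: "\<And>x. x \<in> space M \<Longrightarrow> uniformly_continuous_on UNIV (\<lambda>t. f (U t x))"
  shows "AE x in M. ((\<lambda>N. bilin N f g x - orbit_mean g x * rect f N N x) \<longlongrightarrow> 0) at_top"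
proof -
  let ?g = "\<lambda>n::nat. rect g (real n) (real n)"
  let ?h = "\<lambda>n x. ?g n x - orbit_mean g x"
  let ?k = "\<lambda>n x. \<bar>?h n x\<bar>"
  have gm: "?g n \<in> borel_measurable M" for n using g(1) by (rule rect_meas)
  have gb: "\<bar>?g n x\<bar> \<le> D" for n x by (rule rect_bound[where f=g and C=D, OF g(2)])
  have om: "orbit_mean g \<in> borel_measurable M" using g(1) by (rule orbit_mean_meas)
  have ob: "\<bar>orbit_mean g x\<bar> \<le> D" for x by (rule orbit_mean_bound[where f=g and C=D, OF g(2)])
  have hm: "?h n \<in> borel_measurable M" for n using gm om by (rule borel_measurable_diff)
  have hb: "?k n x \<le> 2 * D" for n x using gb[of x n] ob[of x] by linarith
  have km: "?k n \<in> borel_measurable M" for n using hm by (rule borel_measurable_abs)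
  have kb: "\<bar>?k n x\<bar> \<le> 2 * D" for n x using hb by simp
  have "(\<lambda>n. \<integral>x. ?k n x \<partial>M) \<longlonglongrightarrow> (\<integral>x. 0 \<partial>M)"
  proof (rule integral_dominated_convergence[where w="\<lambda>_. 2 * D"])
    show "AE x in M. (\<lambda>n. ?k n x) \<longlonglongrightarrow> 0"
      using square_means_tendsto_orbit_mean[where g=g and D=D, OF g]
      by eventually_elim (intro tendsto_rabs_zero, simp add: LIM_zero_iff)
  qed (use km hb in auto)
  then have limk: "(\<lambda>n. \<integral>x. ?k n x \<partial>M) \<longlonglongrightarrow> 0" by simp
  obtain r :: "nat \<Rightarrow> nat" where r: "AE x in M. (\<lambda>j. orbit_mean (?k (r j)) x) \<longlonglongrightarrow> 0"
    by (rule orbit_mean_subseq_zero[where k="?k" and D="2 * D", OF km _ limk]) (use hb in auto)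
  have conv: "AE x in M. \<forall>n. ((\<lambda>(a, b). rect (?k n) a b x) \<longlongrightarrow> orbit_mean (?k n) x) (at_top \<times>\<^sub>F at_top)"
    unfolding AE_all_countable by (intro allI orbit_mean_AE(1)[where f="?k _" and C="2*D", OF km kb])
  show ?thesis
    using r conv
  proof (rule AE_mp[OF _ AE_mp[OF _ AE_I2]], intro impI)
    fix x assume x: "x \<in> space M" and r: "(\<lambda>j. orbit_mean (?k (r j)) x) \<longlonglongrightarrow> 0"
      and conv: "\<forall>n. ((\<lambda>(a, b). rect (?k n) a b x) \<longlongrightarrow> orbit_mean (?k n) x) (at_top \<times>\<^sub>F at_top)"
    have C0: "0 \<le> C" using f(2)[of x] by linarith
    have D0: "0 \<le> D" using g(2)[of x] by linarith
    \<comment> \<open>Invariance makes the second factor constant along the orbit.\<close>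
    have const: "bilin N f (orbit_mean g) x = orbit_mean g x * rect f N N x" for N
      by (simp add: bilin_def rect_mean_def orbit_mean_invariant[where f=g and C=D, OF g x] scaleR_prod_def)
    show "((\<lambda>N. bilin N f g x - orbit_mean g x * rect f N N x) \<longlongrightarrow> 0) at_top"
    proof (rule tendstoI)
      fix \<epsilon> :: real assume \<epsilon>: "0 < \<epsilon>"
      \<comment> \<open>Adding \<open>1\<close> avoids a division by zero and leaves \<open>C * (2 * D * e) \<le> \<epsilon> / 3\<close>.\<close>
      define e where "e = \<epsilon> / 6 / ((C + 1) * (D + 1))"
      have pos: "0 < (C + 1) * (D + 1)" using C0 D0 by simp
      have e: "e > 0" unfolding e_def using \<epsilon> pos by (intro divide_pos_pos) auto
      have Ce: "C * (2 * D * e) \<le> \<epsilon> / 3"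
      proof -
        have "C * D \<le> (C + 1) * (D + 1)" using C0 D0 by (intro mult_mono) auto
        then have "C * D * e \<le> (C + 1) * (D + 1) * e" using e by (intro mult_right_mono) auto
        also have "\<dots> = \<epsilon> / 6"
        proof -
          have "p * (q / p) = q" if "0 < p" for p q :: real using that by simp
          from this[OF pos] show ?thesis unfolding e_def .
        qed
        finally show ?thesis by simp
      qed
      obtain K where K: "0 \<le> K" "\<And>D k. k \<in> borel_measurable borel \<Longrightarrow> (\<And>z. 0 \<le> k z \<and> k z \<le> D) \<Longrightarrow>
        (\<integral>s. k (power_sums s) \<partial>unit_sq) \<le> K * (\<integral>s. k (2 *\<^sub>R s) \<partial>unit_sq) + D * e"
        using power_sums_average_le[OF e] by blast
      have "(\<lambda>j. C * (K * orbit_mean (?k (r j)) x)) \<longlonglongrightarrow> 0"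
        using r by (intro tendsto_mult_right_zero)
      then have "\<forall>\<^sub>F j in sequentially. C * (K * orbit_mean (?k (r j)) x) < \<epsilon> / 3"
        using \<epsilon> by (intro order_tendstoD(2)) auto
      then obtain j where j: "C * (K * orbit_mean (?k (r j)) x) < \<epsilon> / 3"
        by (auto simp: eventually_sequentially)
      let ?n = "r j"
      have "((\<lambda>N. C * (K * rect (?k ?n) (2 * N ^ 2) (2 * N ^ 3) x)) \<longlongrightarrow> C * (K * orbit_mean (?k ?n) x)) at_top"
        using filterlim_compose[OF conv[rule_format, of ?n] filterlim_power_pair]
        by (intro tendsto_mult tendsto_const) simp
      then have ev1: "\<forall>\<^sub>F N in at_top. C * (K * rect (?k ?n) (2 * N ^ 2) (2 * N ^ 3) x) < \<epsilon> / 3"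
        using j by (rule order_tendstoD(2))
      have ev2: "\<forall>\<^sub>F N in at_top. dist (bilin N f g x - bilin N f (?g ?n) x) 0 < \<epsilon> / 3"
        using \<epsilon> by (intro tendstoD[OF bilin_replace_by_square_mean[where f=f and g=g and C=C and D=D, OF f g x uc[OF x]]]) auto
      show "\<forall>\<^sub>F N in at_top. dist (bilin N f g x - orbit_mean g x * rect f N N x) 0 < \<epsilon>"
        using ev1 ev2
      proof eventually_elim
        case (elim N)
        have "bilin N f g x - orbit_mean g x * rect f N N x
            = (bilin N f g x - bilin N f (?g ?n) x) + bilin N f (?h ?n) x"
          using bilin_diff_right[where f=f and C=C and g="?g ?n" and D=D and g'="orbit_mean g" and D'=D and N=N, OF f gm gb om ob x] by (simp add: const)
        moreover have "\<bar>bilin N f (?h ?n) x\<bar> \<le> C * (K * rect (?k ?n) (2 * N ^ 2) (2 * N ^ 3) x + 2 * D * e)"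
          by (rule bilin_le_right[where f=f and C=C and g="?h ?n" and D="2*D", OF K(2) f hm hb x])
        ultimately show ?case using elim Ce unfolding dist_real_def distrib_left by linarith
      qed
    qed
  qed
qed

lemma rect_uniformly_continuous:
  assumes f: "f \<in> borel_measurable M" "\<And>x. \<bar>f x\<bar> \<le> C" and x: "x \<in> space M" and \<eta>: "0 < \<eta>"
  shows "uniformly_continuous_on UNIV (\<lambda>t. rect f \<eta> \<eta> (U t x))"
  unfolding uniformly_continuous_on_sequentially
proof safe
  fix a b :: "nat \<Rightarrow> real \<times> real" assume ab: "(\<lambda>n. dist (a n) (b n)) \<longlonglongrightarrow> 0"
  let ?H = "\<lambda>n s. f (U (\<eta> *\<^sub>R s + b n) x)"
  let ?h = "\<lambda>n. inverse \<eta> *\<^sub>R (a n - b n)"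
  have "(\<lambda>n. a n - b n) \<longlonglongrightarrow> 0" using ab by (simp add: dist_norm tendsto_norm_zero_iff)
  then have h: "?h \<longlonglongrightarrow> 0" using tendsto_scaleR[OF tendsto_const] by fastforce
  have Hm: "?H n \<in> borel_measurable borel" for n
    by (rule measurable_compose[OF _ orbit_fun_meas[OF f(1) x]]) measurable
  have eq: "rect f \<eta> \<eta> (U t x) = (\<integral>s. f (U (\<eta> *\<^sub>R s + t) x) \<partial>unit_sq)" for t
    using x by (simp add: rect_mean_def U_add scaleR_prod_def)
  have "\<eta> *\<^sub>R (s + ?h n) + b n = \<eta> *\<^sub>R s + a n" for s n
    using \<eta> by (simp add: algebra_simps)
  then have "(\<lambda>n. rect f \<eta> \<eta> (U (a n) x) - rect f \<eta> \<eta> (U (b n) x)) \<longlonglongrightarrow> 0"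
    using unit_sq_shift_tendsto_0[where H="?H" and C=C and h="?h", OF Hm f(2) h] by (simp add: eq)
  then show "(\<lambda>n. dist (rect f \<eta> \<eta> (U (a n) x)) (rect f \<eta> \<eta> (U (b n) x))) \<longlonglongrightarrow> 0"
    unfolding dist_real_def by (rule tendsto_rabs_zero)
qed

text \<open>
  By invariance of the measure, \<open>x\<close> may be averaged over its translates by the unit square; along each
  single orbit the claim is the continuity of translations in the mean.
\<close>
lemma L1_continuous_action:
  fixes f :: "'a \<Rightarrow> real"
  assumes f: "f \<in> borel_measurable M" "\<And>x. \<bar>f x\<bar> \<le> C" and u: "u \<longlonglongrightarrow> 0"
  shows "(\<lambda>n. \<integral>x. \<bar>f (U (u n) x) - f x\<bar> \<partial>M) \<longlonglongrightarrow> 0"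
proof -
  let ?d = "\<lambda>n x. \<bar>f (U (u n) x) - f x\<bar>"
  have db: "\<bar>?d n x\<bar> \<le> 2 * C" for n x using f(2)[of x] f(2)[of "U (u n) x"] by linarith
  have dm: "?d n \<in> borel_measurable M" for n
    using f(1) measurable_compose[OF U_meas f(1)] by (intro borel_measurable_abs borel_measurable_diff) auto
  \<comment> \<open>Averaging over the unit square does not change the integral over the space.\<close>
  have "(\<lambda>n. \<integral>x. rect (?d n) 1 1 x \<partial>M) \<longlonglongrightarrow> (\<integral>x. 0 \<partial>M)"
  proof (rule integral_dominated_convergence[where w="\<lambda>_. 2 * C"])
    show "AE x in M. (\<lambda>n. rect (?d n) 1 1 x) \<longlonglongrightarrow> 0"
    proof (intro AE_I2)
      fix x assume x: "x \<in> space M"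
      have "rect (?d n) 1 1 x = (\<integral>s. \<bar>f (U (s + u n) x) - f (U s x)\<bar> \<partial>unit_sq)" for n
        using x by (simp add: rect_mean_def U_add[symmetric] add.commute)
      then show "(\<lambda>n. rect (?d n) 1 1 x) \<longlonglongrightarrow> 0"
        using unit_sq_translation_continuous[where H="\<lambda>t. f (U t x)" and C=C, OF orbit_fun_meas[OF f(1) x] f(2) u]
        by simp
    qed
    show "AE x in M. norm (rect (?d n) 1 1 x) \<le> 2 * C" for n
      unfolding real_norm_def using rect_bound[where f="?d n" and C="2*C", OF db] by blast
  qed (use rect_meas[OF dm] in auto)
  then show ?thesis by (simp add: integral_rect[where f="?d _" and C="2*C", OF dm db])
qed

lemma small_rect_L1:
  assumes f: "f \<in> borel_measurable M" "\<And>x. \<bar>f x\<bar> \<le> C"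
  shows "(\<lambda>n. \<integral>x. \<bar>f x - rect f (inverse (Suc n)) (inverse (Suc n)) x\<bar> \<partial>M) \<longlonglongrightarrow> 0"
proof -
  let ?\<eta> = "\<lambda>n. inverse (real (Suc n))"
  let ?d = "\<lambda>n x s. \<bar>f (U (?\<eta> n *\<^sub>R s) x) - f x\<bar>"
  note [measurable] = f(1)
  have db: "\<bar>?d n x s\<bar> \<le> 2 * C" for n x s using f(2)[of x] f(2)[of "U (?\<eta> n *\<^sub>R s) x"] by linarith
  have C0: "0 \<le> C" using f(2)[of undefined] by linarith
  have dm: "(\<lambda>(x, s). ?d n x s) \<in> borel_measurable (M \<Otimes>\<^sub>M unit_sq)" for n
  proof -
    have [measurable]: "(\<lambda>(x, s). f (U (?\<eta> n *\<^sub>R s) x)) \<in> borel_measurable (M \<Otimes>\<^sub>M unit_sq)"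
      by (rule joint_avg_meas) measurable
    have "(\<lambda>p. \<bar>(\<lambda>(x, s). f (U (?\<eta> n *\<^sub>R s) x)) p - f (fst p)\<bar>) \<in> borel_measurable (M \<Otimes>\<^sub>M unit_sq)"
      by measurable
    then show ?thesis by (simp add: case_prod_beta')
  qed
  have \<eta>: "?\<eta> \<longlonglongrightarrow> 0" by (rule LIMSEQ_inverse_real_of_nat)
  have "(\<lambda>n. \<integral>s. (\<integral>x. ?d n x s \<partial>M) \<partial>unit_sq) \<longlonglongrightarrow> (\<integral>s. 0 \<partial>unit_sq)"
  proof (rule integral_dominated_convergence[where w="\<lambda>_. 2 * C"])
    show "AE s in unit_sq. (\<lambda>n. \<integral>x. ?d n x s \<partial>M) \<longlonglongrightarrow> 0"
    proof (intro AE_I2 L1_continuous_action[where f=f and C=C, OF f])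
      fix s :: "real \<times> real"
      show "(\<lambda>n. ?\<eta> n *\<^sub>R s) \<longlonglongrightarrow> 0" using tendsto_scaleR[OF \<eta> tendsto_const, of s] by simp
    qed
    show "AE s in unit_sq. norm (\<integral>x. ?d n x s \<partial>M) \<le> 2 * C" for n
      unfolding real_norm_def using C0 by (intro AE_I2 integral_abs_bound_const db) auto
    have "(\<lambda>(s, x). ?d n x s) \<in> borel_measurable (unit_sq \<Otimes>\<^sub>M M)" for n
      using measurable_pair_swap[OF dm] by (simp add: case_prod_beta')
    from borel_measurable_lebesgue_integral[OF this]
    show "(\<lambda>s. \<integral>x. ?d n x s \<partial>M) \<in> borel_measurable unit_sq" for n by simp
  qed auto
  moreover have "(\<integral>s. (\<integral>x. ?d n x s \<partial>M) \<partial>unit_sq) = (\<integral>x. (\<integral>s. ?d n x s \<partial>unit_sq) \<partial>M)" for n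
    by (rule fubini_bounded[OF unit_sq.prob_space_axioms dm db, symmetric])
  ultimately have lim: "(\<lambda>n. \<integral>x. (\<integral>s. ?d n x s \<partial>unit_sq) \<partial>M) \<longlonglongrightarrow> 0" by simp
  show ?thesis
  proof (rule Lim_null_comparison[OF always_eventually lim], rule allI)
    fix n
    have "norm (\<integral>x. \<bar>f x - rect f (?\<eta> n) (?\<eta> n) x\<bar> \<partial>M) = (\<integral>x. \<bar>f x - rect f (?\<eta> n) (?\<eta> n) x\<bar> \<partial>M)"
      by (simp add: integral_nonneg_AE)
    also have "\<dots> \<le> (\<integral>x. (\<integral>s. ?d n x s \<partial>unit_sq) \<partial>M)"
    proof (rule integral_mono)
      show "integrable M (\<lambda>x. \<bar>f x - rect f (?\<eta> n) (?\<eta> n) x\<bar>)"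
      proof (rule integrable_bounded[where C="2 * C"])
        show "\<bar>\<bar>f x - rect f (?\<eta> n) (?\<eta> n) x\<bar>\<bar> \<le> 2 * C" for x
          using f(2)[of x] rect_bound[where f=f and C=C and x=x and a="?\<eta> n" and b="?\<eta> n", OF f(2)] by linarith
      qed measurable
      show "integrable M (\<lambda>x. \<integral>s. ?d n x s \<partial>unit_sq)"
      proof (rule integrable_bounded[where C="2 * C"])
        show "(\<lambda>x. \<integral>s. ?d n x s \<partial>unit_sq) \<in> borel_measurable M"
          using unit_sq.borel_measurable_lebesgue_integral[OF dm] by simp
        show "\<bar>\<integral>s. ?d n x s \<partial>unit_sq\<bar> \<le> 2 * C" for x
          using C0 by (intro unit_sq.integral_abs_bound_const db) auto
      qed
      fix x assume x: "x \<in> space M"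
      have m[measurable]: "(\<lambda>s. f (U (?\<eta> n *\<^sub>R s) x)) \<in> borel_measurable borel"
        by (rule bilin_orbit_meas(1)[OF f(1) f(1) x])
      have i: "integrable unit_sq (\<lambda>s. f (U (?\<eta> n *\<^sub>R s) x))"
        using f(2) m by (intro unit_sq.integrable_bounded[where C=C]) (simp_all only: measurable_unit_sq)
      have "f x - rect f (?\<eta> n) (?\<eta> n) x = (\<integral>s. f x - f (U (?\<eta> n *\<^sub>R s) x) \<partial>unit_sq)"
        using i by (simp add: rect_mean_def scaleR_prod_def)
      also have "\<bar>\<dots>\<bar> \<le> (\<integral>s. ?d n x s \<partial>unit_sq)"
        using i by (intro Bochner_Integration.integral_abs_bound_integral) auto
      finally show "\<bar>f x - rect f (?\<eta> n) (?\<eta> n) x\<bar> \<le> (\<integral>s. ?d n x s \<partial>unit_sq)" .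
    qed
    finally show "norm (\<integral>x. \<bar>f x - rect f (?\<eta> n) (?\<eta> n) x\<bar> \<partial>M) \<le> (\<integral>x. (\<integral>s. ?d n x s \<partial>unit_sq) \<partial>M)" .
  qed
qed

text \<open>
  The error of replacing \<open>f\<close> by its mean over a small square is at most the bound of \<open>g\<close> times a mean over
  \<open>[0,N]\<^sup>2\<close> of the absolute difference. As \<open>N\<close> grows this tends to an orbit mean, which is small along a
  subsequence of squares.
\<close>
theorem bilin_limit:
  assumes f: "f \<in> borel_measurable M" "\<And>x. \<bar>f x\<bar> \<le> C" and g: "g \<in> borel_measurable M" "\<And>x. \<bar>g x\<bar> \<le> D"
  shows "AE x in M. ((\<lambda>N. bilin N f g x) \<longlongrightarrow> orbit_mean f x * orbit_mean g x) at_top"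
proof -
  let ?f = "\<lambda>n::nat. rect f (inverse (Suc n)) (inverse (Suc n))"
  let ?h = "\<lambda>n x. f x - ?f n x"
  let ?k = "\<lambda>n x. \<bar>?h n x\<bar>"
  have fm: "?f n \<in> borel_measurable M" for n using f(1) by (rule rect_meas)
  have fb: "\<bar>?f n x\<bar> \<le> C" for n x by (rule rect_bound[where f=f and C=C, OF f(2)])
  have hm: "?h n \<in> borel_measurable M" for n using f(1) fm by (rule borel_measurable_diff)
  have hb: "?k n x \<le> 2 * C" for n x using fb[of x n] f(2)[of x] by linarith
  have km: "?k n \<in> borel_measurable M" for n using hm by (rule borel_measurable_abs)
  have kb: "\<bar>?k n x\<bar> \<le> 2 * C" for n x using hb by simp
  obtain r :: "nat \<Rightarrow> nat" where r: "AE x in M. (\<lambda>j. orbit_mean (?k (r j)) x) \<longlonglongrightarrow> 0"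
    by (rule orbit_mean_subseq_zero[where k="?k" and D="2 * C", OF km _ small_rect_L1[where f=f and C=C, OF f]])
      (use hb in auto)
  have conv: "AE x in M. \<forall>n. ((\<lambda>(a, b). rect (?k n) a b x) \<longlongrightarrow> orbit_mean (?k n) x) (at_top \<times>\<^sub>F at_top)"
    unfolding AE_all_countable by (intro allI orbit_mean_AE(1)[where f="?k _" and C="2*C", OF km kb])
  have main: "AE x in M. \<forall>n. ((\<lambda>N. bilin N (?f n) g x - orbit_mean g x * rect (?f n) N N x) \<longlongrightarrow> 0) at_top"
    unfolding AE_all_countable
    by (intro allI bilin_limit_uniformly_continuous[where C=C and D=D, OF fm fb g] rect_uniformly_continuous[where f=f and C=C, OF f]) auto
  have fconv: "AE x in M. ((\<lambda>(a, b). rect f a b x) \<longlongrightarrow> orbit_mean f x) (at_top \<times>\<^sub>F at_top)"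
    by (rule orbit_mean_AE(1)[where f=f and C=C, OF f])
  show ?thesis
    using r conv main fconv
  proof (rule AE_mp[OF _ AE_mp[OF _ AE_mp[OF _ AE_mp[OF _ AE_I2]]]], intro impI)
    fix x assume x: "x \<in> space M" and r: "(\<lambda>j. orbit_mean (?k (r j)) x) \<longlonglongrightarrow> 0"
      and conv: "\<forall>n. ((\<lambda>(a, b). rect (?k n) a b x) \<longlongrightarrow> orbit_mean (?k n) x) (at_top \<times>\<^sub>F at_top)"
      and main: "\<forall>n. ((\<lambda>N. bilin N (?f n) g x - orbit_mean g x * rect (?f n) N N x) \<longlongrightarrow> 0) at_top"
      and fconv: "((\<lambda>(a, b). rect f a b x) \<longlongrightarrow> orbit_mean f x) (at_top \<times>\<^sub>F at_top)"
    have D0: "0 \<le> D" using g(2)[of x] by linarith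
    have diag: "filterlim (\<lambda>N::real. (N, N)) (at_top \<times>\<^sub>F at_top) at_top"
      by (intro filterlim_Pair filterlim_ident)
    have "((\<lambda>N. bilin N f g x - orbit_mean g x * rect f N N x) \<longlongrightarrow> 0) at_top"
    proof (rule tendstoI)
      fix \<epsilon> :: real assume \<epsilon>: "0 < \<epsilon>"
      have "(\<lambda>j. 2 * D * orbit_mean (?k (r j)) x) \<longlonglongrightarrow> 0"
        using r by (intro tendsto_mult_right_zero)
      then have "\<forall>\<^sub>F j in sequentially. 2 * D * orbit_mean (?k (r j)) x < \<epsilon> / 2"
        using \<epsilon> by (intro order_tendstoD(2)) auto
      then obtain j where j: "2 * D * orbit_mean (?k (r j)) x < \<epsilon> / 2"
        by (auto simp: eventually_sequentially)
      let ?n = "r j"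
      have "((\<lambda>N. 2 * D * rect (?k ?n) N N x) \<longlongrightarrow> 2 * D * orbit_mean (?k ?n) x) at_top"
        using filterlim_compose[OF conv[rule_format, of ?n] diag]
        by (intro tendsto_mult tendsto_const) simp
      then have ev1: "\<forall>\<^sub>F N in at_top. 2 * D * rect (?k ?n) N N x < \<epsilon> / 2"
        using j by (rule order_tendstoD(2))
      have ev2: "\<forall>\<^sub>F N in at_top. dist (bilin N (?f ?n) g x - orbit_mean g x * rect (?f ?n) N N x) 0 < \<epsilon> / 2"
        using \<epsilon> by (intro tendstoD[OF main[rule_format]]) auto
      show "\<forall>\<^sub>F N in at_top. dist (bilin N f g x - orbit_mean g x * rect f N N x) 0 < \<epsilon>"
        using ev1 ev2
      proof eventually_elim
        case (elim N)
        have const: "bilin N k (\<lambda>_. 1) x = rect k N N x" for k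
          by (simp add: bilin_def rect_mean_def scaleR_prod_def)
        have 1: "bilin N f g x - bilin N (?f ?n) g x = bilin N (?h ?n) g x"
          by (rule bilin_diff_left[where f=f and C=C and f'="?f ?n" and C'=C and g=g and D=D, OF f fm fb g x])
        have 2: "rect f N N x - rect (?f ?n) N N x = bilin N (?h ?n) (\<lambda>_. 1) x"
          using bilin_diff_left[where f=f and C=C and f'="?f ?n" and C'=C and g="\<lambda>_. 1" and D=1 and N=N, OF f fm fb _ _ x] by (simp add: const)
        have 3: "\<bar>bilin N (?h ?n) g x\<bar> \<le> D * rect (?k ?n) N N x"
          by (rule bilin_le_left[where f="?h ?n" and C="2*C" and g=g and D=D, OF hm hb g x])
        have "\<bar>bilin N (?h ?n) (\<lambda>_. 1) x\<bar> \<le> 1 * rect (?k ?n) N N x"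
          by (rule bilin_le_left[where f="?h ?n" and C="2*C" and g="\<lambda>_. 1" and D=1, OF hm hb _ _ x]) auto
        then have 4: "\<bar>orbit_mean g x * bilin N (?h ?n) (\<lambda>_. 1) x\<bar> \<le> D * rect (?k ?n) N N x"
          unfolding abs_mult using orbit_mean_bound[where f=g and C=D and x=x, OF g(2)] D0 by (intro mult_mono) auto
        have "bilin N f g x - orbit_mean g x * rect f N N x
          = (bilin N (?f ?n) g x - orbit_mean g x * rect (?f ?n) N N x)
            + bilin N (?h ?n) g x - orbit_mean g x * bilin N (?h ?n) (\<lambda>_. 1) x"
          unfolding 1[symmetric] 2[symmetric] by (simp add: algebra_simps)
        then show ?case using elim 3 4 unfolding dist_real_def by linarith
      qed
    qed
    moreover have "((\<lambda>N. orbit_mean g x * rect f N N x) \<longlongrightarrow> orbit_mean g x * orbit_mean f x) at_top"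
      using filterlim_compose[OF fconv diag] by (intro tendsto_mult tendsto_const) simp
    ultimately have "((\<lambda>N. (bilin N f g x - orbit_mean g x * rect f N N x) + orbit_mean g x * rect f N N x)
        \<longlongrightarrow> 0 + orbit_mean g x * orbit_mean f x) at_top"
      by (rule tendsto_add)
    then show "((\<lambda>N. bilin N f g x) \<longlongrightarrow> orbit_mean f x * orbit_mean g x) at_top"
      by (simp add: mult.commute)
  qed
qed

end

section \<open>Commuting flows\<close>

lemma plane_action_of_flows:
  assumes "prob_space M" and T1: "measure_preserving_flow M T1" and T2: "measure_preserving_flow M T2"
    and comm: "commuting_flows M T1 T2"
    and meas: "(\<lambda>(x, t1, t2). T1 t1 (T2 t2 x)) \<in> measurable (M \<Otimes>\<^sub>M (borel :: (real \<times> real) measure)) M"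
  shows "plane_action M (\<lambda>t x. T1 (fst t) (T2 (snd t) x))"
proof -
  interpret prob_space M by fact
  have m: "T1 s \<in> measurable M M" "T2 s \<in> measurable M M" for s
    using T1 T2 by (auto simp: measure_preserving_flow_def measure_preserving_map_def)
  have d: "distr M M (T1 s) = M" "distr M M (T2 s) = M" for s
    using T1 T2 by (auto simp: measure_preserving_flow_def measure_preserving_map_def)
  have sp: "T1 s x \<in> space M" "T2 s x \<in> space M" if "x \<in> space M" for s x
    using measurable_space[OF m(1) that] measurable_space[OF m(2) that] by auto
  show ?thesis
  proof
    show "(\<lambda>(x, t). T1 (fst t) (T2 (snd t) x)) \<in> measurable (M \<Otimes>\<^sub>M borel) M"
      using meas by (simp add: case_prod_beta')
    fix x assume x: "x \<in> space M"
    show "T1 (fst 0) (T2 (snd 0) x) = x"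
      using T1 T2 x by (simp add: measure_preserving_flow_def)
    fix s t :: "real \<times> real"
    have "T1 (fst s + fst t) (T2 (snd s + snd t) x) = T1 (fst s) (T1 (fst t) (T2 (snd s) (T2 (snd t) x)))"
      using T1 T2 x sp by (simp add: measure_preserving_flow_def)
    also have "T1 (fst t) (T2 (snd s) (T2 (snd t) x)) = T2 (snd s) (T1 (fst t) (T2 (snd t) x))"
      using comm sp[OF x] by (simp add: commuting_flows_def)
    finally show "T1 (fst (s + t)) (T2 (snd (s + t)) x) = T1 (fst s) (T2 (snd s) (T1 (fst t) (T2 (snd t) x)))"
      by simp
  next
    fix t :: "real \<times> real"
    have "distr M M (\<lambda>x. T1 (fst t) (T2 (snd t) x)) = distr (distr M M (T2 (snd t))) M (T1 (fst t))"
      by (subst distr_distr[OF m]) (simp add: o_def)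
    then show "distr M M (\<lambda>x. T1 (fst t) (T2 (snd t) x)) = M" by (simp add: d)
  qed
qed

context plane_action begin

text \<open>
  This makes the averages independent of the choice of representatives of \<open>f\<close> and \<open>g\<close>: each map \<open>U t\<close>
  preserves null sets, and Fubini exchanges the two almost-everywhere quantifiers.
\<close>
lemma AE_along_orbit:
  fixes \<phi> :: "real \<times> real \<Rightarrow> real \<times> real"
  assumes "AE y in M. P y" and [measurable]: "\<phi> \<in> borel_measurable borel"
  shows "AE x in M. AE t in lborel. P (U (\<phi> t) x)"
proof -
  obtain N where N: "{y \<in> space M. \<not> P y} \<subseteq> N" "emeasure M N = 0" "N \<in> sets M"
    using assms(1) by (rule AE_E)
  note [measurable] = N(3)
  interpret pair_sigma_finite M "lborel :: (real \<times> real) measure" ..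
  have nN: "AE y in M. y \<notin> N" using N by (intro AE_not_in) auto
  have "(\<lambda>p. U (\<phi> (snd p)) (fst p)) \<in> measurable (M \<Otimes>\<^sub>M lborel) M"
  proof -
    have "(\<lambda>p. (\<lambda>(x, t). U t x) (fst p, \<phi> (snd p))) \<in> measurable (M \<Otimes>\<^sub>M lborel) M" by measurable
    then show ?thesis by simp
  qed
  note [measurable] = this
  have "AE t in lborel. AE x in M. U (\<phi> t) x \<notin> N"
  proof (rule AE_I2)
    fix t :: "real \<times> real"
    have "AE y in distr M M (U (\<phi> t)). y \<notin> N" using nN unfolding U_distr .
    then show "AE x in M. U (\<phi> t) x \<notin> N" by (subst (asm) AE_distr_iff) auto
  qed
  moreover have "{p \<in> space (M \<Otimes>\<^sub>M lborel). U (\<phi> (snd p)) (fst p) \<notin> N} \<in> sets (M \<Otimes>\<^sub>M lborel)"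
    by measurable
  ultimately have "AE x in M. AE t in lborel. U (\<phi> t) x \<notin> N"
    by (subst AE_commute)
  then show ?thesis
    using AE_space
  proof eventually_elim
    case (elim x)
    from elim(1) show "AE t in lborel. P (U (\<phi> t) x)"
      by eventually_elim (use N(1) U_space[OF elim(2)] in blast)
  qed
qed

lemma bilin_eq_box_integral:
  fixes f g :: "'a \<Rightarrow> real"
  assumes "f \<in> borel_measurable M" "g \<in> borel_measurable M" "x \<in> space M" "0 < N"
  shows "N ^ 2 * bilin N f g x =
    (\<integral>t. indicator ({0..N} \<times> {0..N}) t * (f (U t x) * g (U (power_sums t) x)) \<partial>lborel)"
proof -
  note [measurable] = orbit_fun_meas[OF assms(1,3)] orbit_fun_meas[OF assms(2,3)]
  have "(\<lambda>t. f (U t x) * g (U (power_sums t) x)) \<in> borel_measurable borel" by measurable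
  from integral_unit_sq_scale[OF this assms(4,4)] show ?thesis
    unfolding bilin_def power_sums_scaleR[symmetric] by (simp add: scaleR_prod_def power2_eq_square)
qed

lemma complex_box_average:
  fixes fr fi gr gi :: "'a \<Rightarrow> real"
  assumes m: "fr \<in> borel_measurable M" "fi \<in> borel_measurable M" "gr \<in> borel_measurable M" "gi \<in> borel_measurable M"
    and bd: "\<And>x. \<bar>fr x\<bar> \<le> C" "\<And>x. \<bar>fi x\<bar> \<le> C" "\<And>x. \<bar>gr x\<bar> \<le> D" "\<And>x. \<bar>gi x\<bar> \<le> D"
    and x: "x \<in> space M" and N: "0 < N"
  shows "(1 / N\<^sup>2) *\<^sub>R (\<integral>t. indicator ({0..N} \<times> {0..N}) t *\<^sub>R
      (Complex (fr (U t x)) (fi (U t x)) * Complex (gr (U (power_sums t) x)) (gi (U (power_sums t) x))) \<partial>lborel)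
    = Complex (bilin N fr gr x - bilin N fi gi x) (bilin N fr gi x + bilin N fi gr x)"
proof -
  let ?A = "{0..N} \<times> {0..N} :: (real \<times> real) set"
  let ?p = "\<lambda>f g t. indicator ?A t * (f (U t x) * g (U (power_sums t) x)) :: real"
  have int: "integrable lborel (?p f g)"
    if "f \<in> borel_measurable M" "g \<in> borel_measurable M" "\<And>x. \<bar>f x\<bar> \<le> C" "\<And>x. \<bar>g x\<bar> \<le> D" for f g :: "'a \<Rightarrow> real"
  proof (rule integrable_box[where C="C * D"])
    note [measurable] = orbit_fun_meas[OF that(1) x] orbit_fun_meas[OF that(2) x]
    show "(\<lambda>t. f (U t x) * g (U (power_sums t) x)) \<in> borel_measurable borel" by measurable
    have "0 \<le> C" using that(3)[of x] by linarith
    then show "\<bar>f (U t x) * g (U (power_sums t) x)\<bar> \<le> C * D" for t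
      unfolding abs_mult using that(3,4) by (intro mult_mono) auto
    show "emeasure lborel ?A < \<infinity>" using N by (simp add: emeasure_box)
  qed measurable
  have i: "integrable lborel (?p fr gr)" "integrable lborel (?p fi gi)" "integrable lborel (?p fr gi)" "integrable lborel (?p fi gr)"
    by (rule int; fact)+
  have "(\<integral>t. indicator ?A t *\<^sub>R
      (Complex (fr (U t x)) (fi (U t x)) * Complex (gr (U (power_sums t) x)) (gi (U (power_sums t) x))) \<partial>lborel)
    = (\<integral>t. complex_of_real (?p fr gr t - ?p fi gi t) + \<i> * complex_of_real (?p fr gi t + ?p fi gr t) \<partial>lborel)"
    by (intro Bochner_Integration.integral_cong refl) (auto simp: complex_eq_iff split: split_indicator)
  also have "\<dots> = complex_of_real (\<integral>t. ?p fr gr t - ?p fi gi t \<partial>lborel) + \<i> * complex_of_real (\<integral>t. ?p fr gi t + ?p fi gr t \<partial>lborel)"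
    using i by (subst Bochner_Integration.integral_add) (auto simp del: of_real_add of_real_diff)
  also have "(\<integral>t. ?p fr gr t - ?p fi gi t \<partial>lborel) = N ^ 2 * (bilin N fr gr x - bilin N fi gi x)"
    using i by (simp add: right_diff_distrib bilin_eq_box_integral m x N)
  also have "(\<integral>t. ?p fr gi t + ?p fi gr t \<partial>lborel) = N ^ 2 * (bilin N fr gi x + bilin N fi gr x)"
    using i by (simp add: distrib_left bilin_eq_box_integral m x N)
  finally show ?thesis using N by (simp add: complex_eq_iff)
qed

end

text \<open>
  The function is set to \<open>0\<close> on the null set where it exceeds its essential bound, so that the parts are
  bounded everywhere.
\<close>
lemma L_infinity_bounded_parts:
  assumes "f \<in> L_infinity M"
  obtains fr fi :: "'a \<Rightarrow> real" and C :: real where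
    "fr \<in> borel_measurable M" "fi \<in> borel_measurable M" "\<And>x. \<bar>fr x\<bar> \<le> C" "\<And>x. \<bar>fi x\<bar> \<le> C"
    "AE x in M. f x = Complex (fr x) (fi x)"
proof -
  obtain C where [measurable]: "f \<in> borel_measurable M" and C: "AE x in M. norm (f x) \<le> C"
    using assms by (auto simp: L_infinity_def)
  let ?f = "\<lambda>x. if norm (f x) \<le> C then f x else 0"
  show ?thesis
  proof (rule that[of "\<lambda>x. Re (?f x)" "\<lambda>x. Im (?f x)" "\<bar>C\<bar>"])
    show "AE x in M. f x = Complex (Re (?f x)) (Im (?f x))" using C by eventually_elim simp
    show "\<bar>Re (?f x)\<bar> \<le> \<bar>C\<bar>" "\<bar>Im (?f x)\<bar> \<le> \<bar>C\<bar>" for x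
      using abs_Re_le_cmod[of "f x"] abs_Im_le_cmod[of "f x"] by auto
  qed measurable
qed

theorem theorem3:
  fixes M :: "'a measure"
    and T1 T2 :: "real \<Rightarrow> 'a \<Rightarrow> 'a"
    and f g :: "'a \<Rightarrow> complex"
  assumes "prob_space M"
    and "measure_preserving_flow M T1"
    and "measure_preserving_flow M T2"
    and "commuting_flows M T1 T2"
    and "(\<lambda>(x, t1, t2). T1 t1 (T2 t2 x)) \<in> measurable (M \<Otimes>\<^sub>M (borel :: (real \<times> real) measure)) M"
    and "f \<in> L_infinity M"
    and "g \<in> L_infinity M"
  shows "AE x in M. \<exists>L. ((\<lambda>N. double_average T1 T2 f g N x) \<longlongrightarrow> L) at_top"
proof -
  define U where "U t x = T1 (fst t) (T2 (snd t) x)" for t x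
  interpret plane_action M U
    unfolding U_def[abs_def] by (rule plane_action_of_flows[OF assms(1-5)])
  obtain fr fi C where f: "fr \<in> borel_measurable M" "fi \<in> borel_measurable M" "\<And>x. \<bar>fr x\<bar> \<le> C" "\<And>x. \<bar>fi x\<bar> \<le> C"
    "AE x in M. f x = Complex (fr x) (fi x)" using L_infinity_bounded_parts[OF assms(6)] by blast
  obtain gr gi D where g: "gr \<in> borel_measurable M" "gi \<in> borel_measurable M" "\<And>x. \<bar>gr x\<bar> \<le> D" "\<And>x. \<bar>gi x\<bar> \<le> D"
    "AE x in M. g x = Complex (gr x) (gi x)" using L_infinity_bounded_parts[OF assms(7)] by blast
  have [measurable]: "f \<in> borel_measurable M" "g \<in> borel_measurable M"
    using assms(6,7) by (auto simp: L_infinity_def)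
  note lims = bilin_limit[where f=fr and g=gr and C=C and D=D, OF f(1,3) g(1,3)]
    bilin_limit[where f=fi and g=gi and C=C and D=D, OF f(2,4) g(2,4)]
    bilin_limit[where f=fr and g=gi and C=C and D=D, OF f(1,3) g(2,4)]
    bilin_limit[where f=fi and g=gr and C=C and D=D, OF f(2,4) g(1,3)]
  have "AE x in M. AE t in lborel. f (U t x) = Complex (fr (U t x)) (fi (U t x))"
    using AE_along_orbit[OF f(5), of "\<lambda>t. t"] by simp
  moreover have "AE x in M. AE t in lborel. g (U (power_sums t) x) = Complex (gr (U (power_sums t) x)) (gi (U (power_sums t) x))"
    using AE_along_orbit[OF g(5) power_sums_borel] .
  ultimately show ?thesis
    using lims AE_space
  proof eventually_elim
    case (elim x)
    let ?c = "\<lambda>N. Complex (bilin N fr gr x - bilin N fi gi x) (bilin N fr gi x + bilin N fi gr x)"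
    let ?h = "\<lambda>t. f (U t x) * g (U (power_sums t) x)"
    let ?h' = "\<lambda>t. Complex (fr (U t x)) (fi (U t x)) * Complex (gr (U (power_sums t) x)) (gi (U (power_sums t) x))"
    have x: "x \<in> space M" by fact
    note om = U_orbit_meas[OF x]
    note [measurable] = measurable_compose[OF om f(1)] measurable_compose[OF om f(2)]
      measurable_compose[OF om g(1)] measurable_compose[OF om g(2)]
    have fm[measurable]: "(\<lambda>t. f (U t x)) \<in> borel_measurable borel" "(\<lambda>t. g (U t x)) \<in> borel_measurable borel"
      by (auto intro!: measurable_compose[OF om])
    have avg: "double_average T1 T2 f g N x = ?c N" if "0 < N" for N
    proof -
      let ?A = "{0..N} \<times> {0..N} :: (real \<times> real) set"
      have "(\<integral>t. indicator ?A t *\<^sub>R ?h t \<partial>lborel) = (\<integral>t. indicator ?A t *\<^sub>R ?h' t \<partial>lborel)"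
      proof (rule integral_cong_AE)
        show "AE t in lborel. indicator ?A t *\<^sub>R ?h t = indicator ?A t *\<^sub>R ?h' t"
          using elim(1,2) by eventually_elim simp
        show "(\<lambda>t. indicator ?A t *\<^sub>R ?h t) \<in> borel_measurable lborel" by measurable
        show "(\<lambda>t. indicator ?A t *\<^sub>R ?h' t) \<in> borel_measurable lborel"
          unfolding Complex_eq by measurable
      qed
      then show ?thesis
        using complex_box_average[where C=C and D=D, OF f(1,2) g(1,2) f(3,4) g(3,4) x that]
        by (simp add: double_average_def set_lebesgue_integral_def U_def power_sums_def case_prod_beta')
    qed
    have "(?c \<longlongrightarrow> Complex (orbit_mean fr x * orbit_mean gr x - orbit_mean fi x * orbit_mean gi x)
        (orbit_mean fr x * orbit_mean gi x + orbit_mean fi x * orbit_mean gr x)) at_top"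
      by (intro tendsto_Complex tendsto_diff tendsto_add elim)
    moreover have "\<forall>\<^sub>F N in at_top. double_average T1 T2 f g N x = ?c N"
      using eventually_gt_at_top[of 0] by eventually_elim (rule avg)
    ultimately show "\<exists>L. ((\<lambda>N. double_average T1 T2 f g N x) \<longlongrightarrow> L) at_top"
      by (intro exI) (simp add: tendsto_cong)
  qed
qed

end
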